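(* Let $(W,S)$ be a Coxeter system of finite rank, $c$ a Coxeter element, and $t$ a $c$-accessible reflection. Then there exists a unique $c$-sortable join-irreducible element $j$ whose unique cover reflection is $t$. Furthermore, $j$ is the unique minimal element (in the right weak order) among $c$-sortable elements having $t$ as an inversion.
   Context: $T$ = reflections; $\mathrm{inv}(w)=\{t\in T:\ell(tw)<\ell(w)\}$ (inversions); weak order $v\le w$ iff $\mathrm{inv}(v)\subseteq\mathrm{inv}(w)$. A cover reflection of $w$ is $t\in\mathrm{inv}(w)$ with $tw=ws$ for some $s\in S$. An element is join-irreducible if it covers exactly one element in the weak order (equivalently, has exactly one cover reflection). Coxeter element $c=s_1\cdots s_n$ (all of $S$ in some order); the $c$-sorting word of $w$ is the lexicographically first (by positions) subword of $(s_1\cdots s_n)^\infty$ that is a reduced word for $w$; $w$ is $c$-sortable if the sets of letters in successive copies of $s_1\cdots s_n$ weakly decrease under inclusion. A reflection is $c$-accessible if it is an inversion of some $c$-sortable element. *)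

theory Defs
  imports "HOL-Algebra.Generated_Groups"
begin

section \<open>Coxeter systems\<close>

definition word_prod :: "('a, 'b) monoid_scheme \<Rightarrow> 'a list \<Rightarrow> 'a" where
  "word_prod G ws = foldr (mult G) ws (one G)"

text \<open>The entry \<open>0\<close> of a Coxeter matrix stands for \<open>\<infinity>\<close>.\<close>

definition coxeter_matrix :: "'a set \<Rightarrow> ('a \<Rightarrow> 'a \<Rightarrow> nat) \<Rightarrow> bool" where
  "coxeter_matrix S m \<longleftrightarrow>
     (\<forall>s\<in>S. m s s = 1) \<and> (\<forall>s\<in>S. \<forall>t\<in>S. m s t = m t s \<and> (s \<noteq> t \<longrightarrow> m s t \<noteq> 1))"

text \<open>
  One application of a defining relation \<open>(st)\<^bsup>m s t\<^esup> = 1\<close>. For \<open>m s t = 0\<close> (no relation) the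
  relator is the empty word. As \<open>m s s = 1\<close> contributes \<open>ss = 1\<close>, generators are their own
  inverses, so presenting the group by positive words is the same as presenting it as a quotient
  of the free group.
\<close>

definition relator_step :: "'a set \<Rightarrow> ('a \<Rightarrow> 'a \<Rightarrow> nat) \<Rightarrow> 'a list \<Rightarrow> 'a list \<Rightarrow> bool" where
  "relator_step S m ws ws' \<longleftrightarrow>
     (\<exists>u v. \<exists>s\<in>S. \<exists>t\<in>S. ws = u @ concat (replicate (m s t) [s, t]) @ v \<and> ws' = u @ v)"

definition coxeter_system :: "('a, 'b) monoid_scheme \<Rightarrow> 'a set \<Rightarrow> bool" where
  "coxeter_system G S \<longleftrightarrow>
     group G \<and> S \<subseteq> carrier G \<and> generate G S = carrier G \<and>
     (\<exists>m. coxeter_matrix S m \<and>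
        (\<forall>u\<in>lists S. \<forall>v\<in>lists S.
           word_prod G u = word_prod G v \<longleftrightarrow> equivclp (relator_step S m) u v))"

definition cox_length :: "('a, 'b) monoid_scheme \<Rightarrow> 'a set \<Rightarrow> 'a \<Rightarrow> nat" where
  "cox_length G S w = (LEAST k. \<exists>ws\<in>lists S. length ws = k \<and> word_prod G ws = w)"

definition reduced_word_for :: "('a, 'b) monoid_scheme \<Rightarrow> 'a set \<Rightarrow> 'a \<Rightarrow> 'a list \<Rightarrow> bool" where
  "reduced_word_for G S w ws \<longleftrightarrow>
     ws \<in> lists S \<and> word_prod G ws = w \<and> length ws = cox_length G S w"


section \<open>Reflections, inversions and the weak order\<close>

definition reflections :: "('a, 'b) monoid_scheme \<Rightarrow> 'a set \<Rightarrow> 'a set" where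
  "reflections G S = {w \<otimes>\<^bsub>G\<^esub> s \<otimes>\<^bsub>G\<^esub> inv\<^bsub>G\<^esub> w | w s. w \<in> carrier G \<and> s \<in> S}"

definition inversions :: "('a, 'b) monoid_scheme \<Rightarrow> 'a set \<Rightarrow> 'a \<Rightarrow> 'a set" where
  "inversions G S w =
     {t \<in> reflections G S. cox_length G S (t \<otimes>\<^bsub>G\<^esub> w) < cox_length G S w}"

definition weak_le :: "('a, 'b) monoid_scheme \<Rightarrow> 'a set \<Rightarrow> 'a \<Rightarrow> 'a \<Rightarrow> bool" where
  "weak_le G S v w \<longleftrightarrow> inversions G S v \<subseteq> inversions G S w"

definition weak_less :: "('a, 'b) monoid_scheme \<Rightarrow> 'a set \<Rightarrow> 'a \<Rightarrow> 'a \<Rightarrow> bool" where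
  "weak_less G S v w \<longleftrightarrow> weak_le G S v w \<and> v \<noteq> w"

definition weak_covers :: "('a, 'b) monoid_scheme \<Rightarrow> 'a set \<Rightarrow> 'a \<Rightarrow> 'a \<Rightarrow> bool" where
  "weak_covers G S w v \<longleftrightarrow>
     weak_less G S v w \<and> \<not> (\<exists>x\<in>carrier G. weak_less G S v x \<and> weak_less G S x w)"

definition join_irreducible :: "('a, 'b) monoid_scheme \<Rightarrow> 'a set \<Rightarrow> 'a \<Rightarrow> bool" where
  "join_irreducible G S w \<longleftrightarrow>
     w \<in> carrier G \<and> (\<exists>!v. v \<in> carrier G \<and> weak_covers G S w v)"

definition cover_reflections :: "('a, 'b) monoid_scheme \<Rightarrow> 'a set \<Rightarrow> 'a \<Rightarrow> 'a set" where
  "cover_reflections G S w = {t \<in> inversions G S w. \<exists>s\<in>S. t \<otimes>\<^bsub>G\<^esub> w = w \<otimes>\<^bsub>G\<^esub> s}"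

definition weak_minimal :: "('a, 'b) monoid_scheme \<Rightarrow> 'a set \<Rightarrow> 'a set \<Rightarrow> 'a \<Rightarrow> bool" where
  "weak_minimal G S A w \<longleftrightarrow> w \<in> A \<and> \<not> (\<exists>v\<in>A. weak_less G S v w)"


section \<open>Sortable elements\<close>

text \<open>
  A Coxeter element \<open>c = s\<^sub>1 \<cdots> s\<^sub>n\<close> is given by the list \<open>cs = [s\<^sub>1, \<dots>, s\<^sub>n]\<close>, since sorting words
  are formed from such an expression.
\<close>

definition coxeter_word :: "'a set \<Rightarrow> 'a list \<Rightarrow> bool" where
  "coxeter_word S cs \<longleftrightarrow> distinct cs \<and> set cs = S"

text \<open>
  Positions in the infinite word \<open>(s\<^sub>1 \<cdots> s\<^sub>n)\<^sup>\<infinity>\<close> are numbered from \<open>0\<close>, so that position \<open>p\<close> lies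
  in copy \<open>p div n\<close> and carries the letter \<open>cs ! (p mod n)\<close>. A subword is the strictly increasing
  list of the positions it occupies. If \<open>n = 0\<close> the infinite word is empty; letters
  at positions are then meaningless, but the only reduced word is the empty one, given by \<open>[]\<close>.
\<close>

definition subword_at :: "'a list \<Rightarrow> nat list \<Rightarrow> 'a list" where
  "subword_at cs ps = map (\<lambda>p. cs ! (p mod length cs)) ps"

definition reduced_positions ::
  "('a, 'b) monoid_scheme \<Rightarrow> 'a set \<Rightarrow> 'a list \<Rightarrow> 'a \<Rightarrow> nat list \<Rightarrow> bool" where
  "reduced_positions G S cs w ps \<longleftrightarrow>
     sorted_wrt (<) ps \<and> reduced_word_for G S w (subword_at cs ps)"

text \<open>
  The relation \<^const>\<open>lex\<close> compares lists of equal length only, which suffices here because all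
  reduced words of an element have the same length.
\<close>

definition sorting_positions ::
  "('a, 'b) monoid_scheme \<Rightarrow> 'a set \<Rightarrow> 'a list \<Rightarrow> 'a \<Rightarrow> nat list \<Rightarrow> bool" where
  "sorting_positions G S cs w ps \<longleftrightarrow>
     reduced_positions G S cs w ps \<and>
     (\<forall>qs. reduced_positions G S cs w qs \<longrightarrow> ps = qs \<or> (ps, qs) \<in> lex less_than)"

definition copy_letters :: "'a list \<Rightarrow> nat list \<Rightarrow> nat \<Rightarrow> 'a set" where
  "copy_letters cs ps k =
     (\<lambda>p. cs ! (p mod length cs)) ` {p \<in> set ps. p div length cs = k}"

definition c_sortable :: "('a, 'b) monoid_scheme \<Rightarrow> 'a set \<Rightarrow> 'a list \<Rightarrow> 'a \<Rightarrow> bool" where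
  "c_sortable G S cs w \<longleftrightarrow>
     w \<in> carrier G \<and>
     (\<exists>ps. sorting_positions G S cs w ps \<and>
        (\<forall>k. copy_letters cs ps (Suc k) \<subseteq> copy_letters cs ps k))"

definition c_accessible :: "('a, 'b) monoid_scheme \<Rightarrow> 'a set \<Rightarrow> 'a list \<Rightarrow> 'a \<Rightarrow> bool" where
  "c_accessible G S cs t \<longleftrightarrow>
     t \<in> reflections G S \<and> (\<exists>w. c_sortable G S cs w \<and> t \<in> inversions G S w)"

end

(*
  The proof uses the geometric representation of W. Roots beta turned negative by the inverse of w
  encode the inversions of w, and for a Coxeter element c = s_1 ... s_n the Euler form E_c with
  E_c(alpha_i, alpha_j) = 0 for i < j satisfies E_c(s beta, s gamma) = E_{scs}(beta, gamma) for s
  initial in c. Hence sortable elements are those having a reduced word whose root sequence is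
  weakly increasing for the antisymmetrization of E_c, a condition that passes to the parabolic
  component of w. The roots at which the sorting word of w first skips each letter form an
  exceptional sequence for E_c and contain the negatives of all cover reflections of w; therefore,
  if the initial letter s is a cover reflection of a sortable w, all other cover reflections of w lie
  in the parabolic subgroup generated by the letters other than s.

  The least sortable j with a given inversion t is found by induction on rank and length. For
  t = s it is s; for t in the parabolic subgroup without s it is found there; otherwise every
  sortable w with inversion t lies above s, and j = s j' for the least scs-sortable j' with inversion
  sts. In the last case a second cover reflection of j could only be s, which would put t into the
  parabolic subgroup.
*)

theory Submission
  imports Complex_Main Defs
begin

section \<open>The geometric representation\<close>

text \<open>The obstacle is the induction on rank. A sorting word that uses an initial letter
  \<open>s\<close> does not show whether the component of \<open>w\<close> in the parabolic subgroup
  without \<open>s\<close> is again sortable, since deleting letters from the word need not produce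
  that component. Passing from words to lists of roots removes the difficulty: the roots of the
  component form a sublist of the roots of \<open>w\<close>, and a condition on pairs of entries
  survives taking sublists. The antisymmetrized Euler form supplies such a condition. The group may
  be infinite, so there is neither a longest element nor a finite list of roots to argue with. The
  main inductions run on rank plus length, and the geometric steps rest on the fact that the
  coordinates of a root have one sign. That fact and the braid relations are where dihedral
  subgroups are computed explicitly.\<close>

abbreviation unit_vec :: "'a \<Rightarrow> 'a \<Rightarrow> real" where
  "unit_vec s \<equiv> (\<lambda>r. if r = s then 1 else 0)"

locale coxeter_form =
  fixes S :: "'a set" and m :: "'a \<Rightarrow> 'a \<Rightarrow> nat"
  assumes fin: "finite S"
    and cm: "coxeter_matrix S m"
begin

text \<open>Twice the usual cosine form, with \<open>- 2\<close> for an infinite bond. Simple roots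
  then have square length 2, so a reflection subtracts \<open>K s v\<close> without a denominator.
  Vectors are functions on the whole type; \<open>K\<close> and \<open>bil\<close> see only the
  coordinates in \<open>S\<close>.\<close>

definition k :: "'a \<Rightarrow> 'a \<Rightarrow> real" where
  "k s r = (if m s r = 0 then - 2 else - 2 * cos (pi / real (m s r)))"

definition K :: "'a \<Rightarrow> ('a \<Rightarrow> real) \<Rightarrow> real" where
  "K s v = (\<Sum>r\<in>S. k s r * v r)"

definition bil :: "('a \<Rightarrow> real) \<Rightarrow> ('a \<Rightarrow> real) \<Rightarrow> real" where
  "bil u v = (\<Sum>s\<in>S. u s * K s v)"

definition sref :: "'a \<Rightarrow> ('a \<Rightarrow> real) \<Rightarrow> 'a \<Rightarrow> real" where
  "sref s v = (\<lambda>r. v r - K s v * unit_vec s r)"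

text \<open>Words act first: an action of the group itself has to wait until the relations are
  checked in \<open>act_braid\<close>.\<close>

definition act :: "'a list \<Rightarrow> ('a \<Rightarrow> real) \<Rightarrow> 'a \<Rightarrow> real" where
  "act ws v = foldr sref ws v"

lemma act_Nil [simp]: "act [] v = v"
  and act_Cons [simp]: "act (s # ws) v = sref s (act ws v)"
  and act_append: "act (us @ ws) v = act us (act ws v)"
  by (simp_all add: act_def)

lemma k_diag [simp]: "s \<in> S \<Longrightarrow> k s s = 2"
  using cm by (simp add: k_def coxeter_matrix_def)

lemma k_sym: "s \<in> S \<Longrightarrow> r \<in> S \<Longrightarrow> k s r = k r s"
  using cm by (simp add: k_def coxeter_matrix_def)

lemma m_cases:
  assumes "s \<in> S" "r \<in> S" "s \<noteq> r"
  shows "m s r = 0 \<or> m s r \<ge> 2"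
  using cm assms unfolding coxeter_matrix_def by (metis One_nat_def less_2_cases_iff not_le)

lemma k_nonpos:
  assumes "s \<in> S" "r \<in> S" "s \<noteq> r"
  shows "k s r \<le> 0"
proof (cases "m s r = 0")
  case False
  then have "real (m s r) \<ge> 2"
    using m_cases [OF assms] by auto
  then have "pi / real (m s r) \<le> pi / 2" "0 \<le> pi / real (m s r)"
    using divide_left_mono [of 2 "real (m s r)" pi] by simp_all
  then have "cos (pi / real (m s r)) \<ge> 0"
    using pi_gt_zero by (intro cos_ge_zero) linarith+
  then show ?thesis
    by (simp add: k_def)
qed (simp add: k_def)

lemma K_lin: "K s (\<lambda>r. a * u r + b * v r) = a * K s u + b * K s v"
  by (simp add: K_def algebra_simps sum.distrib sum_distrib_left)

lemma K_diff: "K s (\<lambda>r. u r - v r) = K s u - K s v"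
  using K_lin [of s 1 u "- 1" v] by simp

lemma K_scale: "K s (\<lambda>r. a * u r) = a * K s u"
  using K_lin [of s a u 0 u] by simp

lemma K_unit: "r \<in> S \<Longrightarrow> K s (unit_vec r) = k s r"
  using fin by (simp add: K_def if_distrib cong: if_cong)

lemma K_supp:
  assumes "A \<subseteq> S" "\<And>r. r \<in> S - A \<Longrightarrow> v r = 0"
  shows "K s v = (\<Sum>r\<in>A. k s r * v r)"
  unfolding K_def using assms fin by (intro sum.mono_neutral_right) auto

lemma bil_lin_right: "bil w (\<lambda>r. a * u r + b * v r) = a * bil w u + b * bil w v"
  by (simp add: bil_def K_lin algebra_simps sum.distrib sum_distrib_left)

lemma bil_sym: "bil u v = bil v u"
proof -
  have "bil u v = (\<Sum>s\<in>S. \<Sum>r\<in>S. u s * (k s r * v r))"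
    by (simp add: bil_def K_def sum_distrib_left)
  also have "\<dots> = (\<Sum>r\<in>S. \<Sum>s\<in>S. u s * (k s r * v r))"
    by (rule sum.swap)
  also have "\<dots> = (\<Sum>r\<in>S. \<Sum>s\<in>S. v r * (k r s * u s))"
    by (intro sum.cong refl) (simp add: k_sym)
  finally show ?thesis
    by (simp add: bil_def K_def sum_distrib_left)
qed

lemma bil_lin_left: "bil (\<lambda>r. a * u r + b * v r) w = a * bil u w + b * bil v w"
  by (metis bil_lin_right bil_sym)

lemma bil_scale: "bil (\<lambda>r. a * u r) v = a * bil u v" "bil u (\<lambda>r. a * v r) = a * bil u v"
  using bil_lin_left [of a u 0 u v] bil_lin_right [of u a v 0 v] by simp_all

lemma bil_unit: "s \<in> S \<Longrightarrow> bil (unit_vec s) v = K s v"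
  using fin by (simp add: bil_def if_distrib if_distribR cong: if_cong)

lemma sref_lin: "sref s (\<lambda>r. a * u r + b * v r) = (\<lambda>r. a * sref s u r + b * sref s v r)"
  by (simp add: sref_def K_lin algebra_simps)

lemma act_lin: "act ws (\<lambda>r. a * u r + b * v r) = (\<lambda>r. a * act ws u r + b * act ws v r)"
  by (induction ws) (simp_all add: sref_lin)

lemma act_scale: "act ws (\<lambda>r. a * u r) = (\<lambda>r. a * act ws u r)"
  using act_lin [of ws a u 0 u] by simp

lemma act_uminus: "act ws (\<lambda>r. - u r) = (\<lambda>r. - act ws u r)"
  using act_scale [of ws "- 1" u] by simp

lemma act_zero: "act ws (\<lambda>r. 0) = (\<lambda>r. 0)"
  using act_scale [of ws 0 "\<lambda>r. 0"] by simp

lemma sref_unit: "s \<in> S \<Longrightarrow> sref s (unit_vec s) = (\<lambda>r. - unit_vec s r)"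
  by (simp add: sref_def K_unit fun_eq_iff)

lemma sref_other: "r \<noteq> s \<Longrightarrow> sref s v r = v r"
  by (simp add: sref_def)

lemma K_sref_self: "s \<in> S \<Longrightarrow> K s (sref s v) = - K s v"
  by (simp add: sref_def K_diff K_scale K_unit)

lemma sref_sref [simp]: "s \<in> S \<Longrightarrow> sref s (sref s v) = v"
  by (simp add: sref_def [of s "sref s v"] K_sref_self) (simp add: sref_def fun_eq_iff)

lemma bil_sref: "s \<in> S \<Longrightarrow> bil (sref s u) (sref s v) = bil u v"
proof -
  assume s: "s \<in> S"
  have r: "sref s w = (\<lambda>r. 1 * w r + (- K s w) * unit_vec s r)" for w
    by (simp add: sref_def)
  have "bil (sref s u) (sref s v) = bil u (sref s v) - K s u * K s (sref s v)"
    unfolding r [of u] bil_lin_left using s by (simp add: bil_unit)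
  also have "bil u (sref s v) = bil u v - K s v * K s u"
    unfolding r [of v] bil_lin_right using s by (simp add: bil_unit bil_sym [of u])
  finally show ?thesis
    using s by (simp add: K_sref_self)
qed

lemma bil_act: "ws \<in> lists S \<Longrightarrow> bil (act ws u) (act ws v) = bil u v"
  by (induction ws) (auto simp: bil_sref)

text \<open>
  \<open>cheb s t n\<close> is \<open>sin (n\<theta>) / sin \<theta>\<close> for \<open>\<theta> = \<pi> / m s t\<close>, with limiting value \<open>n\<close> for \<open>m s t = 0\<close>.
\<close>

fun cheb :: "'a \<Rightarrow> 'a \<Rightarrow> nat \<Rightarrow> real" where
  "cheb s t 0 = 0"
| "cheb s t (Suc 0) = 1"
| "cheb s t (Suc (Suc n)) = - k s t * cheb s t (Suc n) - cheb s t n"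

lemma cheb_infinite: "m s t = 0 \<Longrightarrow> cheb s t n = real n"
  by (induction s t n rule: cheb.induct) (simp_all add: k_def)

lemma cheb_sin:
  assumes "m s t \<noteq> 0"
  shows "sin (pi / real (m s t)) * cheb s t n = sin (real n * (pi / real (m s t)))"
proof (induction s t n rule: cheb.induct)
  case (3 s t n)
  define x where "x = pi / real (m s t)"
  have "sin (real (Suc (Suc n)) * x) + sin (real n * x)
      = sin (real (Suc n) * x + x) + sin (real (Suc n) * x - x)"
    by (simp add: algebra_simps)
  also have "\<dots> = 2 * cos x * sin (real (Suc n) * x)"
    by (simp add: sin_add sin_diff)
  finally have 1: "sin (real (Suc (Suc n)) * x) = 2 * cos x * sin (real (Suc n) * x) - sin (real n * x)"
    by simp
  have "- k s t = 2 * cos x"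
    using 3 by (simp add: k_def x_def)
  then have "sin x * cheb s t (Suc (Suc n)) = 2 * cos x * (sin x * cheb s t (Suc n)) - sin x * cheb s t n"
    by (simp add: algebra_simps)
  with 1 3 show ?case
    by (simp add: x_def)
qed auto

lemma sin_angle_pos:
  assumes "m s t \<ge> 2"
  shows "sin (pi / real (m s t)) > 0"
proof (rule sin_gt_zero)
  have "pi / real (m s t) \<le> pi / 2"
    using divide_left_mono [of 2 "real (m s t)" pi] assms by simp
  then show "pi / real (m s t) < pi"
    using pi_gt_zero by linarith
qed (use assms in auto)

lemma cheb_nonneg:
  assumes "s \<in> S" "t \<in> S" "s \<noteq> t" and n: "m s t = 0 \<or> n \<le> m s t"
  shows "cheb s t n \<ge> 0"
proof (cases "m s t = 0")
  case True
  then show ?thesis by (simp add: cheb_infinite)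
next
  case False
  then have m2: "m s t \<ge> 2"
    using m_cases [OF assms(1-3)] by simp
  have "real n * (pi / real (m s t)) \<le> real (m s t) * (pi / real (m s t))"
    using n False by (intro mult_right_mono) auto
  then have "real n * (pi / real (m s t)) \<le> pi"
    using False by simp
  then have "sin (real n * (pi / real (m s t))) \<ge> 0"
    by (intro sin_ge_zero) auto
  then have "sin (pi / real (m s t)) * cheb s t n \<ge> 0"
    using cheb_sin [OF False] by simp
  then show ?thesis
    using sin_angle_pos [OF m2] by (simp add: zero_le_mult_iff)
qed

lemma cheb_m:
  assumes "m s t \<ge> 2"
  shows "cheb s t (m s t) = 0" "cheb s t (Suc (m s t)) = - 1"
proof -
  have 0: "m s t \<noteq> 0" using assms by simp
  have "sin (pi / real (m s t)) * cheb s t (m s t) = 0"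
    using 0 by (simp add: cheb_sin)
  then show "cheb s t (m s t) = 0"
    using sin_angle_pos [OF assms] by simp
  have "real (Suc (m s t)) * (pi / real (m s t)) = pi + pi / real (m s t)"
    using 0 by (simp add: distrib_right add_divide_distrib)
  then have "sin (pi / real (m s t)) * cheb s t (Suc (m s t)) = - sin (pi / real (m s t))"
    using cheb_sin [OF 0, of "Suc (m s t)"] by (simp add: sin_add)
  then have "sin (pi / real (m s t)) * (cheb s t (Suc (m s t)) + 1) = 0"
    by (simp add: algebra_simps)
  then show "cheb s t (Suc (m s t)) = - 1"
    using sin_angle_pos [OF assms] by simp
qed

text \<open>For finite \<open>m s t\<close> the form is positive definite on the plane of the two
  simple roots, with Gram determinant \<open>4 - k s t * k s t\<close>. This is what makes the
  linear system in \<open>act_braid\<close> uniquely solvable.\<close>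

lemma k_sq_less:
  assumes "m s t \<ge> 2"
  shows "k s t * k s t < 4"
proof -
  have "(sin (pi / real (m s t)))\<^sup>2 > 0"
    using sin_angle_pos [OF assms] by simp
  then have "(cos (pi / real (m s t)))\<^sup>2 < 1"
    using sin_cos_squared_add [of "pi / real (m s t)"] by linarith
  then show ?thesis
    using assms by (simp add: k_def power2_eq_square)
qed

end

section \<open>Alternating words and the braid relations\<close>

fun alt :: "'a \<Rightarrow> 'a \<Rightarrow> nat \<Rightarrow> 'a list" where
  "alt s t 0 = []"
| "alt s t (Suc n) = (if even n then t else s) # alt s t n"

lemma length_alt [simp]: "length (alt s t n) = n"
  by (induction n) auto

lemma alt_in_lists: "s \<in> S \<Longrightarrow> t \<in> S \<Longrightarrow> alt s t n \<in> lists S"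
  by (induction n) auto

lemma alt_double: "alt s t (2 * n) = concat (replicate n [s, t])"
  by (induction n) auto

lemma alt_Suc_snoc: "alt s t (Suc n) = alt t s n @ [t]"
  by (induction n) auto

context coxeter_form
begin

text \<open>
  The coefficients subtracted by the successive reflections in an alternating word. They are
  antiperiodic with period \<open>m s t\<close>, which gives the braid relations.
\<close>

fun zseq :: "'a \<Rightarrow> 'a \<Rightarrow> ('a \<Rightarrow> real) \<Rightarrow> nat \<Rightarrow> real" where
  "zseq s t v 0 = - K s v"
| "zseq s t v (Suc 0) = K t v"
| "zseq s t v (Suc (Suc n)) = - k s t * zseq s t v (Suc n) - zseq s t v n"

text \<open>Two consecutive terms of \<open>zseq\<close> describe both \<open>K s\<close> and
  \<open>K t\<close> on the current vector: the letter to be applied next subtracts the new term,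
  and the letter just applied has had its value negated by its own reflection.\<close>

lemma K_alt:
  assumes st: "s \<in> S" "t \<in> S"
  shows "K (if even n then t else s) (act (alt s t n) v) = zseq s t v (Suc n)
       \<and> K (if even n then s else t) (act (alt s t n) v) = - zseq s t v n"
proof (induction n)
  case (Suc n)
  then show ?case
    using st by (auto simp: sref_def K_diff K_scale K_unit k_sym [of t s])
qed auto

lemma zseq_cheb: "zseq s t v (Suc n) = cheb s t (Suc n) * zseq s t v 1 - cheb s t n * zseq s t v 0"
proof (induction n rule: less_induct)
  case (less n)
  show ?case
  proof (cases n)
    case (Suc l)
    show ?thesis
    proof (cases l)
      case (Suc j)
      then show ?thesis
        using less [of l] less [of j] \<open>n = Suc l\<close> by (simp add: algebra_simps)
    qed (use Suc in \<open>simp add: algebra_simps\<close>)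
  qed auto
qed

text \<open>\<open>cheb\<close> takes the values 0 and -1 at \<open>m s t\<close> and
  \<open>m s t + 1\<close>, so both starting values return negated; linearity of the recurrence does
  the rest.\<close>

lemma zseq_periodic:
  assumes "m s t \<ge> 2"
  shows "zseq s t v (m s t + n) = - zseq s t v n"
proof -
  obtain l where l: "m s t = Suc l"
    using assms by (cases "m s t") auto
  have 1: "zseq s t v (Suc (m s t)) = - zseq s t v 1"
    by (subst zseq_cheb) (simp add: cheb_m [OF assms])
  have "cheb s t l = 1"
    using cheb_m [OF assms] by (simp add: l)
  then have 0: "zseq s t v (m s t) = - zseq s t v 0"
    using cheb_m(1) [OF assms] zseq_cheb [of s t v l] by (simp add: l)
  show ?thesis
  proof (induction n rule: less_induct)
    case (less n)
    consider "n = 0" | "n = 1" | j where "n = Suc (Suc j)"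
      by (metis One_nat_def not0_implies_Suc)
    then show ?case
    proof cases
      case 3
      then show ?thesis
        using less [of j] less [of "Suc j"] by simp
    qed (use 0 1 in auto)
  qed
qed

lemma act_alt_even:
  assumes st: "s \<in> S" "t \<in> S"
  shows "act (alt s t (2 * n)) v = (\<lambda>r. v r - (\<Sum>i<n. zseq s t v (2 * i + 1)) * unit_vec t r
           - (\<Sum>i<n. zseq s t v (2 * i + 2)) * unit_vec s r)"
proof (induction n)
  case (Suc n)
  have e: "alt s t (2 * Suc n) = s # t # alt s t (2 * n)"
    by simp
  have a: "K t (act (alt s t (2 * n)) v) = zseq s t v (2 * n + 1)"
    using K_alt [OF st, of "2 * n" v] by simp
  have b: "K s (act (alt s t (2 * n + 1)) v) = zseq s t v (2 * n + 2)"
    using K_alt [OF st, of "2 * n + 1" v] by simp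
  then show ?case
    using Suc a unfolding e by (auto simp: sref_def fun_eq_iff algebra_simps)
qed auto

text \<open>The whole relator subtracts \<open>od\<close> times one simple root and
  \<open>ev\<close> times the other, each a sum of \<open>zseq\<close> over a full period. Summing
  the recurrence over that period gives \<open>2 * od = - k s t * ev\<close> and the same with
  \<open>od\<close> and \<open>ev\<close> exchanged, and \<open>k_sq_less\<close> leaves only the
  zero solution.\<close>

lemma act_braid:
  assumes st: "s \<in> S" "t \<in> S"
  shows "act (concat (replicate (m s t) [s, t])) v = v"
proof (cases "s = t")
  case True
  then have "m s t = 1"
    using cm st by (simp add: coxeter_matrix_def)
  then show ?thesis
    using True st by simp
next
  case False
  show ?thesis
  proof (cases "m s t = 0")
    case False
    then have m2: "m s t \<ge> 2"
      using m_cases [OF st \<open>s \<noteq> t\<close>] by simp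
    define p where "p = m s t"
    define z where "z = zseq s t v"
    define od where "od = (\<Sum>i<p. z (2 * i + 1))"
    define ev where "ev = (\<Sum>i<p. z (2 * i + 2))"
    have rec: "z (Suc (Suc n)) + z n = - k s t * z (Suc n)" for n
      by (simp add: z_def)
    have per: "z (2 * p + n) = z n" for n
      using zseq_periodic [OF m2, of v] unfolding z_def p_def
      by (metis add.assoc minus_minus mult_2)
    have tel: "(\<Sum>i<p. z (2 * i + 2 + j)) = (\<Sum>i<p. z (2 * i + j))" for j
    proof -
      have "(\<Sum>i<p. z (2 * Suc i + j) - z (2 * i + j)) = z (2 * p + j) - z (2 * 0 + j)"
        by (rule sum_lessThan_telescope)
      then show ?thesis
        using per by (simp add: sum_subtractf)
    qed
    have "od + od = (\<Sum>i<p. z (2 * i + 2 + 1) + z (2 * i + 1))"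
      using tel [of 1] by (simp add: od_def sum.distrib)
    also have "\<dots> = - k s t * ev"
      unfolding ev_def sum_distrib_left using rec by (intro sum.cong) auto
    finally have 1: "2 * od = - k s t * ev"
      by simp
    have "ev + ev = (\<Sum>i<p. z (2 * i + 2) + z (2 * i))"
      using tel [of 0] by (simp add: ev_def sum.distrib)
    also have "\<dots> = - k s t * od"
      unfolding od_def sum_distrib_left using rec by (intro sum.cong) auto
    finally have 2: "2 * ev = - k s t * od"
      by simp
    have "4 * od = k s t * k s t * od"
      using 1 2 by algebra
    then have "od = 0"
      using k_sq_less [OF m2] by auto
    moreover from this 2 have "ev = 0"
      by simp
    ultimately show ?thesis
      unfolding alt_double [symmetric] act_alt_even [OF st] od_def ev_def z_def p_def
      by simp
  qed simp
qed

lemma act_alt_unit: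
  assumes st: "s \<in> S" "t \<in> S"
  shows "act (alt s t n) (unit_vec s) =
    (\<lambda>r. cheb s t (Suc n) * unit_vec (if even n then s else t) r
       + cheb s t n * unit_vec (if even n then t else s) r)"
proof (induction n)
  case (Suc n)
  then show ?case
    using st unfolding alt.simps act_Cons Suc.IH
    by (auto simp: sref_def K_lin K_unit k_sym [of t s] fun_eq_iff algebra_simps)
qed auto

end

section \<open>Coxeter systems: words, length and positivity\<close>

locale coxeter = group G + coxeter_form S m
  for G :: "('a, 'b) monoid_scheme" (structure) and S :: "'a set" and m :: "'a \<Rightarrow> 'a \<Rightarrow> nat" +
  assumes S_carrier: "S \<subseteq> carrier G"
    and gen: "generate G S = carrier G"
    and word_eq: "\<And>u v. u \<in> lists S \<Longrightarrow> v \<in> lists S \<Longrightarrow>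
          word_prod G u = word_prod G v \<longleftrightarrow> equivclp (relator_step S m) u v"
begin

declare in_lists_conv_set [simp]

abbreviation "wp \<equiv> word_prod G"
abbreviation "len \<equiv> cox_length G S"

lemma S_closed [simp, intro]: "s \<in> S \<Longrightarrow> s \<in> carrier G"
  using S_carrier by auto

lemma wp_Nil [simp]: "wp [] = \<one>"
  and wp_Cons [simp]: "wp (s # ws) = s \<otimes> wp ws"
  by (simp_all add: word_prod_def)

lemma wp_closed [simp, intro]: "ws \<in> lists S \<Longrightarrow> wp ws \<in> carrier G"
  by (induction ws) auto

lemma wp_append: "us \<in> lists S \<Longrightarrow> vs \<in> lists S \<Longrightarrow> wp (us @ vs) = wp us \<otimes> wp vs"
  by (induction us) (auto simp: m_assoc)

lemma equivclp_invariant: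
  assumes "equivclp r u v" and "\<And>a b. r a b \<Longrightarrow> f a = f b"
  shows "f u = f v"
  using assms(1)
proof (induction rule: equivclp_induct)
  case base
  then show ?case by simp
next
  case (step y z)
  then show ?case using assms(2) by auto
qed

lemma act_cong:
  assumes "u \<in> lists S" "v \<in> lists S" "wp u = wp v"
  shows "act u = act v"
proof (rule equivclp_invariant)
  show "equivclp (relator_step S m) u v"
    using assms word_eq by blast
next
  fix a b
  assume "relator_step S m a b"
  then obtain u v s t where "s \<in> S" "t \<in> S"
    "a = u @ concat (replicate (m s t) [s, t]) @ v" "b = u @ v"
    unfolding relator_step_def by blast
  then show "act a = act b"
    by (simp add: fun_eq_iff act_append act_braid)
qed

text \<open>Relators have even length. This parity is what keeps \<open>len\<close> from staying the
  same under multiplication by a generator, in \<open>len_mult_S\<close>.\<close>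

lemma parity_cong:
  assumes "u \<in> lists S" "v \<in> lists S" "wp u = wp v"
  shows "even (length u) = even (length v)"
proof (rule equivclp_invariant [where f = "\<lambda>ws. even (length ws)"])
  show "equivclp (relator_step S m) u v"
    using assms word_eq by blast
next
  fix a b
  assume "relator_step S m a b"
  then obtain u v s t where "a = u @ concat (replicate (m s t) [s, t]) @ v" "b = u @ v"
    unfolding relator_step_def by blast
  moreover have "even (length (concat (replicate n [s, t])))" for n
    by (induction n) auto
  ultimately show "even (length a) = even (length b)"
    by simp
qed

lemma relator_one:
  assumes "s \<in> S" "t \<in> S"
  shows "wp (concat (replicate (m s t) [s, t])) = \<one>"
proof -
  have "concat (replicate n [s, t]) \<in> lists S" for n
    using assms by (induction n) auto
  moreover have "relator_step S m (concat (replicate (m s t) [s, t])) []"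
    unfolding relator_step_def using assms by fastforce
  ultimately show ?thesis
    using word_eq [of _ "[]"] by (metis lists.Nil r_into_equivclp wp_Nil)
qed

lemma S_sq [simp]: "s \<in> S \<Longrightarrow> s \<otimes> s = \<one>"
  using relator_one [of s s] cm by (simp add: coxeter_matrix_def)

lemma S_cancel [simp]: "s \<in> S \<Longrightarrow> w \<in> carrier G \<Longrightarrow> s \<otimes> (s \<otimes> w) = w"
  by (simp add: m_assoc [symmetric])

lemma S_cancel_right [simp]: "s \<in> S \<Longrightarrow> w \<in> carrier G \<Longrightarrow> w \<otimes> s \<otimes> s = w"
  by (simp add: m_assoc)

lemma inv_S [simp]: "s \<in> S \<Longrightarrow> inv s = s"
  by (simp add: inv_equality)

lemma wp_rev: "ws \<in> lists S \<Longrightarrow> wp (rev ws) = inv (wp ws)"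
  by (induction ws) (auto simp: wp_append inv_mult_group)

lemma word_exists:
  assumes "w \<in> carrier G"
  shows "\<exists>ws\<in>lists S. wp ws = w"
proof -
  have "w \<in> generate G S"
    using assms gen by simp
  then show ?thesis
  proof (induction rule: generate.induct)
    case one
    show ?case by (rule bexI [of _ "[]"]) auto
  next
    case (incl h)
    then show ?case by (intro bexI [of _ "[h]"]) auto
  next
    case (inv h)
    then show ?case by (intro bexI [of _ "[h]"]) auto
  next
    case (eng h1 h2)
    then obtain u v where "u \<in> lists S" "v \<in> lists S" "wp u = h1" "wp v = h2"
      by blast
    then show ?case by (intro bexI [of _ "u @ v"]) (auto simp: wp_append)
  qed
qed

lemma len_le: "ws \<in> lists S \<Longrightarrow> len (wp ws) \<le> length ws"
  unfolding cox_length_def by (rule Least_le) blast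

lemma reduced_word_exists:
  assumes "w \<in> carrier G"
  obtains ws where "ws \<in> lists S" "wp ws = w" "length ws = len w"
proof -
  have "\<exists>n. \<exists>ws\<in>lists S. length ws = n \<and> wp ws = w"
    using word_exists [OF assms] by blast
  then have "\<exists>ws\<in>lists S. length ws = len w \<and> wp ws = w"
    unfolding cox_length_def by (rule LeastI_ex)
  then show ?thesis
    using that by blast
qed

section \<open>Reduced words\<close>

definition reduced :: "'a list \<Rightarrow> bool" where
  "reduced ws \<longleftrightarrow> ws \<in> lists S \<and> length ws = len (wp ws)"

lemma reduced_exists:
  assumes "w \<in> carrier G"
  obtains ws where "reduced ws" "wp ws = w" "ws \<in> lists S"
  using reduced_word_exists [OF assms] unfolding reduced_def by metis

lemma len_one [simp]: "len \<one> = 0"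
  using len_le [of "[]"] by simp

lemma len_eq_0: "w \<in> carrier G \<Longrightarrow> len w = 0 \<longleftrightarrow> w = \<one>"
  by (metis len_one length_0_conv reduced_word_exists wp_Nil)

lemma len_mult_le:
  assumes "v \<in> carrier G" "w \<in> carrier G"
  shows "len (v \<otimes> w) \<le> len v + len w"
proof -
  obtain vs ws where "vs \<in> lists S" "wp vs = v" "length vs = len v"
    "ws \<in> lists S" "wp ws = w" "length ws = len w"
    using assms reduced_word_exists by metis
  then show ?thesis
    using len_le [of "vs @ ws"] by (auto simp: wp_append)
qed

lemma len_S_le:
  assumes "s \<in> S"
  shows "len s \<le> 1"
proof -
  have "wp [s] = s"
    using S_closed [OF assms] by (simp only: wp_Cons wp_Nil r_one)
  moreover have "len (wp [s]) \<le> length [s]"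
    using assms by (intro len_le) simp
  ultimately show ?thesis
    by simp
qed

lemma len_inv: "w \<in> carrier G \<Longrightarrow> len (inv w) = len w"
proof -
  have "len (inv w) \<le> len w" if w: "w \<in> carrier G" for w
  proof -
    obtain ws where "ws \<in> lists S" "wp ws = w" "length ws = len w"
      using w reduced_word_exists by metis
    moreover have "len (wp (rev ws)) \<le> length (rev ws)"
      using \<open>ws \<in> lists S\<close> by (intro len_le) simp
    ultimately show ?thesis
      by (simp only: wp_rev length_rev)
  qed
  then show "w \<in> carrier G \<Longrightarrow> len (inv w) = len w"
    by (metis inv_closed inv_inv le_antisym)
qed

lemma len_parity:
  assumes "w \<in> carrier G" "ws \<in> lists S" "wp ws = w"
  shows "even (len w) = even (length ws)"
  using assms parity_cong reduced_word_exists by metis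

lemma len_mult_S:
  assumes "w \<in> carrier G" "s \<in> S"
  shows "len (w \<otimes> s) = Suc (len w) \<or> len w = Suc (len (w \<otimes> s))"
proof -
  obtain ws where ws: "ws \<in> lists S" "wp ws = w" "length ws = len w"
    using assms reduced_word_exists by metis
  have "even (len (w \<otimes> s)) = even (length (ws @ [s]))"
    by (rule len_parity) (use assms ws in \<open>auto simp: wp_append\<close>)
  then have "len (w \<otimes> s) \<noteq> len w"
    using ws by auto
  moreover have "len (w \<otimes> s) \<le> len w + 1"
    using len_mult_le [of w s] len_S_le [of s] assms by force
  moreover have "len w \<le> len (w \<otimes> s) + 1"
    using len_mult_le [of "w \<otimes> s" s] len_S_le [of s] assms by force
  ultimately show ?thesis
    by linarith
qed

lemma reduced_append:
  assumes "reduced (us @ vs)"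
  shows "reduced us" "reduced vs"
proof -
  have l: "us \<in> lists S" "vs \<in> lists S"
    using assms by (auto simp: reduced_def)
  then have "length us + length vs \<le> len (wp us) + len (wp vs)"
    using assms len_mult_le [of "wp us" "wp vs"] by (auto simp: reduced_def wp_append)
  then show "reduced us" "reduced vs"
    using l len_le [OF l(1)] len_le [OF l(2)] by (auto simp: reduced_def)
qed

lemma reduced_distinct_adj: "reduced ws \<Longrightarrow> distinct_adj ws"
proof (induction ws)
  case (Cons a ws)
  have r: "reduced ws"
    using reduced_append(2) [of "[a]" ws] Cons.prems by simp
  have "a \<noteq> hd ws" if "ws \<noteq> []"
  proof
    have "ws \<noteq> []" by (fact that)
    assume "a = hd ws"
    then obtain vs where vs: "ws = a # vs"
      using \<open>ws \<noteq> []\<close> by (cases ws) auto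
    then have "wp (a # ws) = wp vs" "vs \<in> lists S"
      using Cons.prems by (auto simp: reduced_def)
    then show False
      using Cons.prems len_le [of vs] vs unfolding reduced_def by simp
  qed
  then show ?case
    using Cons.IH [OF r] by (auto simp: distinct_adj_Cons)
qed simp

section \<open>The action of the group and the signs of roots\<close>

definition rho :: "'a \<Rightarrow> ('a \<Rightarrow> real) \<Rightarrow> 'a \<Rightarrow> real" where
  "rho w = act (SOME ws. ws \<in> lists S \<and> wp ws = w)"

lemma rho_wp: "ws \<in> lists S \<Longrightarrow> rho (wp ws) = act ws"
  unfolding rho_def by (rule someI2 [of _ ws]) (auto intro: act_cong)

lemma rho_one [simp]: "rho \<one> v = v"
  using rho_wp [of "[]"] by (simp add: fun_eq_iff)

lemma rho_S [simp]: "s \<in> S \<Longrightarrow> rho s v = sref s v"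
  using rho_wp [of "[s]"] by (simp add: fun_eq_iff)

lemma rho_mult: "v \<in> carrier G \<Longrightarrow> w \<in> carrier G \<Longrightarrow> rho (v \<otimes> w) x = rho v (rho w x)"
proof -
  assume "v \<in> carrier G" "w \<in> carrier G"
  then obtain vs ws where "vs \<in> lists S" "wp vs = v" "ws \<in> lists S" "wp ws = w"
    using word_exists by blast
  moreover from this have "rho (wp (vs @ ws)) = act (vs @ ws)"
    by (intro rho_wp) auto
  ultimately show ?thesis
    using rho_wp [of vs] rho_wp [of ws] by (simp add: wp_append act_append)
qed

lemma rho_inv [simp]:
  "w \<in> carrier G \<Longrightarrow> rho (inv w) (rho w x) = x"
  "w \<in> carrier G \<Longrightarrow> rho w (rho (inv w) x) = x"
  by (simp_all flip: rho_mult)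

lemma rho_lin:
  assumes "w \<in> carrier G"
  shows "rho w (\<lambda>r. a * u r + b * v r) = (\<lambda>r. a * rho w u r + b * rho w v r)"
  using word_exists [OF assms] rho_wp act_lin by metis

lemma rho_scale: "w \<in> carrier G \<Longrightarrow> rho w (\<lambda>r. a * u r) = (\<lambda>r. a * rho w u r)"
  using rho_lin [of w a u 0 u] by simp

lemma rho_uminus: "w \<in> carrier G \<Longrightarrow> rho w (\<lambda>r. - u r) = (\<lambda>r. - rho w u r)"
  using rho_scale [of w "- 1" u] by simp

lemma rho_zero: "w \<in> carrier G \<Longrightarrow> rho w (\<lambda>r. 0) = (\<lambda>r. 0)"
  using rho_scale [of w 0 "\<lambda>r. 0"] by simp

lemma bil_rho: "w \<in> carrier G \<Longrightarrow> bil (rho w u) (rho w v) = bil u v"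
  using word_exists bil_act rho_wp by metis

definition nonneg :: "('a \<Rightarrow> real) \<Rightarrow> bool" where
  "nonneg v \<longleftrightarrow> (\<forall>r. v r \<ge> 0)"

definition nonpos :: "('a \<Rightarrow> real) \<Rightarrow> bool" where
  "nonpos v \<longleftrightarrow> (\<forall>r. v r \<le> 0)"

lemma alt_unique:
  assumes "set ws \<subseteq> {s, t}" "distinct_adj (ws @ [s])"
  shows "ws = alt s t (length ws)"
  using assms
proof (induction ws)
  case (Cons a ws)
  then have IH: "ws = alt s t (length ws)" and a: "a = s \<or> a = t"
    by (auto simp: distinct_adj_Cons)
  show ?case
  proof (cases "length ws")
    case 0
    then show ?thesis using Cons.prems a by auto
  next
    case (Suc n)
    define y where "y = (if even n then t else s)"
    have ws: "ws = y # alt s t n"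
      using IH Suc by (simp add: y_def)
    have "distinct_adj (a # y # alt s t n @ [s])"
      using Cons.prems(2) unfolding ws by simp
    then have "a \<noteq> (if even n then t else s)"
      by (simp add: y_def)
    then have "a = (if even (Suc n) then t else s)"
      using a by auto
    then show ?thesis
      unfolding ws by (simp add: y_def)
  qed
qed simp

text \<open>The relator is an alternating word of length \<open>2 * m s t\<close>; its first half is
  the reverse, hence the inverse, of one of the two alternating words, and its second half is the
  other one.\<close>

lemma braid:
  assumes st: "s \<in> S" "t \<in> S"
  shows "wp (alt s t (m s t)) = wp (alt t s (m s t))"
proof -
  have split: "alt s t (i + j) = (if even j then alt s t i else alt t s i) @ alt s t j" for i j
    by (induction i) auto
  have rev: "rev (alt s t n) = (if even n then alt t s n else alt s t n)" for s t :: 'a and n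
  proof (induction n arbitrary: s t)
    case (Suc n)
    have "rev (alt s t (Suc n)) = t # rev (alt t s n)"
      by (subst alt_Suc_snoc) simp
    then show ?case using Suc by simp
  qed simp
  define n where "n = m s t"
  have "alt s t (2 * n) = rev (alt t s n) @ alt s t n"
    using split [of n n] rev [of t s n] by (simp add: mult_2)
  moreover have "wp (alt s t (2 * n)) = \<one>"
    using relator_one [OF st] by (simp add: alt_double n_def)
  ultimately have "inv (wp (alt t s n)) \<otimes> wp (alt s t n) = \<one>"
    using alt_in_lists [OF st, of n] alt_in_lists [OF st(2,1), of n]
    by (simp add: wp_append wp_rev)
  then show ?thesis
    unfolding n_def by (metis alt_in_lists inv_closed inv_equality inv_inv st wp_closed)
qed

text \<open>Split \<open>w\<close> as \<open>v\<close> times an alternating word in \<open>s\<close>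
  and the last letter \<open>t\<close> of a reduced word, with the alternating part as long as
  possible. That part sends the simple root of \<open>s\<close> to a combination of the two simple
  roots with \<open>cheb\<close> coefficients, and the shorter \<open>v\<close> sends both of these
  to nonnegative vectors by induction.\<close>

theorem rho_unit_nonneg:
  assumes "w \<in> carrier G" "s \<in> S" "len w < len (w \<otimes> s)"
  shows "nonneg (rho w (unit_vec s))"
  using assms
proof (induction "len w" arbitrary: w s rule: less_induct)
  case less
  note w = \<open>w \<in> carrier G\<close> and s = \<open>s \<in> S\<close>
  show ?case
  proof (cases "w = \<one>")
    case True
    then show ?thesis by (simp add: nonneg_def)
  next
    case False
    obtain ws where ws: "reduced ws" "wp ws = w" "ws \<in> lists S"
      using reduced_exists w by blast
    with False have "ws \<noteq> []"
      by auto
    then obtain us t where us: "ws = us @ [t]"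
      by (metis rev_exhaust)
    have t: "t \<in> S"
      using ws us by simp
    have "t \<noteq> s"
    proof
      assume "t = s"
      then have "w \<otimes> s = wp us"
        using ws us s by (auto simp: wp_append)
      moreover have "us \<in> lists S"
        using ws us by simp
      ultimately have "len (w \<otimes> s) \<le> length us"
        by (metis len_le)
      then show False
        using less.prems(3) ws us by (simp add: reduced_def)
    qed
    \<comment> \<open>\<open>P n\<close>: some reduced word of \<open>w\<close> ends in
      \<open>n\<close> letters from \<open>{s, t}\<close>. The maximal such \<open>n\<close> is
      used.\<close>
    define P where "P = (\<lambda>n. \<exists>as bs. length bs = n \<and> reduced (as @ bs) \<and> wp (as @ bs) = w \<and> set bs \<subseteq> {s, t})"
    have "P 1"
      unfolding P_def using ws us by (intro exI [of _ us] exI [of _ "[t]"]) auto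
    moreover have bound: "n \<le> len w" if "P n" for n
      using that unfolding P_def reduced_def by auto
    ultimately have "\<exists>n. P n \<and> (\<forall>n'. P n' \<longrightarrow> n' \<le> n)"
      using GreatestI_nat [of P 1 "len w"] Greatest_le_nat [of P _ "len w"] by blast
    then obtain n where Pn: "P n" and max: "\<And>n'. P n' \<Longrightarrow> n' \<le> n"
      by blast
    obtain as bs where bs: "length bs = n" "reduced (as @ bs)" "wp (as @ bs) = w" "set bs \<subseteq> {s, t}"
      using Pn unfolding P_def by blast
    have n1: "n \<ge> 1"
      using max \<open>P 1\<close> by blast
    have lists: "as \<in> lists S" "bs \<in> lists S"
      using bs by (auto simp: reduced_def)
    define v where "v = wp as"
    have v: "v \<in> carrier G" "len v < len w"
      using lists bs n1 reduced_append(1) [OF bs(2)] by (auto simp: v_def reduced_def)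
    \<comment> \<open>A descent of \<open>v\<close> at \<open>s\<close> or \<open>t\<close> could be
      moved into the suffix, against the maximality of \<open>n\<close>.\<close>
    have ascent: "len v < len (v \<otimes> r)" if r: "r = s \<or> r = t" for r
    proof (rule ccontr)
      have rS: "r \<in> S" using r s t by auto
      assume "\<not> len v < len (v \<otimes> r)"
      then have l: "len v = Suc (len (v \<otimes> r))"
        using len_mult_S [OF v(1) rS] by linarith
      obtain cs where cs: "reduced cs" "wp cs = v \<otimes> r" "cs \<in> lists S"
        using reduced_exists [of "v \<otimes> r"] v rS by auto
      have e: "wp (cs @ r # bs) = w"
        using cs lists bs rS v by (simp add: wp_append) (simp add: m_assoc [symmetric] v_def)
      have "length cs + 1 = length as"
        using l cs reduced_append(1) [OF bs(2)] by (simp add: reduced_def v_def)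
      then have "reduced (cs @ r # bs)"
        using e bs cs lists rS by (auto simp: reduced_def)
      then have "P (Suc n)"
        unfolding P_def using e bs r by (intro exI [of _ cs] exI [of _ "r # bs"]) auto
      then show False
        using max by fastforce
    qed
    have vs: "nonneg (rho v (unit_vec s))" and vt: "nonneg (rho v (unit_vec t))"
      using less.hyps [OF v(2) v(1)] s t ascent by auto
    have no_end: "wp cs \<noteq> w \<or> length cs \<noteq> len w" if "cs = ds @ [s]" "ds \<in> lists S" for cs ds
    proof (rule ccontr)
      assume "\<not> ?thesis"
      then have c: "wp cs = w" "length cs = len w" by auto
      then have "w \<otimes> s = wp ds"
        using that s by (auto simp: wp_append)
      then show False
        using len_le [OF that(2)] less.prems(3) c that by simp
    qed
    have "last bs \<noteq> s"
    proof
      assume "last bs = s"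
      moreover have "bs \<noteq> []"
        using bs(1) n1 by auto
      ultimately have "as @ bs = (as @ butlast bs) @ [s]"
        by (metis append.assoc append_butlast_last_id)
      moreover have "as @ butlast bs \<in> lists S"
        using lists by (auto dest: in_set_butlastD)
      moreover have "length (as @ bs) = len w"
        using bs by (simp add: reduced_def)
      ultimately show False
        using no_end bs(3) by blast
    qed
    then have "distinct_adj (bs @ [s])"
      using reduced_distinct_adj [OF reduced_append(2) [OF bs(2)]] by (simp add: distinct_adj_append_iff)
    then have alt: "bs = alt s t n"
      using alt_unique [OF bs(4)] bs(1) by simp
    \<comment> \<open>This bound puts \<open>cheb s t n\<close> and \<open>cheb s t (Suc n)\<close>
      in their nonnegative range. If it failed, a braid move on the last \<open>m s t\<close>
      letters would give a reduced word of \<open>w\<close> ending in \<open>s\<close>, although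
      \<open>s\<close> is an ascent.\<close>
    have n: "m s t = 0 \<or> Suc n \<le> m s t"
    proof (rule ccontr)
      assume a: "\<not> ?thesis"
      then have "m s t \<noteq> 0" "m s t \<le> n"
        by auto
      then obtain i where i: "n = i + m s t" and mm: "m s t \<noteq> 0"
        using le_Suc_ex by (metis add.commute)
      have "\<exists>xs. xs \<in> lists S \<and> length xs = i \<and> alt s t (i + j) = xs @ alt s t j" for i j
      proof (induction i)
        case (Suc i)
        then show ?case
          using s t by (auto intro!: exI [of _ "(if even (i + j) then t else s) # _"])
      qed auto
      then obtain xs where xs: "xs \<in> lists S" "length xs = i" "bs = xs @ alt s t (m s t)"
        using alt i by metis
      obtain p where p: "m s t = Suc p"
        using mm by (cases "m s t") auto
      have b: "alt t s (m s t) = alt s t p @ [s]"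
        unfolding p by (rule alt_Suc_snoc)
      have "wp (as @ xs @ alt t s (m s t)) = w"
      proof -
        have l: "alt s t (m s t) \<in> lists S" "alt t s (m s t) \<in> lists S"
          by (rule alt_in_lists; fact s t)+
        then have l': "xs @ alt s t (m s t) \<in> lists S" "xs @ alt t s (m s t) \<in> lists S"
          using xs(1) by auto
        have "wp (as @ xs @ alt t s (m s t)) = wp (as @ xs @ alt s t (m s t))"
          using wp_append [OF lists(1) l'(1)] wp_append [OF lists(1) l'(2)]
            wp_append [OF xs(1) l(1)] wp_append [OF xs(1) l(2)] braid [OF s t] by simp
        then show ?thesis
          using bs(3) xs(3) by simp
      qed
      moreover have "length (as @ xs @ alt t s (m s t)) = len w"
        using bs xs by (simp add: reduced_def)
      moreover have "as @ xs @ alt t s (m s t) = (as @ xs @ alt s t p) @ [s]"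
        using b by simp
      moreover have "as @ xs @ alt s t p \<in> lists S"
        using lists(1) xs(1) alt_in_lists [OF s t, of p] by auto
      ultimately show False
        using no_end by blast
    qed
    have "rho w (unit_vec s) = rho v (act bs (unit_vec s))"
      using bs lists v by (metis rho_mult rho_wp v_def wp_append wp_closed)
    also have "\<dots> = (\<lambda>r. cheb s t (Suc n) * rho v (unit_vec (if even n then s else t)) r
                      + cheb s t n * rho v (unit_vec (if even n then t else s)) r)"
      unfolding alt act_alt_unit [OF s t] using rho_lin [OF v(1)] by simp
    finally show ?thesis
      using vs vt cheb_nonneg [OF s t \<open>t \<noteq> s\<close> [symmetric], of n] n
        cheb_nonneg [OF s t \<open>t \<noteq> s\<close> [symmetric], of "Suc n"]
      unfolding nonneg_def by auto
  qed
qed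

subsection \<open>Roots and inversion sets\<close>

definition Phi :: "('a \<Rightarrow> real) set" where
  "Phi = {rho w (unit_vec s) | w s. w \<in> carrier G \<and> s \<in> S}"

lemma unit_Phi [simp]: "s \<in> S \<Longrightarrow> unit_vec s \<in> Phi"
  unfolding Phi_def by (intro CollectI exI [of _ \<one>] exI [of _ s]) simp

lemma rho_Phi: "w \<in> carrier G \<Longrightarrow> \<beta> \<in> Phi \<Longrightarrow> rho w \<beta> \<in> Phi"
  unfolding Phi_def using rho_mult m_closed by (smt (verit) mem_Collect_eq)

lemma sref_Phi: "s \<in> S \<Longrightarrow> \<beta> \<in> Phi \<Longrightarrow> sref s \<beta> \<in> Phi"
  using rho_Phi [of s \<beta>] by simp

lemma Phi_norm: "\<beta> \<in> Phi \<Longrightarrow> bil \<beta> \<beta> = 2"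
  unfolding Phi_def using bil_rho bil_unit K_unit by auto

lemma uminus_Phi:
  assumes "\<beta> \<in> Phi"
  shows "(\<lambda>r. - \<beta> r) \<in> Phi"
proof -
  obtain w s where ws: "w \<in> carrier G" "s \<in> S" "\<beta> = rho w (unit_vec s)"
    using assms unfolding Phi_def by blast
  then have "(\<lambda>r. - \<beta> r) = rho (w \<otimes> s) (unit_vec s)"
    by (simp add: rho_mult sref_unit rho_uminus)
  then show ?thesis
    unfolding Phi_def using ws by blast
qed

lemma Phi_signed: "\<beta> \<in> Phi \<Longrightarrow> nonneg \<beta> \<or> nonpos \<beta>"
proof -
  assume "\<beta> \<in> Phi"
  then obtain w s where ws: "w \<in> carrier G" "s \<in> S" "\<beta> = rho w (unit_vec s)"
    unfolding Phi_def by blast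
  show ?thesis
  proof (cases "len w < len (w \<otimes> s)")
    case True
    then show ?thesis using rho_unit_nonneg ws by simp
  next
    case False
    then have "nonneg (rho (w \<otimes> s) (unit_vec s))"
      using len_mult_S [OF ws(1,2)] ws by (intro rho_unit_nonneg) auto
    then show ?thesis
      using ws by (simp add: rho_mult sref_unit rho_uminus nonneg_def nonpos_def)
  qed
qed

lemma Phi_not_both: "\<beta> \<in> Phi \<Longrightarrow> nonneg \<beta> \<Longrightarrow> nonpos \<beta> \<Longrightarrow> False"
proof -
  assume "\<beta> \<in> Phi" "nonneg \<beta>" "nonpos \<beta>"
  then have "\<beta> = (\<lambda>r. 0)"
    by (auto simp: nonneg_def nonpos_def fun_eq_iff intro: antisym)
  then have "bil \<beta> \<beta> = 0"
    by (simp add: bil_def)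
  then show False
    using Phi_norm [OF \<open>\<beta> \<in> Phi\<close>] by simp
qed

lemma not_nonneg_iff: "\<beta> \<in> Phi \<Longrightarrow> \<not> nonneg \<beta> \<longleftrightarrow> nonpos \<beta>"
  using Phi_signed Phi_not_both by blast

lemma nonneg_uminus [simp]: "nonneg (\<lambda>r. - \<beta> r) \<longleftrightarrow> nonpos \<beta>"
  and nonpos_uminus [simp]: "nonpos (\<lambda>r. - \<beta> r) \<longleftrightarrow> nonneg \<beta>"
  by (simp_all add: nonneg_def nonpos_def)

lemma nonneg_unit [simp]: "nonneg (unit_vec s)"
  by (simp add: nonneg_def)

lemma act_outside: "r \<notin> set ws \<Longrightarrow> act ws v r = v r"
  by (induction ws) (auto simp: sref_other)

lemma Phi_multiple:
  assumes "\<beta> \<in> Phi" "s \<in> S" "\<And>r. r \<noteq> s \<Longrightarrow> \<beta> r = 0" "nonneg \<beta>"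
  shows "\<beta> = unit_vec s"
proof -
  have e: "\<beta> = (\<lambda>r. \<beta> s * unit_vec s r)"
    using assms(3) by auto
  have "bil \<beta> \<beta> = \<beta> s * \<beta> s * 2"
    by (subst (1 2) e) (simp only: bil_scale bil_unit [OF assms(2)] K_unit [OF assms(2)] k_diag [OF assms(2)] mult.assoc)
  then have "\<beta> s * \<beta> s = 1"
    using Phi_norm [OF assms(1)] by simp
  then have "\<beta> s = 1"
    using assms(4) by (auto simp: nonneg_def square_eq_1_iff) (metis not_one_le_zero neg_0_le_iff_le)
  then show ?thesis
    using e by simp
qed

text \<open>A simple reflection changes one coordinate only. A positive root that it makes negative
  therefore has no other nonzero coordinate, and its length identifies it as the simple
  root.\<close>

lemma sref_nonneg:
  assumes "\<beta> \<in> Phi" "nonneg \<beta>" "s \<in> S" "\<beta> \<noteq> unit_vec s"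
  shows "nonneg (sref s \<beta>)"
proof (rule ccontr)
  assume "\<not> nonneg (sref s \<beta>)"
  then have n: "nonpos (sref s \<beta>)"
    using not_nonneg_iff sref_Phi assms by blast
  have "\<beta> r = 0" if "r \<noteq> s" for r
    using n assms(2) that sref_other [OF that, of \<beta>] unfolding nonneg_def nonpos_def
    by (metis order_antisym)
  then show False
    using Phi_multiple assms by blast
qed

definition N :: "'a \<Rightarrow> ('a \<Rightarrow> real) set" where
  "N w = {\<beta> \<in> Phi. nonneg \<beta> \<and> nonpos (rho (inv w) \<beta>)}"

lemma N_Phi: "\<beta> \<in> N w \<Longrightarrow> \<beta> \<in> Phi" "\<beta> \<in> N w \<Longrightarrow> nonneg \<beta>"
  by (auto simp: N_def)

lemma N_one [simp]: "N \<one> = {}"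
  using Phi_not_both by (auto simp: N_def)

lemma notin_N: "\<beta> \<in> Phi \<Longrightarrow> nonneg \<beta> \<Longrightarrow> w \<in> carrier G \<Longrightarrow> \<beta> \<notin> N w \<longleftrightarrow> nonneg (rho (inv w) \<beta>)"
  using not_nonneg_iff [of "rho (inv w) \<beta>"] by (auto simp: N_def rho_Phi)

lemma rho_unit_nonpos_iff:
  assumes "w \<in> carrier G" "s \<in> S"
  shows "nonpos (rho w (unit_vec s)) \<longleftrightarrow> len w = Suc (len (w \<otimes> s))"
proof
  assume "nonpos (rho w (unit_vec s))"
  then have "\<not> len w < len (w \<otimes> s)"
    using rho_unit_nonneg assms Phi_not_both rho_Phi unit_Phi by blast
  then show "len w = Suc (len (w \<otimes> s))"
    using len_mult_S assms by fastforce
next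
  assume "len w = Suc (len (w \<otimes> s))"
  then have "nonneg (rho (w \<otimes> s) (unit_vec s))"
    using assms by (intro rho_unit_nonneg) auto
  then show "nonpos (rho w (unit_vec s))"
    using assms by (simp add: rho_mult sref_unit rho_uminus)
qed

lemma unit_N_iff:
  assumes "w \<in> carrier G" "s \<in> S"
  shows "unit_vec s \<in> N w \<longleftrightarrow> len w = Suc (len (s \<otimes> w))"
proof -
  have "inv w \<otimes> s = inv (s \<otimes> w)"
    using assms by (simp add: inv_mult_group)
  then show ?thesis
    using rho_unit_nonpos_iff [of "inv w" s] assms by (simp add: N_def len_inv)
qed

lemma len_S_mult:
  assumes "w \<in> carrier G" "s \<in> S"
  shows "len (s \<otimes> w) = Suc (len w) \<or> len w = Suc (len (s \<otimes> w))"
proof -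
  have "inv w \<otimes> s = inv (s \<otimes> w)"
    using assms by (simp add: inv_mult_group)
  then show ?thesis
    using len_mult_S [of "inv w" s] assms by (simp add: len_inv)
qed

lemma unit_N_S_mult:
  assumes "w \<in> carrier G" "s \<in> S"
  shows "unit_vec s \<in> N (s \<otimes> w) \<longleftrightarrow> unit_vec s \<notin> N w"
proof -
  have "unit_vec s \<in> N (s \<otimes> w) \<longleftrightarrow> len (s \<otimes> w) = Suc (len w)"
    using unit_N_iff [of "s \<otimes> w" s] assms by simp
  then show ?thesis
    using len_S_mult [OF assms] unit_N_iff [OF assms] by linarith
qed

lemma rho_inv_S_mult:
  assumes "w \<in> carrier G" "s \<in> S"
  shows "rho (inv (s \<otimes> w)) \<beta> = rho (inv w) (sref s \<beta>)"
  using assms by (simp add: inv_mult_group rho_mult)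

lemma sref_in_N:
  assumes "w \<in> carrier G" "s \<in> S" "\<beta> \<in> N w" "\<beta> \<noteq> unit_vec s"
  shows "sref s \<beta> \<in> N (s \<otimes> w)"
  using assms sref_nonneg [of \<beta> s] rho_inv_S_mult [of w s "sref s \<beta>"]
  by (simp add: N_def sref_Phi)

lemma N_S_mult:
  assumes w: "w \<in> carrier G" and s: "s \<in> S" and n: "unit_vec s \<notin> N w"
  shows "N (s \<otimes> w) = insert (unit_vec s) (sref s ` N w)"
proof (intro equalityI subsetI)
  fix \<beta>
  assume b: "\<beta> \<in> N (s \<otimes> w)"
  show "\<beta> \<in> insert (unit_vec s) (sref s ` N w)"
  proof (cases "\<beta> = unit_vec s")
    case False
    then have "sref s \<beta> \<in> N w"
      using sref_in_N [of "s \<otimes> w" s \<beta>] b w s by simp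
    then show ?thesis
      using s by (metis imageI insertCI sref_sref)
  qed simp
next
  fix \<beta>
  assume "\<beta> \<in> insert (unit_vec s) (sref s ` N w)"
  then show "\<beta> \<in> N (s \<otimes> w)"
    using unit_N_S_mult [OF w s] sref_in_N [OF w s] n by auto
qed

lemma N_descend:
  assumes w: "w \<in> carrier G" and s: "s \<in> S" and n: "unit_vec s \<in> N w"
  shows "N w = insert (unit_vec s) (sref s ` N (s \<otimes> w))" "unit_vec s \<notin> N (s \<otimes> w)"
    "len w = Suc (len (s \<otimes> w))"
  using N_S_mult [of "s \<otimes> w" s] unit_N_S_mult [OF w s] unit_N_iff [OF w s] assms by simp_all

lemma left_descent_exists:
  assumes w: "w \<in> carrier G" "w \<noteq> \<one>"
  obtains s where "s \<in> S" "unit_vec s \<in> N w"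
proof -
  obtain ws where ws: "reduced ws" "wp ws = w" "ws \<in> lists S"
    using reduced_exists w(1) by blast
  then obtain s us where us: "ws = s # us"
    using w by (cases ws) auto
  then have s: "s \<in> S" "us \<in> lists S"
    using ws by auto
  then have "s \<otimes> w = wp us"
    using ws us by auto
  then have "len (s \<otimes> w) \<le> length us"
    using len_le [OF s(2)] by simp
  then have "len (s \<otimes> w) < len w"
    using ws us by (simp add: reduced_def)
  then show ?thesis
    using that [OF s(1)] unit_N_iff len_S_mult w s by fastforce
qed

lemma N_finite_card: "w \<in> carrier G \<Longrightarrow> finite (N w) \<and> card (N w) = len w"
proof (induction "len w" arbitrary: w rule: less_induct)
  case less
  show ?case
  proof (cases "w = \<one>")
    case False
    then obtain s where s: "s \<in> S" "unit_vec s \<in> N w"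
      using left_descent_exists less.prems by blast
    note d = N_descend [OF less.prems s]
    have IH: "finite (N (s \<otimes> w)) \<and> card (N (s \<otimes> w)) = len (s \<otimes> w)"
      using less.hyps d(3) less.prems s by simp
    have "inj_on (sref s) (N (s \<otimes> w))"
      using s by (intro inj_on_inverseI [of _ "sref s"]) simp
    moreover have "unit_vec s \<notin> sref s ` N (s \<otimes> w)"
    proof
      assume "unit_vec s \<in> sref s ` N (s \<otimes> w)"
      then obtain \<beta> where b: "\<beta> \<in> N (s \<otimes> w)" "unit_vec s = sref s \<beta>"
        by blast
      then have "\<beta> = (\<lambda>r. - unit_vec s r)"
        using s by (metis sref_sref sref_unit)
      then have "nonpos \<beta>"
        by (simp add: nonpos_def)
      then show False
        using b N_Phi Phi_not_both by blast
    qed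
    ultimately show ?thesis
      using IH d by (simp add: card_image)
  qed simp
qed

text \<open>Inclusion of inversion sets makes \<open>v\<close> a prefix of \<open>w\<close>: a left
  descent of \<open>v\<close> is one of \<open>w\<close>, and stripping it from both preserves the
  inclusion.\<close>

lemma N_subset_prefix:
  assumes "v \<in> carrier G" "w \<in> carrier G" "N v \<subseteq> N w"
  shows "len w = len v + len (inv v \<otimes> w)"
  using assms
proof (induction "len v" arbitrary: v w rule: less_induct)
  case less
  show ?case
  proof (cases "v = \<one>")
    case True
    then show ?thesis using less.prems by simp
  next
    case False
    then obtain s where s: "s \<in> S" "unit_vec s \<in> N v"
      using left_descent_exists less.prems by blast
    then have sw: "unit_vec s \<in> N w"
      using less.prems by blast
    note dv = N_descend [OF less.prems(1) s] and dw = N_descend [OF less.prems(2) s(1) sw]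
    have "N (s \<otimes> v) \<subseteq> N (s \<otimes> w)"
    proof
      fix \<beta>
      assume b: "\<beta> \<in> N (s \<otimes> v)"
      then have "sref s \<beta> \<in> N w"
        using dv less.prems by blast
      moreover have "sref s \<beta> \<noteq> unit_vec s"
      proof
        assume "sref s \<beta> = unit_vec s"
        then have "\<beta> = (\<lambda>r. - unit_vec s r)"
          using s by (metis sref_sref sref_unit)
        then have "nonpos \<beta>"
          by (simp add: nonpos_def)
        then show False
          using b N_Phi Phi_not_both by blast
      qed
      ultimately show "\<beta> \<in> N (s \<otimes> w)"
        using sref_in_N [OF less.prems(2) s(1)] s by fastforce
    qed
    then have "len (s \<otimes> w) = len (s \<otimes> v) + len (inv (s \<otimes> v) \<otimes> (s \<otimes> w))"
      using less.hyps [of "s \<otimes> v" "s \<otimes> w"] dv less.prems s by simp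
    moreover have "inv (s \<otimes> v) \<otimes> (s \<otimes> w) = inv v \<otimes> w"
      using less.prems s by (simp add: inv_mult_group m_assoc)
    ultimately show ?thesis
      using dv dw by simp
  qed
qed

lemma N_inj:
  assumes "v \<in> carrier G" "w \<in> carrier G" "N v = N w"
  shows "v = w"
proof -
  have "len (inv v \<otimes> w) = 0"
    using N_subset_prefix [of v w] N_finite_card [of v] N_finite_card [of w] assms by simp
  then have "inv v \<otimes> w = \<one>"
    using len_eq_0 assms by simp
  then show ?thesis
    using assms by (metis inv_closed inv_equality inv_inv)
qed

lemma N_mono_len: "v \<in> carrier G \<Longrightarrow> w \<in> carrier G \<Longrightarrow> N v \<subseteq> N w \<Longrightarrow> len v \<le> len w"
  using N_subset_prefix [of v w] by (metis le_add1)

lemma sref_sign: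
  assumes "\<gamma> \<in> Phi" "s \<in> S" "\<gamma> \<noteq> unit_vec s" "\<gamma> \<noteq> (\<lambda>r. - unit_vec s r)"
  shows "nonpos (sref s \<gamma>) \<longleftrightarrow> nonpos \<gamma>"
proof -
  have 1: "nonneg (sref s \<gamma>)" if "nonneg \<gamma>"
    using sref_nonneg that assms by blast
  have 2: "nonpos (sref s \<gamma>)" if "nonpos \<gamma>"
  proof -
    have ne: "(\<lambda>r. - \<gamma> r) \<noteq> unit_vec s"
      using assms(4) by (metis minus_minus)
    have "nonneg (sref s (\<lambda>r. - \<gamma> r))"
      by (rule sref_nonneg [OF uminus_Phi]) (use that assms ne in auto)
    moreover have "sref s (\<lambda>r. - \<gamma> r) = (\<lambda>r. - sref s \<gamma> r)"
      using act_uminus [of "[s]" \<gamma>] by simp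
    ultimately show ?thesis by simp
  qed
  show ?thesis
    using 1 2 Phi_signed [OF assms(1)] Phi_not_both [OF sref_Phi [OF assms(2,1)]] by blast
qed

text \<open>Right multiplication only affects the root whose preimage is \<open>\<plusminus>\<alpha>\<^sub>s\<close>.\<close>

lemma N_mult_S_descent:
  assumes w: "w \<in> carrier G" and s: "s \<in> S" and d: "nonpos (rho w (unit_vec s))"
  shows "(\<lambda>r. - rho w (unit_vec s) r) \<in> N w"
    and "N (w \<otimes> s) = N w - {\<lambda>r. - rho w (unit_vec s) r}"
proof -
  let ?b = "\<lambda>r. - rho w (unit_vec s) r"
  have bP: "?b \<in> Phi" "nonneg ?b"
    using d uminus_Phi rho_Phi w s by simp_all
  have rb: "rho (inv w) ?b = (\<lambda>r. - unit_vec s r)"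
    using w by (simp add: rho_uminus)
  have inv: "rho (inv (w \<otimes> s)) \<beta> = sref s (rho (inv w) \<beta>)" for \<beta>
    using w s by (simp add: inv_mult_group rho_mult)
  show "?b \<in> N w"
    using bP rb by (simp add: N_def)
  have other: "\<beta> \<in> N (w \<otimes> s) \<longleftrightarrow> \<beta> \<in> N w" if b: "\<beta> \<noteq> ?b" "\<beta> \<in> Phi" "nonneg \<beta>" for \<beta>
  proof -
    have "rho (inv w) \<beta> \<noteq> unit_vec s"
      using b w d Phi_not_both by (metis rho_inv(2))
    moreover have "rho (inv w) \<beta> \<noteq> (\<lambda>r. - unit_vec s r)"
      using b rb w by (metis rho_inv(2))
    ultimately show ?thesis
      using sref_sign [of "rho (inv w) \<beta>" s] rho_Phi [of "inv w" \<beta>] b w s by (simp add: N_def inv)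
  qed
  have removed: "?b \<notin> N (w \<otimes> s)"
  proof
    assume "?b \<in> N (w \<otimes> s)"
    then have "nonpos (sref s (\<lambda>r. - unit_vec s r))"
      using inv rb by (simp add: N_def)
    moreover have "sref s (\<lambda>r. - unit_vec s r) = unit_vec s"
      using sref_sref [OF s, of "unit_vec s"] by (simp only: sref_unit [OF s])
    ultimately show False
      by (auto simp: nonpos_def dest: spec [of _ s])
  qed
  show "N (w \<otimes> s) = N w - {?b}"
  proof (rule Set.set_eqI)
    fix \<beta>
    show "\<beta> \<in> N (w \<otimes> s) \<longleftrightarrow> \<beta> \<in> N w - {?b}"
    proof (cases "\<beta> = ?b")
      case True
      then show ?thesis using removed by blast
    next
      case False
      then show ?thesis
        using other [OF False] N_Phi [of \<beta>] by blast
    qed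
  qed
qed

text \<open>The inversion sequence of a word: each entry is the simple root of a letter, moved by
  the prefix in front of it. For a reduced word it enumerates \<open>N\<close> without repetition
  (\<open>set_root_seq\<close>, \<open>distinct_root_seq\<close>).\<close>

fun root_seq :: "'a list \<Rightarrow> ('a \<Rightarrow> real) list" where
  "root_seq [] = []"
| "root_seq (s # ws) = unit_vec s # map (sref s) (root_seq ws)"

lemma length_root_seq [simp]: "length (root_seq ws) = length ws"
  by (induction ws) auto

lemma root_seq_append: "root_seq (us @ vs) = root_seq us @ map (act us) (root_seq vs)"
  by (induction us) (auto simp: comp_def)

lemma reduced_Cons:
  "reduced (s # ws) \<longleftrightarrow> s \<in> S \<and> reduced ws \<and> unit_vec s \<notin> N (wp ws)"
proof (cases "s \<in> S \<and> reduced ws")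
  case True
  then have s: "s \<in> S" and ws: "ws \<in> lists S" "length ws = len (wp ws)" and "wp ws \<in> carrier G"
    by (auto simp: reduced_def)
  then have "unit_vec s \<in> N (wp ws) \<longleftrightarrow> len (wp ws) = Suc (len (s \<otimes> wp ws))"
    using unit_N_iff by blast
  then have "unit_vec s \<notin> N (wp ws) \<longleftrightarrow> Suc (len (wp ws)) = len (s \<otimes> wp ws)"
    using len_S_mult [of "wp ws" s] s \<open>wp ws \<in> carrier G\<close> by linarith
  then show ?thesis
    using s ws by (simp add: reduced_def)
next
  case False
  then show ?thesis
    using reduced_append(2) [of "[s]" ws] by (auto simp: reduced_def)
qed

lemma set_root_seq: "reduced ws \<Longrightarrow> set (root_seq ws) = N (wp ws)"
proof (induction ws)
  case (Cons s ws)
  then have "s \<in> S" "reduced ws" "unit_vec s \<notin> N (wp ws)"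
    using reduced_Cons by blast+
  moreover from \<open>reduced ws\<close> have "wp ws \<in> carrier G"
    by (simp add: reduced_def)
  ultimately show ?case
    using Cons.IH N_S_mult [of "wp ws" s] by simp
qed simp

lemma distinct_root_seq: "reduced ws \<Longrightarrow> distinct (root_seq ws)"
  using set_root_seq [of ws] N_finite_card [of "wp ws"] by (auto simp: reduced_def intro!: card_distinct)

lemma reduced_snoc:
  assumes "reduced ws" "s \<in> S" "nonneg (act ws (unit_vec s))"
  shows "reduced (ws @ [s])"
proof -
  have ws: "ws \<in> lists S" "length ws = len (wp ws)" and c: "wp ws \<in> carrier G"
    using assms(1) by (auto simp: reduced_def)
  have "nonneg (rho (wp ws) (unit_vec s))"
    using assms(3) rho_wp [OF ws(1)] by simp
  then have "\<not> nonpos (rho (wp ws) (unit_vec s))"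
    using Phi_not_both rho_Phi [OF c unit_Phi [OF assms(2)]] by blast
  then have "len (wp ws \<otimes> s) = Suc (len (wp ws))"
    using rho_unit_nonpos_iff [OF c assms(2)] len_mult_S [OF c assms(2)] by blast
  then show ?thesis
    using ws assms(2) by (simp add: reduced_def wp_append)
qed

section \<open>Supports and parabolic components\<close>

definition supp :: "'a set \<Rightarrow> ('a \<Rightarrow> real) \<Rightarrow> bool" where
  "supp A v \<longleftrightarrow> (\<forall>r. r \<notin> A \<longrightarrow> v r = 0)"

lemma supp_mono: "supp A v \<Longrightarrow> A \<subseteq> B \<Longrightarrow> supp B v"
  by (auto simp: supp_def)

lemma supp_act: "supp A v \<Longrightarrow> set ws \<subseteq> A \<Longrightarrow> supp A (act ws v)"
  unfolding supp_def by (metis act_outside subsetD)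

lemma supp_unit [simp]: "supp A (unit_vec s) \<longleftrightarrow> s \<in> A"
  by (auto simp: supp_def)

lemma supp_root_seq: "\<beta> \<in> set (root_seq ws) \<Longrightarrow> supp (set ws) \<beta>"
proof (induction ws arbitrary: \<beta>)
  case (Cons s ws)
  then consider "\<beta> = unit_vec s" | \<gamma> where "\<gamma> \<in> set (root_seq ws)" "\<beta> = sref s \<gamma>"
    by auto
  then show ?case
  proof cases
    case 2
    have "supp (set ws) \<gamma>"
      using Cons.IH 2(1) .
    then have "supp (set (s # ws)) \<gamma>"
      by (rule supp_mono) auto
    then have "supp (set (s # ws)) (act [s] \<gamma>)"
      by (rule supp_act) simp
    then show ?thesis using 2 by simp
  qed simp
qed simp

lemma rho_sum:
  assumes "w \<in> carrier G" "finite A"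
  shows "rho w (\<lambda>r. \<Sum>j\<in>A. c j * g j r) = (\<lambda>r. \<Sum>j\<in>A. c j * rho w (g j) r)"
  using assms(2)
proof (induction A)
  case empty
  then show ?case using rho_zero [OF assms(1)] by simp
next
  case (insert j A)
  then show ?case
    using rho_lin [OF assms(1), of "c j" "g j" 1 "\<lambda>r. \<Sum>j\<in>A. c j * g j r"] by simp
qed

text \<open>The word \<open>vs\<close> spells the component of the element in the parabolic subgroup
  of \<open>A\<close>. Appending a letter to \<open>ws\<close> either adds a root outside the span
  of \<open>A\<close>, or adds one which, pulled back by the component \<open>z\<close> found so
  far, is a simple root and so extends \<open>vs\<close> by one letter. Keeping the order of the
  roots is essential for \<open>sortable_restrict\<close>.\<close>

lemma parabolic_restrict:
  assumes "reduced ws" "A \<subseteq> S"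
  shows "\<exists>vs. reduced vs \<and> set vs \<subseteq> A \<and> root_seq vs = filter (supp A) (root_seq ws)"
  using assms(1)
proof (induction ws rule: rev_induct)
  case Nil
  then show ?case by (intro exI [of _ "[]"]) simp
next
  case (snoc a ws)
  have ws: "reduced ws" and a: "a \<in> S" and wsS: "ws \<in> lists S"
    using snoc.prems reduced_append(1) [of ws "[a]"] by (auto simp: reduced_def)
  obtain vs where vs: "reduced vs" "set vs \<subseteq> A" "root_seq vs = filter (supp A) (root_seq ws)"
    using snoc.IH ws by blast
  have vsS: "vs \<in> lists S"
    using vs by (simp add: reduced_def)
  define \<beta> where "\<beta> = act ws (unit_vec a)"
  have r: "root_seq (ws @ [a]) = root_seq ws @ [\<beta>]"
    by (simp add: root_seq_append \<beta>_def)
  show ?case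
  proof (cases "supp A \<beta>")
    case False
    then show ?thesis using vs r by auto
  next
    case True
    define w z where "w = wp ws" and "z = wp vs"
    have wz: "w \<in> carrier G" "z \<in> carrier G"
      using wsS vsS by (auto simp: w_def z_def)
    have Nz: "N z = {\<gamma> \<in> N w. supp A \<gamma>}"
      using set_root_seq [OF vs(1)] set_root_seq [OF ws] vs(3) by (auto simp: w_def z_def)
    have \<beta>w: "\<beta> = rho w (unit_vec a)"
      using rho_wp [OF wsS] by (simp add: \<beta>_def w_def)
    have b: "\<beta> \<in> Phi" "nonneg \<beta>" "\<beta> \<notin> N w"
      using set_root_seq [OF snoc.prems] distinct_root_seq [OF snoc.prems] set_root_seq [OF ws]
        N_Phi [of \<beta> "wp (ws @ [a])"]
      unfolding r w_def by auto
    define v where "v = inv z \<otimes> w"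
    have v: "v \<in> carrier G" and zv: "z \<otimes> v = w"
      using wz by (simp_all add: v_def m_assoc [symmetric])
    have iv: "inv v \<otimes> inv z = inv w"
      using wz v zv by (metis inv_mult_group)
    define \<gamma> where "\<gamma> = rho (inv z) \<beta>"
    have z\<gamma>: "rho z \<gamma> = \<beta>"
      using wz by (simp add: \<gamma>_def)
    have \<gamma>v: "rho v (unit_vec a) = \<gamma>"
      using wz by (simp add: v_def \<gamma>_def \<beta>w rho_mult)
    have "\<gamma> = act (rev vs) \<beta>"
      using rho_wp [of "rev vs"] vsS by (simp add: \<gamma>_def z_def wp_rev)
    then have \<gamma>A: "supp A \<gamma>"
      using supp_act [OF True, of "rev vs"] vs by simp
    have \<gamma>P: "\<gamma> \<in> Phi" "nonneg \<gamma>"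
      using b wz Nz notin_N [of \<beta> z] rho_Phi [of "inv z" \<beta>] by (auto simp: \<gamma>_def)
    \<comment> \<open>This says that \<open>v\<close> is the minimal coset representative. The root
      \<open>\<delta>\<close> and its negative lie in the span of \<open>A\<close>, where
      \<open>N z\<close> and \<open>N w\<close> agree, so pulling \<open>\<delta>\<close> back by
      \<open>z\<close> and by \<open>w\<close> gives the same sign; the first pullback is
      \<open>unit_vec j\<close>, the second is \<open>rho (inv v) (unit_vec j)\<close>.\<close>
    have pos: "nonneg (rho (inv v) (unit_vec j))" if j: "j \<in> A" for j
    proof (rule ccontr)
      have jS: "j \<in> S" using j assms by blast
      have P: "rho (inv v) (unit_vec j) \<in> Phi"
        using v jS by (simp add: rho_Phi)
      assume "\<not> ?thesis"
      then have n: "nonpos (rho (inv v) (unit_vec j))"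
        using P not_nonneg_iff by blast
      define \<delta> where "\<delta> = rho z (unit_vec j)"
      have \<delta>: "\<delta> \<in> Phi"
        using wz jS by (simp add: \<delta>_def rho_Phi)
      have "\<delta> = act vs (unit_vec j)"
        using rho_wp [OF vsS] by (simp add: \<delta>_def z_def)
      then have \<delta>A: "supp A \<delta>"
        using supp_act [of A "unit_vec j" vs] vs j by simp
      have z\<delta>: "rho (inv z) \<delta> = unit_vec j"
        using wz by (simp add: \<delta>_def)
      have w\<delta>: "rho (inv w) \<delta> = rho (inv v) (unit_vec j)"
        using rho_mult [of "inv v" "inv z" \<delta>] iv z\<delta> v wz by simp
      show False
      proof (cases "nonneg \<delta>")
        case True
        then have "\<delta> \<in> N z"
          using \<delta> n w\<delta> \<delta>A unfolding Nz by (simp add: N_def)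
        then have "nonpos (unit_vec j)"
          using z\<delta> by (simp add: N_def)
        then show False
          using Phi_not_both [OF unit_Phi [OF jS]] by simp
      next
        case False
        then have "nonneg (\<lambda>r. - \<delta> r)"
          using not_nonneg_iff \<delta> by simp
        moreover have "nonpos (rho (inv z) (\<lambda>r. - \<delta> r))"
          using z\<delta> wz by (simp only: rho_uminus inv_closed nonpos_uminus nonneg_unit)
        ultimately have "(\<lambda>r. - \<delta> r) \<in> N z"
          using uminus_Phi [OF \<delta>] by (simp add: N_def)
        then have "(\<lambda>r. - \<delta> r) \<in> N w"
          using Nz by blast
        then have "nonpos (rho (inv w) (\<lambda>r. - \<delta> r))"
          by (simp add: N_def)
        then have "nonneg (rho (inv v) (unit_vec j))"
          using w\<delta> wz by (simp only: rho_uminus inv_closed nonpos_uminus)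
        then show False
          using n P Phi_not_both by blast
      qed
    qed
    have finA: "finite A"
      using assms(2) fin finite_subset by blast
    have "\<exists>j. \<gamma> j > 0"
      using \<gamma>P Phi_not_both not_less unfolding nonpos_def by metis
    then obtain j where j: "\<gamma> j > 0" by blast
    then have jA: "j \<in> A"
      using \<gamma>A unfolding supp_def by force
    then have jS: "j \<in> S"
      using assms by blast
    have \<gamma>sum: "\<gamma> = (\<lambda>r. \<Sum>i\<in>A. \<gamma> i * unit_vec i r)"
    proof
      fix r
      show "\<gamma> r = (\<Sum>i\<in>A. \<gamma> i * unit_vec i r)"
        using finA \<gamma>A by (auto simp: supp_def if_distrib cong: if_cong)
    qed
    have "unit_vec a = rho (inv v) \<gamma>"
      using \<gamma>v v by (metis rho_inv(1))
    also have "\<dots> = (\<lambda>r. \<Sum>i\<in>A. \<gamma> i * rho (inv v) (unit_vec i) r)"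
      by (subst \<gamma>sum) (rule rho_sum, use v finA in auto)
    finally have ua: "unit_vec a = (\<lambda>r. \<Sum>i\<in>A. \<gamma> i * rho (inv v) (unit_vec i) r)" .
    \<comment> \<open>A simple root has been written as a nonnegative combination of positive roots.
      Nothing can cancel, so every summand with positive coefficient is supported on
      \<open>a\<close> alone.\<close>
    have "rho (inv v) (unit_vec j) = unit_vec a"
    proof (rule Phi_multiple)
      fix r assume "r \<noteq> a"
      then have "(\<Sum>i\<in>A. \<gamma> i * rho (inv v) (unit_vec i) r) = 0"
        using fun_cong [OF ua, of r] by simp
      moreover have "\<forall>i\<in>A. 0 \<le> \<gamma> i * rho (inv v) (unit_vec i) r"
        using pos \<gamma>P(2) by (auto simp: nonneg_def)
      ultimately have "\<gamma> j * rho (inv v) (unit_vec j) r = 0"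
        using sum_nonneg_eq_0_iff [OF finA, of "\<lambda>i. \<gamma> i * rho (inv v) (unit_vec i) r"] jA by blast
      then show "rho (inv v) (unit_vec j) r = 0"
        using j by simp
    qed (use a pos [OF jA] v jS rho_Phi in auto)
    then have "\<gamma> = unit_vec j"
      using \<gamma>v v by (metis rho_inv(2))
    then have bj: "\<beta> = act vs (unit_vec j)"
      using z\<gamma> rho_wp [OF vsS] by (simp add: z_def)
    then have "reduced (vs @ [j])"
      using reduced_snoc vs(1) jS b(2) by blast
    moreover have "root_seq (vs @ [j]) = filter (supp A) (root_seq (ws @ [a]))"
      using r True vs(3) bj by (simp add: root_seq_append)
    ultimately show ?thesis
      using vs jA by (intro exI [of _ "vs @ [j]"]) auto
  qed
qed

text \<open>The representation is faithful: \<open>N\<close> depends only on the action and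
  determines the element.\<close>

lemma rho_inj:
  assumes "v \<in> carrier G" "w \<in> carrier G" "\<And>x. rho v x = rho w x"
  shows "v = w"
proof (rule N_inj)
  have "rho (inv v) x = rho (inv w) x" for x
    using rho_inv assms by metis
  then show "N v = N w"
    by (simp add: N_def)
qed (use assms in auto)

lemma rho_reflection:
  assumes "w \<in> carrier G" "s \<in> S"
  shows "rho (w \<otimes> s \<otimes> inv w) x = (\<lambda>r. x r - bil (rho w (unit_vec s)) x * rho w (unit_vec s) r)"
proof -
  have "rho (w \<otimes> s \<otimes> inv w) x = rho w (sref s (rho (inv w) x))"
    using assms by (simp add: rho_mult)
  also have "\<dots> = rho w (\<lambda>r. 1 * rho (inv w) x r + (- K s (rho (inv w) x)) * unit_vec s r)"
    by (simp add: sref_def)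
  also have "\<dots> = (\<lambda>r. x r - K s (rho (inv w) x) * rho w (unit_vec s) r)"
    by (subst rho_lin) (use assms in simp_all)
  also have "K s (rho (inv w) x) = bil (rho w (unit_vec s)) x"
    using bil_rho [of w "unit_vec s" "rho (inv w) x"] assms by (simp add: bil_unit)
  finally show ?thesis .
qed

lemma conj_of_rho_unit:
  assumes "w \<in> carrier G" "s \<in> S" "a \<in> S" "rho w (unit_vec a) = unit_vec s"
  shows "s \<otimes> w = w \<otimes> a"
proof -
  have "w \<otimes> a \<otimes> inv w = s"
  proof (rule rho_inj)
    show "rho (w \<otimes> a \<otimes> inv w) x = rho s x" for x
      using rho_reflection [OF assms(1,3), of x] assms by (simp add: sref_def bil_unit)
  qed (use assms in auto)
  then show ?thesis
    using assms by (metis S_closed inv_closed inv_solve_right m_closed)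
qed

subsection \<open>The Euler form of a Coxeter element\<close>

text \<open>The pairing of the simple root of \<open>s\<close> with the part of a vector on the
  letters of \<open>cs\<close>. Under the hypotheses of \<open>K_Lf\<close> it is \<open>K s\<close>
  without its diagonal term.\<close>

definition Lf :: "'a list \<Rightarrow> 'a \<Rightarrow> ('a \<Rightarrow> real) \<Rightarrow> real" where
  "Lf cs s \<beta> = (\<Sum>q\<leftarrow>cs. k q s * \<beta> q)"

text \<open>The Euler form of the Coxeter element \<open>cs\<close>, on vectors supported on the letters of \<open>cs\<close>.\<close>

fun E :: "'a list \<Rightarrow> ('a \<Rightarrow> real) \<Rightarrow> ('a \<Rightarrow> real) \<Rightarrow> real" where
  "E [] \<beta> \<gamma> = 0"
| "E (s # cs) \<beta> \<gamma> = \<beta> s * \<gamma> s + Lf cs s \<beta> * \<gamma> s + E cs \<beta> \<gamma>"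

lemma Lf_simps [simp]: "Lf [] s \<beta> = 0" "Lf (q # cs) s \<beta> = k q s * \<beta> q + Lf cs s \<beta>"
  by (simp_all add: Lf_def)

lemma Lf_append: "Lf (cs @ ds) s \<beta> = Lf cs s \<beta> + Lf ds s \<beta>"
  by (simp add: Lf_def)

lemma Lf_cong: "(\<And>q. q \<in> set cs \<Longrightarrow> \<beta> q = \<beta>' q) \<Longrightarrow> Lf cs s \<beta> = Lf cs s \<beta>'"
  by (induction cs) auto

lemma E_cong:
  "(\<And>q. q \<in> set cs \<Longrightarrow> \<beta> q = \<beta>' q) \<Longrightarrow> (\<And>q. q \<in> set cs \<Longrightarrow> \<gamma> q = \<gamma>' q) \<Longrightarrow>
    E cs \<beta> \<gamma> = E cs \<beta>' \<gamma>'"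
proof (induction cs)
  case (Cons s cs)
  then have "Lf cs s \<beta> = Lf cs s \<beta>'"
    by (intro Lf_cong) simp
  with Cons show ?case by simp
qed simp

lemma Lf_lin: "Lf cs s (\<lambda>r. a * u r + b * v r) = a * Lf cs s u + b * Lf cs s v"
  by (induction cs) (auto simp: algebra_simps)

lemma Lf_zero: "(\<And>q. q \<in> set cs \<Longrightarrow> \<beta> q = 0) \<Longrightarrow> Lf cs s \<beta> = 0"
  by (induction cs) auto

lemma E_lin_left: "E cs (\<lambda>r. a * u r + b * v r) \<gamma> = a * E cs u \<gamma> + b * E cs v \<gamma>"
  by (induction cs) (auto simp: Lf_lin algebra_simps)

lemma E_lin_right: "E cs \<gamma> (\<lambda>r. a * u r + b * v r) = a * E cs \<gamma> u + b * E cs \<gamma> v"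
  by (induction cs) (auto simp: algebra_simps)

lemma E_add_right: "E cs \<gamma> (\<lambda>r. u r + v r) = E cs \<gamma> u + E cs \<gamma> v"
  using E_lin_right [of cs \<gamma> 1 u 1 v] by simp

lemma E_add_left: "E cs (\<lambda>r. u r + v r) \<gamma> = E cs u \<gamma> + E cs v \<gamma>"
  using E_lin_left [of cs 1 u 1 v \<gamma>] by simp

lemma E_uminus [simp]: "E cs (\<lambda>r. - u r) v = - E cs u v" "E cs u (\<lambda>r. - v r) = - E cs u v"
  using E_lin_left [of cs "-1" u 0 u v] E_lin_right [of cs u "-1" v 0 v] by simp_all

lemma E_zero: "(\<And>q. q \<in> set cs \<Longrightarrow> \<gamma> q = 0) \<Longrightarrow> E cs \<beta> \<gamma> = 0"
  by (induction cs) auto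

lemma E_zero_left: "(\<And>q. q \<in> set cs \<Longrightarrow> \<beta> q = 0) \<Longrightarrow> E cs \<beta> \<gamma> = 0"
  by (induction cs) (auto simp: Lf_zero)

lemma E_snoc:
  assumes "set (cs @ [s]) \<subseteq> S"
  shows "E (cs @ [s]) \<beta> \<gamma> = E cs \<beta> \<gamma> + \<beta> s * \<gamma> s + \<beta> s * Lf cs s \<gamma>"
  using assms by (induction cs) (auto simp: Lf_append k_sym [of s] algebra_simps)

lemma K_Lf:
  assumes "distinct (s # cs)" "set (s # cs) \<subseteq> S" "supp (set (s # cs)) \<beta>"
  shows "K s \<beta> = 2 * \<beta> s + Lf cs s \<beta>"
proof -
  have "K s \<beta> = (\<Sum>r\<in>set (s # cs). k s r * \<beta> r)"
    using assms by (intro K_supp) (auto simp: supp_def)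
  also have "\<dots> = k s s * \<beta> s + (\<Sum>r\<in>set cs. k s r * \<beta> r)"
    using assms by simp
  also have "(\<Sum>r\<in>set cs. k s r * \<beta> r) = (\<Sum>r\<in>set cs. k r s * \<beta> r)"
    using assms by (intro sum.cong) (auto simp: k_sym [of s])
  also have "\<dots> = Lf cs s \<beta>"
    using assms by (simp add: Lf_def sum_list_distinct_conv_sum_set)
  finally show ?thesis
    using assms by simp
qed

text \<open>Only the coordinate at \<open>s\<close> changes, from \<open>v s\<close> to
  \<open>- v s - Lf cs s v\<close>. After substitution the terms with \<open>Lf cs s \<beta>\<close>
  cancel, and what remains is the expansion at a last letter in \<open>E_snoc\<close>.\<close>

lemma E_sref:
  assumes "distinct (s # cs)" "set (s # cs) \<subseteq> S"
    "supp (set (s # cs)) \<beta>" "supp (set (s # cs)) \<gamma>"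
  shows "E (s # cs) (sref s \<beta>) (sref s \<gamma>) = E (cs @ [s]) \<beta> \<gamma>"
proof -
  have c: "sref s v q = v q" if "q \<in> set cs" for q v
    using that assms(1) by (intro sref_other) auto
  have s: "sref s v s = - v s - Lf cs s v" if "supp (set (s # cs)) v" for v
    using K_Lf [OF assms(1,2) that] by (simp add: sref_def)
  have L: "Lf cs s (sref s \<beta>) = Lf cs s \<beta>"
    using c by (rule Lf_cong)
  have "E cs (sref s \<beta>) (sref s \<gamma>) = E cs \<beta> \<gamma>"
    using c by (intro E_cong) auto
  then show ?thesis
    using assms by (simp add: E_snoc L s algebra_simps)
qed

text \<open>The Euler form is the triangular half of \<open>bil\<close>, with 1 instead of 2 on the
  diagonal. \<open>cut\<close> removes the coordinate at \<open>s\<close>, so that the induction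
  hypothesis applies to vectors supported on \<open>cs\<close>.\<close>

lemma E_sym:
  assumes "distinct cs" "set cs \<subseteq> S" "supp (set cs) \<beta>" "supp (set cs) \<gamma>"
  shows "E cs \<beta> \<gamma> + E cs \<gamma> \<beta> = bil \<beta> \<gamma>"
  using assms
proof (induction cs arbitrary: \<beta> \<gamma>)
  case Nil
  then show ?case by (simp add: bil_def supp_def)
next
  case (Cons s cs)
  then have s: "s \<in> S" "s \<notin> set cs" "set cs \<subseteq> S" "distinct cs"
    by auto
  define cut where "cut = (\<lambda>v. v(s := (0::real)))"
  have cut: "v = (\<lambda>r. 1 * cut v r + v s * unit_vec s r)" for v :: "'a \<Rightarrow> real"
    by (auto simp: cut_def)
  have cs: "supp (set cs) (cut \<beta>)" "supp (set cs) (cut \<gamma>)"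
    using Cons.prems by (auto simp: supp_def cut_def)
  have E: "E cs (cut u) (cut v) = E cs u v" for u v
    using s by (intro E_cong) (auto simp: cut_def)
  have K: "K s (cut v) = Lf cs s v" if "supp (set cs) (cut v)" for v
  proof -
    have "K s (cut v) = 2 * cut v s + Lf cs s (cut v)"
      using Cons.prems supp_mono [OF that] by (intro K_Lf) auto
    also have "Lf cs s (cut v) = Lf cs s v"
      using s by (intro Lf_cong) (auto simp: cut_def)
    finally show ?thesis
      by (simp only: cut_def fun_upd_same mult_zero_right add_0)
  qed
  have "bil \<beta> \<gamma> = bil (cut \<beta>) \<gamma> + \<beta> s * K s \<gamma>"
    by (subst cut [of \<beta>]) (simp only: bil_lin_left bil_unit [OF s(1)])
  also have "K s \<gamma> = K s (cut \<gamma>) + \<gamma> s * 2"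
    by (subst cut [of \<gamma>]) (simp only: K_lin K_unit [OF s(1)] k_diag [OF s(1)])
  also have "bil (cut \<beta>) \<gamma> = bil (cut \<beta>) (cut \<gamma>) + \<gamma> s * K s (cut \<beta>)"
    by (subst cut [of \<gamma>]) (simp only: bil_lin_right bil_sym [of "cut \<beta>" "unit_vec s"] bil_unit [OF s(1)])
  also have "bil (cut \<beta>) (cut \<gamma>) = E cs \<beta> \<gamma> + E cs \<gamma> \<beta>"
    using Cons.IH [OF s(4,3) cs] by (simp add: E)
  finally show ?case
    using K [OF cs(1)] K [OF cs(2)] by (simp add: algebra_simps)
qed

lemma E_initial:
  assumes "s \<notin> set cs"
  shows "E (s # cs) (unit_vec s) \<beta> = \<beta> s" "E (s # cs) \<beta> (unit_vec s) = \<beta> s + Lf cs s \<beta>"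
proof -
  have "\<And>q. q \<in> set cs \<Longrightarrow> unit_vec s q = 0"
    using assms by auto
  then show "E (s # cs) (unit_vec s) \<beta> = \<beta> s" "E (s # cs) \<beta> (unit_vec s) = \<beta> s + Lf cs s \<beta>"
    by (simp_all add: Lf_zero E_zero E_zero_left)
qed

lemma Lf_nonpos:
  assumes "distinct (s # cs)" "set (s # cs) \<subseteq> S" "nonneg \<beta>"
  shows "Lf cs s \<beta> \<le> 0"
  using assms
  by (induction cs) (auto simp: nonneg_def intro!: add_nonpos_nonpos mult_nonpos_nonneg k_nonpos)

definition omega :: "'a list \<Rightarrow> ('a \<Rightarrow> real) \<Rightarrow> ('a \<Rightarrow> real) \<Rightarrow> real" where
  "omega cs \<beta> \<gamma> = E cs \<beta> \<gamma> - E cs \<gamma> \<beta>"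

subsection \<open>Sortable elements through the Euler form\<close>

text \<open>Sortability read off one position at a time: the greedy word takes an initial letter
  exactly when it is a left descent. A taken letter moves to the end for the next copy; a skipped
  one may never return and leaves the list. \<open>c_sortable_iff_sortable\<close> connects this
  with positions.\<close>

inductive sortable :: "'a list \<Rightarrow> 'a \<Rightarrow> bool" where
  sortable_Nil: "sortable [] \<one>"
| sortable_skip: "unit_vec s \<notin> N w \<Longrightarrow> sortable cs w \<Longrightarrow> sortable (s # cs) w"
| sortable_take: "unit_vec s \<in> N w \<Longrightarrow> w \<in> carrier G \<Longrightarrow> sortable (cs @ [s]) (s \<otimes> w) \<Longrightarrow> sortable (s # cs) w"

lemma sortable_one: "sortable cs \<one>"
  by (induction cs) (auto intro: sortable_Nil sortable_skip)

lemma sortable_closed: "sortable cs w \<Longrightarrow> w \<in> carrier G"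
  by (induction rule: sortable.induct) auto

lemma sortable_Nil_iff: "sortable [] w \<longleftrightarrow> w = \<one>"
  by (auto intro: sortable_Nil elim: sortable.cases)

lemma sortable_Cons_skip: "unit_vec s \<notin> N w \<Longrightarrow> sortable (s # cs) w \<longleftrightarrow> sortable cs w"
  by (auto intro: sortable_skip elim: sortable.cases)

lemma sortable_Cons_take: "unit_vec s \<in> N w \<Longrightarrow> w \<in> carrier G \<Longrightarrow> sortable (s # cs) w \<longleftrightarrow> sortable (cs @ [s]) (s \<otimes> w)"
  by (auto intro: sortable_take elim: sortable.cases)

lemma supp_sref: "supp A v \<Longrightarrow> s \<in> A \<Longrightarrow> supp A (sref s v)"
  using supp_act [of A v "[s]"] by simp

lemma omega_Cons_supp: "\<beta> s = 0 \<Longrightarrow> \<gamma> s = 0 \<Longrightarrow> omega (s # cs) \<beta> \<gamma> = omega cs \<beta> \<gamma>"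
  by (simp add: omega_def)

lemma omega_sref:
  assumes "distinct (s # cs)" "set (s # cs) \<subseteq> S"
    "supp (set (s # cs)) \<beta>" "supp (set (s # cs)) \<gamma>"
  shows "omega (s # cs) (sref s \<beta>) (sref s \<gamma>) = omega (cs @ [s]) \<beta> \<gamma>"
  unfolding omega_def using E_sref [OF assms] E_sref [OF assms(1,2,4,3)] by simp

text \<open>Together with \<open>Lf_nonpos\<close>, this lets an initial simple root stand in front
  of any list of positive roots without spoiling sortedness.\<close>

lemma omega_initial:
  "s \<notin> set cs \<Longrightarrow> omega (s # cs) (unit_vec s) \<beta> = - Lf cs s \<beta>"
  "s \<notin> set cs \<Longrightarrow> omega (s # cs) \<beta> (unit_vec s) = Lf cs s \<beta>"
  unfolding omega_def using E_initial [of s cs \<beta>] by simp_all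

text \<open>Skipping \<open>s\<close> leaves roots without a coordinate at \<open>s\<close>, on
  which the old and new forms agree. Taking \<open>s\<close> transports the pairs of roots by
  \<open>omega_sref\<close> and puts the initial simple root in front.\<close>

theorem sortable_imp_omega_sorted:
  assumes "sortable cs w" "distinct cs" "set cs \<subseteq> S"
  shows "\<exists>ws. reduced ws \<and> set ws \<subseteq> set cs \<and> wp ws = w
           \<and> sorted_wrt (\<lambda>\<beta> \<gamma>. omega cs \<beta> \<gamma> \<ge> 0) (root_seq ws)"
  using assms
proof (induction rule: sortable.induct)
  case sortable_Nil
  then show ?case by (intro exI [of _ "[]"]) (simp add: reduced_def)
next
  case (sortable_skip s w cs)
  then obtain ws where ws: "reduced ws" "set ws \<subseteq> set cs" "wp ws = w"
    "sorted_wrt (\<lambda>\<beta> \<gamma>. omega cs \<beta> \<gamma> \<ge> 0) (root_seq ws)"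
    by auto
  have "\<beta> s = 0" if "\<beta> \<in> set (root_seq ws)" for \<beta>
    using supp_root_seq [OF that] ws(2) sortable_skip.prems by (auto simp: supp_def)
  then have "sorted_wrt (\<lambda>\<beta> \<gamma>. omega (s # cs) \<beta> \<gamma> \<ge> 0) (root_seq ws)"
    using sorted_wrt_mono_rel [OF _ ws(4)] omega_Cons_supp by (metis (lifting))
  then show ?case
    using ws by (intro exI [of _ ws]) auto
next
  case (sortable_take s w cs)
  have d: "distinct (s # cs)" "set (s # cs) \<subseteq> S"
    using sortable_take.prems by auto
  have w: "w \<in> carrier G" and s: "s \<in> S"
    using sortable_take by auto
  obtain ws where ws: "reduced ws" "set ws \<subseteq> set (cs @ [s])" "wp ws = s \<otimes> w"
    "sorted_wrt (\<lambda>\<beta> \<gamma>. omega (cs @ [s]) \<beta> \<gamma> \<ge> 0) (root_seq ws)"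
    using sortable_take.IH d by auto
  have r: "reduced (s # ws)"
    using ws s N_descend(2) [OF w s sortable_take.hyps(1)] by (simp add: reduced_Cons)
  have sw: "wp (s # ws) = w"
    using ws w s by simp
  have sup: "supp (set (s # cs)) \<beta>" if "\<beta> \<in> set (root_seq ws)" for \<beta>
    using supp_mono [OF supp_root_seq [OF that]] ws(2) by auto
  have "sorted_wrt (\<lambda>\<beta> \<gamma>. omega (s # cs) (sref s \<beta>) (sref s \<gamma>) \<ge> 0) (root_seq ws)"
    using ws(4) by (rule sorted_wrt_mono_rel [rotated]) (use omega_sref [OF d] sup in auto)
  moreover have "omega (s # cs) (unit_vec s) (sref s \<beta>) \<ge> 0" if "\<beta> \<in> set (root_seq ws)" for \<beta>
  proof -
    have "sref s \<beta> \<in> N w"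
      using set_root_seq [OF r] sw that by auto
    then have "nonneg (sref s \<beta>)"
      by (rule N_Phi)
    then show ?thesis
      using omega_initial(1) [of s cs] Lf_nonpos [OF d] d by simp
  qed
  ultimately have "sorted_wrt (\<lambda>\<beta> \<gamma>. omega (s # cs) \<beta> \<gamma> \<ge> 0) (root_seq (s # ws))"
    by (simp add: sorted_wrt_map)
  then show ?case
    using r sw ws(2) by (intro exI [of _ "s # ws"]) auto
qed

lemma act_unit_expand:
  assumes "s \<in> S" "set bs \<subseteq> S"
  shows "act bs (unit_vec s) = (\<lambda>r. unit_vec s r + (\<Sum>i<length bs. - k (bs ! i) s * (root_seq bs ! i) r))"
  using assms(2)
proof (induction bs rule: rev_induct)
  case Nil
  then show ?case by simp
next
  case (snoc b bs)
  have "act (bs @ [b]) (unit_vec s) = act bs (\<lambda>r. 1 * unit_vec s r + (- k b s) * unit_vec b r)"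
    using assms(1) snoc.prems by (simp add: act_append sref_def K_unit)
  also have "\<dots> = (\<lambda>r. act bs (unit_vec s) r + - k b s * act bs (unit_vec b) r)"
    by (subst act_lin) simp
  finally show ?case
    using snoc by (simp add: root_seq_append nth_append add_diff_eq)
qed

lemma omega_sum_left:
  "omega cs (\<lambda>r. \<Sum>i<n. c i * g i r) \<gamma> = (\<Sum>i<(n::nat). c i * omega cs (g i) \<gamma>)"
proof (induction n)
  case 0
  then show ?case by (simp add: omega_def E_zero E_zero_left)
next
  case (Suc n)
  have "omega cs (\<lambda>r. 1 * (\<Sum>i<n. c i * g i r) + c n * g n r) \<gamma>
      = 1 * omega cs (\<lambda>r. \<Sum>i<n. c i * g i r) \<gamma> + c n * omega cs (g n) \<gamma>"
    by (simp only: omega_def E_lin_left E_lin_right) (simp add: algebra_simps)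
  with Suc show ?case by simp
qed

lemma Lf_sum: "Lf cs s (\<lambda>r. \<Sum>i<n. c i * g i r) = (\<Sum>i<(n::nat). c i * Lf cs s (g i))"
proof (induction n)
  case 0
  then show ?case by (simp add: Lf_zero)
next
  case (Suc n)
  have "Lf cs s (\<lambda>r. 1 * (\<Sum>i<n. c i * g i r) + c n * g n r)
      = 1 * Lf cs s (\<lambda>r. \<Sum>i<n. c i * g i r) + c n * Lf cs s (g n)"
    by (rule Lf_lin)
  with Suc show ?case by simp
qed

text \<open>
  With \<open>act bs \<alpha>\<^sub>s = \<alpha>\<^sub>s + \<zeta>\<close> and \<open>\<zeta>\<close> a nonnegative combination of the roots of \<open>bs\<close>, the hypothesis
  gives \<open>0 \<le> \<omega>(\<zeta>, \<alpha>\<^sub>s + \<zeta>) = \<omega>(\<zeta>, \<alpha>\<^sub>s)\<close>, whereas \<open>s\<close> being initial makes each term on the right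
  nonpositive.
\<close>

lemma omega_sorted_commuting:
  assumes d: "distinct (s # cs)" "set (s # cs) \<subseteq> S"
    and bs: "reduced bs" "set bs \<subseteq> set cs"
    and om: "\<And>\<gamma>. \<gamma> \<in> set (root_seq bs) \<Longrightarrow> omega (s # cs) \<gamma> (act bs (unit_vec s)) \<ge> 0"
    and b: "b \<in> set bs"
  shows "k b s = 0"
proof (rule ccontr)
  assume kb: "k b s \<noteq> 0"
  define l where "l = length bs"
  define n where "n = (\<lambda>i. - k (bs ! i) s)"
  define g where "g = (\<lambda>i. root_seq bs ! i)"
  define \<zeta> where "\<zeta> = (\<lambda>r. \<Sum>i<l. n i * g i r)"
  have s: "s \<in> S" "s \<notin> set cs" and csS: "set cs \<subseteq> S" using d by auto
  have bsS: "set bs \<subseteq> S" using bs csS by auto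
  have e: "act bs (unit_vec s) = (\<lambda>r. unit_vec s r + \<zeta> r)"
    using act_unit_expand [OF s(1) bsS] by (simp add: \<zeta>_def n_def g_def l_def)
  have n0: "n i \<ge> 0" if "i < l" for i
  proof -
    have "bs ! i \<in> set cs"
      using that bs(2) by (auto simp: l_def)
    then have "k (bs ! i) s \<le> 0"
      using s csS by (intro k_nonpos) auto
    then show ?thesis
      by (simp add: n_def)
  qed
  have g: "g i \<in> set (root_seq bs)" "nonneg (g i)" if "i < l" for i
  proof -
    show 1: "g i \<in> set (root_seq bs)"
      using that by (simp add: g_def l_def)
    show "nonneg (g i)"
      using 1 set_root_seq [OF bs(1)] N_Phi(2) by blast
  qed
  have L0: "Lf cs s (g i) \<le> 0" if "i < l" for i
    using Lf_nonpos [OF d] g(2) [OF that] .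
  have "0 \<le> (\<Sum>i<l. n i * omega (s # cs) (g i) (act bs (unit_vec s)))"
    using n0 om g by (intro sum_nonneg mult_nonneg_nonneg) auto
  also have "\<dots> = omega (s # cs) \<zeta> (act bs (unit_vec s))"
    by (simp only: \<zeta>_def omega_sum_left)
  also have "\<dots> = omega (s # cs) \<zeta> (unit_vec s)"
    unfolding e omega_def E_add_right E_add_left by simp
  also have "\<dots> = (\<Sum>i<l. n i * Lf cs s (g i))"
    unfolding omega_initial(2) [OF s(2)] unfolding \<zeta>_def by (rule Lf_sum)
  finally have "0 \<le> (\<Sum>i<l. n i * Lf cs s (g i))" .
  then have "(\<Sum>i<l. - (n i * Lf cs s (g i))) \<le> 0"
    by (simp add: sum_negf)
  moreover have nn: "\<And>i. i \<in> {..<l} \<Longrightarrow> 0 \<le> - (n i * Lf cs s (g i))"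
    using n0 L0 by (simp add: mult_nonneg_nonpos)
  ultimately have "(\<Sum>i<l. - (n i * Lf cs s (g i))) = 0"
    using sum_nonneg [of "{..<l}", OF nn] by (intro antisym) simp_all
  then have zero: "n i * Lf cs s (g i) = 0" if "i < l" for i
    using sum_nonneg_eq_0_iff [of "{..<l}", OF _ nn] that by auto
  \<comment> \<open>Let \<open>q\<close> be the first letter of \<open>bs\<close> not commuting with
    \<open>s\<close>. It does not occur earlier, so its root has coefficient 1 at \<open>q\<close>,
    and this coordinate alone makes \<open>Lf cs s\<close> strictly negative on that root.\<close>
  obtain xs q ys where bsq: "bs = xs @ q # ys" "k q s \<noteq> 0" and xs: "\<forall>x\<in>set xs. k x s = 0"
    using split_list_first_prop [of bs "\<lambda>x. k x s \<noteq> 0"] b kb by auto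
  let ?i = "length xs"
  have i: "?i < l" "bs ! ?i = q"
    using bsq by (auto simp: l_def)
  have q: "q \<in> set cs" "q \<in> S"
    using bsq bs csS by auto
  have gi: "g ?i = act xs (unit_vec q)"
    using bsq by (simp add: g_def root_seq_append nth_append)
  have "q \<notin> set xs"
    using xs bsq by blast
  then have gq: "g ?i q = 1"
    unfolding gi by (subst act_outside) auto
  have "n ?i \<noteq> 0"
    using bsq i by (simp add: n_def)
  then have L: "Lf cs s (g ?i) = 0"
    using zero [OF i(1)] by simp
  obtain us vs where cs: "cs = us @ q # vs"
    using split_list q by fast
  have "Lf us s (g ?i) \<le> 0" "Lf vs s (g ?i) \<le> 0"
    using d cs g(2) [OF i(1)] by (auto intro!: Lf_nonpos)
  moreover have "k q s < 0"
    using k_nonpos [OF q(2) s(1)] bsq s q by fastforce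
  ultimately show False
    using L unfolding cs by (simp add: Lf_append gq)
qed

lemma root_seq_split:
  assumes "\<beta> \<in> set (root_seq ws)"
  obtains xs a ys where "ws = xs @ a # ys" "act xs (unit_vec a) = \<beta>"
    "root_seq ws = root_seq xs @ \<beta> # map (act (xs @ [a])) (root_seq ys)"
proof -
  obtain i where i: "i < length ws" "root_seq ws ! i = \<beta>"
    using assms by (metis in_set_conv_nth length_root_seq)
  define xs a ys where "xs = take i ws" and "a = ws ! i" and "ys = drop (Suc i) ws"
  have ws: "ws = xs @ a # ys"
    using i by (simp add: xs_def a_def ys_def id_take_nth_drop)
  have l: "length xs = i"
    using i by (simp add: xs_def)
  have r: "root_seq ws = root_seq xs @ act xs (unit_vec a) # map (act (xs @ [a])) (root_seq ys)"
    unfolding ws by (simp add: root_seq_append act_append comp_def)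
  then have "act xs (unit_vec a) = \<beta>"
    using i l by (simp add: nth_append)
  then show ?thesis
    using that ws r by blast
qed

text \<open>If \<open>s\<close> is a left descent, sortedness lets it be moved to the front of the
  word; if not, sortedness keeps it out of the word altogether. So the recursion of
  \<open>sortable\<close> can be followed, each step shortening \<open>ws\<close> or
  \<open>cs\<close>.\<close>

theorem omega_sorted_imp_sortable:
  assumes "reduced ws" "set ws \<subseteq> set cs" "distinct cs" "set cs \<subseteq> S"
    "sorted_wrt (\<lambda>\<beta> \<gamma>. omega cs \<beta> \<gamma> \<ge> 0) (root_seq ws)"
  shows "sortable cs (wp ws)"
  using assms
proof (induction "length cs + length ws" arbitrary: cs ws rule: less_induct)
  case less
  show ?case
  proof (cases cs)
    case Nil
    then show ?thesis
      using less.prems by (simp add: sortable_Nil)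
  next
    case (Cons s cs')
    have d: "distinct (s # cs')" "set (s # cs') \<subseteq> S"
      using less.prems Cons by auto
    then have s: "s \<in> S" "s \<notin> set cs'"
      by auto
    have wsS: "ws \<in> lists S" and w: "wp ws \<in> carrier G"
      using less.prems by (auto simp: reduced_def)
    have sup: "supp (set (s # cs')) \<beta>" if "\<beta> \<in> set (root_seq ws)" for \<beta>
      using supp_mono [OF supp_root_seq [OF that]] less.prems Cons by auto
    show ?thesis
    proof (cases "unit_vec s \<in> N (wp ws)")
      case True
      then have "unit_vec s \<in> set (root_seq ws)"
        using set_root_seq less.prems by blast
      then obtain xs a ys where ws: "ws = xs @ a # ys" "act xs (unit_vec a) = unit_vec s"
        "root_seq ws = root_seq xs @ unit_vec s # map (act (xs @ [a])) (root_seq ys)"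
        by (rule root_seq_split)
      have a: "a \<in> S" and xsS: "xs \<in> lists S" and ysS: "ys \<in> lists S"
        using wsS ws by auto
      \<comment> \<open>For a root in front of \<open>unit_vec s\<close>, sortedness and
        \<open>Lf_nonpos\<close> bound \<open>Lf cs' s \<gamma>\<close> from both sides. Then
        \<open>sref s\<close> negates the coordinate at \<open>s\<close>, which must stay
        nonnegative and hence is zero.\<close>
      have fixed: "sref s \<gamma> = \<gamma>" if \<gamma>: "\<gamma> \<in> set (root_seq xs)" for \<gamma>
      proof -
        have \<gamma>': "\<gamma> \<in> set (root_seq ws)"
          using \<gamma> ws by simp
        then have P: "\<gamma> \<in> Phi" "nonneg \<gamma>"
          using set_root_seq less.prems N_Phi by blast+
        have "omega (s # cs') \<gamma> (unit_vec s) \<ge> 0"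
          using less.prems(5) \<gamma> unfolding ws(3) Cons by (simp add: sorted_wrt_append)
        then have L: "Lf cs' s \<gamma> = 0"
          using omega_initial(2) [OF s(2)] Lf_nonpos [OF d P(2)] by simp
        have K: "K s \<gamma> = 2 * \<gamma> s"
          using K_Lf [OF d sup [OF \<gamma>']] L by simp
        have "\<gamma> \<noteq> unit_vec s"
          using distinct_root_seq [OF less.prems(1)] \<gamma> unfolding ws(3) by auto
        then have "nonneg (sref s \<gamma>)"
          using sref_nonneg P s by blast
        then have "sref s \<gamma> s \<ge> 0"
          unfolding nonneg_def by blast
        moreover have "sref s \<gamma> s = - \<gamma> s"
          using K by (simp add: sref_def)
        moreover have "\<gamma> s \<ge> 0"
          using P unfolding nonneg_def by blast
        ultimately have "K s \<gamma> = 0"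
          using K by simp
        then show ?thesis
          by (simp add: sref_def)
      qed
      \<comment> \<open>Deleting the letter \<open>a\<close> gives a word for
        \<open>s \<otimes> wp ws\<close>, because conjugation by the prefix turns \<open>a\<close>
        into \<open>s\<close>. As the earlier roots are fixed by \<open>s\<close>, the remaining
        roots of \<open>ws\<close> are exactly the \<open>sref s\<close> images of the roots of
        \<open>ws'\<close>.\<close>
      define ws' where "ws' = xs @ ys"
      have x: "rho (wp xs) (unit_vec a) = unit_vec s"
        using rho_wp [OF xsS] ws(2) by simp
      have xc: "wp xs \<in> carrier G" and yc: "wp ys \<in> carrier G"
        using xsS ysS by auto
      have sx: "s \<otimes> wp xs = wp xs \<otimes> a"
        by (rule conj_of_rho_unit [OF xc s(1) a x])
      have w': "ws' \<in> lists S"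
        using xsS ysS by (auto simp: ws'_def)
      then have w'c: "wp ws' \<in> carrier G"
        by (rule wp_closed)
      have "wp ws = wp xs \<otimes> (a \<otimes> wp ys)"
        using wp_append [OF xsS, of "a # ys"] a ysS ws by simp
      also have "\<dots> = s \<otimes> wp ws'"
        using wp_append [OF xsS ysS] sx xc yc a s by (simp add: ws'_def m_assoc [symmetric])
      finally have e: "wp ws = s \<otimes> wp ws'" .
      then have e': "s \<otimes> wp ws = wp ws'"
        using s w'c by simp
      have "Suc (length ws') = length ws"
        using ws by (simp add: ws'_def)
      then have reduced': "reduced ws'"
        using N_descend(3) [OF w s(1) True] e' w' less.prems(1) by (simp add: reduced_def)
      have shift: "act (xs @ [a]) \<eta> = sref s (act xs \<eta>)" for \<eta>
      proof -
        have "act (xs @ [a]) \<eta> = rho (wp xs \<otimes> a) \<eta>"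
          using rho_wp [of "xs @ [a]"] wp_append [OF xsS, of "[a]"] xsS a by simp
        also have "\<dots> = sref s (act xs \<eta>)"
          using rho_mult [of s "wp xs"] s xc rho_wp [OF xsS] by (simp flip: sx)
        finally show ?thesis .
      qed
      have m: "map (sref s) (root_seq ws') = root_seq xs @ map (act (xs @ [a])) (root_seq ys)"
        using fixed by (simp add: ws'_def root_seq_append map_idI shift)
      have "sorted_wrt (\<lambda>\<beta> \<gamma>. omega (s # cs') \<beta> \<gamma> \<ge> 0) (map (sref s) (root_seq ws'))"
        using less.prems(5) unfolding ws(3) m Cons by (simp add: sorted_wrt_append)
      then have o1: "sorted_wrt (\<lambda>\<beta> \<gamma>. omega (s # cs') (sref s \<beta>) (sref s \<gamma>) \<ge> 0) (root_seq ws')"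
        by (simp add: sorted_wrt_map)
      have sup': "supp (set (s # cs')) \<beta>" if "\<beta> \<in> set (root_seq ws')" for \<beta>
        using supp_mono [OF supp_root_seq [OF that]] less.prems(2) ws Cons by (auto simp: ws'_def)
      have "sorted_wrt (\<lambda>\<beta> \<gamma>. omega (cs' @ [s]) \<beta> \<gamma> \<ge> 0) (root_seq ws')"
        using o1 by (rule sorted_wrt_mono_rel [rotated]) (use omega_sref [OF d] sup' in auto)
      then have "sortable (cs' @ [s]) (wp ws')"
        using less.hyps [of "cs' @ [s]" ws'] reduced' less.prems ws Cons d
        by (auto simp: ws'_def)
      then show ?thesis
        using sortable_Cons_take [OF True w] e' Cons by simp
    next
      case False
      \<comment> \<open>The letters before a first \<open>s\<close> would all commute with
        \<open>s\<close>, so \<open>unit_vec s\<close> itself would be one of the roots.\<close>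
      have sws: "s \<notin> set ws"
      proof
        assume "s \<in> set ws"
        then obtain bs rest where bs: "ws = bs @ s # rest" "s \<notin> set bs"
          by (metis split_list_first)
        have rw: "root_seq ws = root_seq bs @ act bs (unit_vec s) # map (act (bs @ [s])) (root_seq rest)"
          unfolding bs(1) by (simp add: root_seq_append act_append comp_def)
        have "k b s = 0" if "b \<in> set bs" for b
        proof (rule omega_sorted_commuting [OF d])
          show "reduced bs"
            using less.prems(1) bs reduced_append by blast
          show "set bs \<subseteq> set cs'"
            using less.prems(2) bs Cons by auto
          show "omega (s # cs') \<gamma> (act bs (unit_vec s)) \<ge> 0" if "\<gamma> \<in> set (root_seq bs)" for \<gamma>
            using less.prems(5) that unfolding rw Cons by (simp add: sorted_wrt_append)
        qed (rule that)
        moreover have "set bs \<subseteq> S"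
          using wsS bs by auto
        ultimately have "act bs (unit_vec s) = unit_vec s"
          using act_unit_expand [OF s(1), of bs] by (simp add: fun_eq_iff)
        then have "unit_vec s \<in> set (root_seq ws)"
          unfolding rw by simp
        then show False
          using False set_root_seq less.prems by blast
      qed
      then have z: "\<beta> s = 0" if "\<beta> \<in> set (root_seq ws)" for \<beta>
        using supp_root_seq [OF that] by (simp add: supp_def)
      have "sorted_wrt (\<lambda>\<beta> \<gamma>. omega cs' \<beta> \<gamma> \<ge> 0) (root_seq ws)"
        using less.prems(5) unfolding Cons
        by (rule sorted_wrt_mono_rel [rotated]) (use z omega_Cons_supp in auto)
      then have "sortable cs' (wp ws)"
        using less.hyps [of cs' ws] less.prems Cons sws by auto
      then show ?thesis
        using sortable_skip False Cons by blast
    qed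
  qed
qed

text \<open>The purpose of the root criterion: a sublist of a sorted list is sorted, and the two
  forms agree on roots without a coordinate at \<open>s\<close>.\<close>

lemma sortable_restrict:
  assumes "sortable (s # cs) w" "distinct (s # cs)" "set (s # cs) \<subseteq> S"
  shows "\<exists>z. sortable cs z \<and> N z = {\<beta> \<in> N w. supp (set cs) \<beta>}"
proof -
  obtain ws where ws: "reduced ws" "set ws \<subseteq> set (s # cs)" "wp ws = w"
    "sorted_wrt (\<lambda>\<beta> \<gamma>. omega (s # cs) \<beta> \<gamma> \<ge> 0) (root_seq ws)"
    using sortable_imp_omega_sorted [OF assms] by blast
  obtain vs where vs: "reduced vs" "set vs \<subseteq> set cs" "root_seq vs = filter (supp (set cs)) (root_seq ws)"
    using parabolic_restrict [OF ws(1), of "set cs"] assms by auto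
  have z: "\<beta> s = 0" if "\<beta> \<in> set (root_seq vs)" for \<beta>
    using that assms vs(3) by (auto simp: supp_def)
  have "sorted_wrt (\<lambda>\<beta> \<gamma>. omega (s # cs) \<beta> \<gamma> \<ge> 0) (root_seq vs)"
    unfolding vs(3) using ws(4) by (rule sorted_wrt_filter)
  then have "sorted_wrt (\<lambda>\<beta> \<gamma>. omega cs \<beta> \<gamma> \<ge> 0) (root_seq vs)"
    by (rule sorted_wrt_mono_rel [rotated]) (use z omega_Cons_supp in auto)
  then have "sortable cs (wp vs)"
    using omega_sorted_imp_sortable vs assms by auto
  moreover have "N (wp vs) = {\<beta> \<in> N w. supp (set cs) \<beta>}"
    using set_root_seq [OF vs(1)] set_root_seq [OF ws(1)] vs(3) ws(3) by auto
  ultimately show ?thesis by blast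
qed

lemma sortable_word:
  assumes "sortable cs w" "distinct cs" "set cs \<subseteq> S"
  obtains ws where "reduced ws" "set ws \<subseteq> set cs" "wp ws = w" "ws \<in> lists S"
  using sortable_imp_omega_sorted [OF assms] unfolding reduced_def by blast

subsection \<open>Skips and cover reflections\<close>

inductive_set cone :: "('a \<Rightarrow> real) set \<Rightarrow> ('a \<Rightarrow> real) set" for A where
  cone_zero: "(\<lambda>r. 0) \<in> cone A"
| cone_add: "a \<ge> 0 \<Longrightarrow> \<beta> \<in> A \<Longrightarrow> \<zeta> \<in> cone A \<Longrightarrow> (\<lambda>r. a * \<beta> r + \<zeta> r) \<in> cone A"

lemma cone_mono: "\<zeta> \<in> cone A \<Longrightarrow> A \<subseteq> B \<Longrightarrow> \<zeta> \<in> cone B"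
  by (induction rule: cone.induct) (auto intro: cone.intros)

lemma cone_nonneg: "\<zeta> \<in> cone A \<Longrightarrow> (\<And>\<beta>. \<beta> \<in> A \<Longrightarrow> nonneg \<beta>) \<Longrightarrow> nonneg \<zeta>"
  by (induction rule: cone.induct) (auto simp: nonneg_def)

lemma cone_sref: "\<zeta> \<in> cone A \<Longrightarrow> sref s \<zeta> \<in> cone (sref s ` A)"
proof (induction rule: cone.induct)
  case cone_zero
  have "sref s (\<lambda>r. 0) = (\<lambda>r. 0)"
    using act_zero [of "[s]"] by simp
  then show ?case by (simp add: cone.cone_zero)
next
  case (cone_add a \<beta> \<zeta>)
  have "sref s (\<lambda>r. a * \<beta> r + \<zeta> r) = (\<lambda>r. a * sref s \<beta> r + sref s \<zeta> r)"
    using sref_lin [of s a \<beta> 1 \<zeta>] by simp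
  then show ?case
    using cone_add by (auto intro: cone.cone_add)
qed

lemma act_unit_cone:
  assumes "s \<in> S" "s \<notin> set ws" "set ws \<subseteq> S"
  shows "(\<lambda>r. act ws (unit_vec s) r - unit_vec s r) \<in> cone (set (root_seq ws))"
  using assms(2,3)
proof (induction ws rule: rev_induct)
  case Nil
  then show ?case by (simp add: cone_zero)
next
  case (snoc b ws)
  then have b: "b \<in> S" "b \<noteq> s" by auto
  have "act (ws @ [b]) (unit_vec s) = act ws (\<lambda>r. 1 * unit_vec s r + (- k b s) * unit_vec b r)"
    using assms(1) by (simp add: act_append sref_def K_unit)
  also have "\<dots> = (\<lambda>r. act ws (unit_vec s) r + - k b s * act ws (unit_vec b) r)"
    by (subst act_lin) simp
  finally have e: "(\<lambda>r. act (ws @ [b]) (unit_vec s) r - unit_vec s r)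
      = (\<lambda>r. - k b s * act ws (unit_vec b) r + (act ws (unit_vec s) r - unit_vec s r))"
    by (simp add: fun_eq_iff)
  show ?case
    unfolding e
  proof (rule cone_add)
    show "0 \<le> - k b s"
      using k_nonpos [OF b(1) assms(1) b(2)] by simp
    show "(\<lambda>r. act ws (unit_vec s) r - unit_vec s r) \<in> cone (set (root_seq (ws @ [b])))"
      using snoc by (intro cone_mono [OF snoc.IH]) (auto simp: root_seq_append)
  qed (simp add: root_seq_append)
qed

text \<open>
  \<open>skips cs w L\<close>: the roots at which the sorting word of \<open>w\<close> first skips each letter of \<open>cs\<close>,
  in the order of the skipped positions. They form an exceptional sequence for the Euler form, and
  the negative ones among them are the cover reflections of \<open>w\<close>.
\<close>

inductive skips :: "'a list \<Rightarrow> 'a \<Rightarrow> ('a \<Rightarrow> real) list \<Rightarrow> bool" where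
  skips_Nil: "skips [] \<one> []"
| skips_skip: "unit_vec s \<notin> N w \<Longrightarrow> sortable cs w \<Longrightarrow> skips cs w L \<Longrightarrow> skips (s # cs) w (unit_vec s # L)"
| skips_take: "unit_vec s \<in> N w \<Longrightarrow> w \<in> carrier G \<Longrightarrow> sortable (cs @ [s]) (s \<otimes> w) \<Longrightarrow>
    skips (cs @ [s]) (s \<otimes> w) L \<Longrightarrow> skips (s # cs) w (map (sref s) L)"

lemma skips_exists: "sortable cs w \<Longrightarrow> \<exists>L. skips cs w L"
  by (induction rule: sortable.induct) (auto intro: skips.intros)

lemma skips_roots:
  assumes "skips cs w L" "set cs \<subseteq> S"
  shows "\<beta> \<in> set L \<Longrightarrow> \<beta> \<in> Phi \<and> supp (set cs) \<beta>"
  using assms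
proof (induction arbitrary: \<beta> rule: skips.induct)
  case (skips_skip s w cs L)
  then have "\<beta> = unit_vec s \<or> \<beta> \<in> Phi \<and> supp (set cs) \<beta>"
    by auto
  then show ?case
    using skips_skip.prems supp_mono [of "set cs" \<beta> "set (s # cs)"] by auto
next
  case (skips_take s w cs L)
  then obtain \<gamma> where \<gamma>: "\<gamma> \<in> set L" "\<beta> = sref s \<gamma>"
    by auto
  then have "\<gamma> \<in> Phi" "supp (set (s # cs)) \<gamma>"
    using skips_take.IH [of \<gamma>] skips_take.prems by auto
  then show ?case
    using \<gamma> skips_take.prems sref_Phi supp_sref [of "set (s # cs)" \<gamma> s] by auto
qed simp

text \<open>A skip puts \<open>unit_vec s\<close> in front, against which the form reads the
  coordinate at \<open>s\<close>; the later entries have none. A take is carried along by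
  \<open>E_sref\<close>.\<close>

lemma skips_exceptional:
  assumes "skips cs w L" "distinct cs" "set cs \<subseteq> S"
  shows "sorted_wrt (\<lambda>\<beta> \<gamma>. E cs \<beta> \<gamma> = 0) L"
  using assms
proof (induction rule: skips.induct)
  case (skips_skip s w cs L)
  have z: "\<beta> s = 0" if "\<beta> \<in> set L" for \<beta>
    using skips_roots [OF skips_skip.hyps(3) _ that] skips_skip.prems by (auto simp: supp_def)
  have "sorted_wrt (\<lambda>\<beta> \<gamma>. E cs \<beta> \<gamma> = 0) L"
    using skips_skip by simp
  then have "sorted_wrt (\<lambda>\<beta> \<gamma>. E (s # cs) \<beta> \<gamma> = 0) L"
  proof (rule sorted_wrt_mono_rel [rotated])
    fix \<beta> \<gamma>
    assume "\<gamma> \<in> set L" "E cs \<beta> \<gamma> = 0"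
    then show "E (s # cs) \<beta> \<gamma> = 0"
      using z [of \<gamma>] by simp
  qed
  moreover have "E (s # cs) (unit_vec s) \<beta> = 0" if "\<beta> \<in> set L" for \<beta>
    using E_initial(1) [of s cs \<beta>] z [OF that] skips_skip.prems by simp
  ultimately show ?case by simp
next
  case (skips_take s w cs L)
  have d: "distinct (s # cs)" "set (s # cs) \<subseteq> S"
    using skips_take.prems by auto
  have sup: "supp (set (s # cs)) \<beta>" if "\<beta> \<in> set L" for \<beta>
    using skips_roots [OF skips_take.hyps(4) _ that] d by auto
  have "sorted_wrt (\<lambda>\<beta> \<gamma>. E (cs @ [s]) \<beta> \<gamma> = 0) L"
    using skips_take by simp
  then have "sorted_wrt (\<lambda>\<beta> \<gamma>. E (s # cs) (sref s \<beta>) (sref s \<gamma>) = 0) L"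
    by (rule sorted_wrt_mono_rel [rotated]) (use E_sref [OF d] sup in auto)
  then show ?case
    by (simp add: sorted_wrt_map)
qed simp

lemma rho_unit_supp:
  assumes "sortable cs w" "distinct cs" "set cs \<subseteq> S" "r \<in> set cs"
  shows "supp (set cs) (rho w (unit_vec r))"
proof -
  obtain ws where ws: "set ws \<subseteq> set cs" "wp ws = w" "ws \<in> lists S"
    using sortable_word assms by metis
  then show ?thesis
    using supp_act [of "set cs" "unit_vec r" ws] rho_wp [OF ws(3)] assms by simp
qed

text \<open>Prepares \<open>skips_final\<close>, where \<open>\<zeta>\<close> is forced to vanish.
  The orthogonality arises when \<open>r\<close> is skipped, from a computation of lengths; further
  skips do not change the form on these vectors, and takes preserve it by
  \<open>E_sref\<close>.\<close>

lemma skips_decomp: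
  assumes "skips cs w L" "sortable cs w" "distinct cs" "set cs \<subseteq> S" "r \<in> set cs"
  shows "\<exists>\<gamma>\<in>set L. \<exists>\<zeta>\<in>cone (N w). rho w (unit_vec r) = (\<lambda>x. \<gamma> x + \<zeta> x)
           \<and> supp (set cs) \<zeta> \<and> E cs \<zeta> (rho w (unit_vec r)) = 0"
  using assms
proof (induction arbitrary: r rule: skips.induct)
  case (skips_skip s w cs L)
  have d: "distinct (s # cs)" "set (s # cs) \<subseteq> S" and s: "s \<in> S" "s \<notin> set cs"
    using skips_skip.prems by auto
  show ?case
  proof (cases "r = s")
    case True
    obtain ws where ws: "reduced ws" "set ws \<subseteq> set cs" "wp ws = w" "ws \<in> lists S"
      using sortable_word [OF skips_skip.hyps(2)] d by auto
    define \<beta> where "\<beta> = rho w (unit_vec s)"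
    have \<beta>: "\<beta> = act ws (unit_vec s)"
      using rho_wp [OF ws(4)] ws(3) by (simp add: \<beta>_def)
    define \<zeta> where "\<zeta> = (\<lambda>x. \<beta> x - unit_vec s x)"
    have "\<zeta> \<in> cone (set (root_seq ws))"
      unfolding \<zeta>_def \<beta> using s ws by (intro act_unit_cone) auto
    then have c: "\<zeta> \<in> cone (N w)"
      using set_root_seq [OF ws(1)] ws(3) by simp
    have b: "\<beta> = (\<lambda>x. unit_vec s x + \<zeta> x)"
      by (simp add: \<zeta>_def)
    have "\<beta> s = 1"
      unfolding \<beta> using s ws by (subst act_outside) auto
    then have zs: "\<zeta> s = 0"
      by (simp add: \<zeta>_def)
    have "supp (set (s # cs)) \<beta>"
      unfolding \<beta> using ws by (intro supp_act) auto
    then have sup: "supp (set (s # cs)) \<zeta>"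
      by (auto simp: \<zeta>_def supp_def)
    then have sup': "supp (set cs) \<zeta>"
      using zs by (auto simp: supp_def)
    have P: "\<beta> \<in> Phi"
      using s ws by (auto simp: \<beta>_def intro: rho_Phi)
    \<comment> \<open>\<open>\<beta>\<close> and \<open>unit_vec s\<close> both have square length
      2. Expanding \<open>\<beta>\<close> as \<open>unit_vec s\<close> plus \<open>\<zeta>\<close>
      leaves \<open>Lf cs s \<zeta> + E cs \<zeta> \<zeta> = 0\<close>, and this sum is the Euler
      form of \<open>\<zeta>\<close> against \<open>\<beta>\<close>.\<close>
    have "bil \<beta> \<beta> = bil (\<lambda>x. 1 * unit_vec s x + 1 * \<zeta> x) (\<lambda>x. 1 * unit_vec s x + 1 * \<zeta> x)"
      using b by simp
    also have "\<dots> = K s (unit_vec s) + 2 * K s \<zeta> + bil \<zeta> \<zeta>"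
      unfolding bil_lin_left bil_lin_right bil_sym [of \<zeta> "unit_vec s"] using s by (simp add: bil_unit)
    also have "K s \<zeta> = Lf cs s \<zeta>"
      using K_Lf [OF d sup] zs by simp
    also have "bil \<zeta> \<zeta> = 2 * E cs \<zeta> \<zeta>"
      using E_sym [of cs \<zeta> \<zeta>] sup' d by simp
    finally have "Lf cs s \<zeta> + E cs \<zeta> \<zeta> = 0"
      using Phi_norm [OF P] K_unit [OF s(1)] s by simp
    moreover have "E (s # cs) \<zeta> \<beta> = Lf cs s \<zeta> + E cs \<zeta> \<zeta>"
    proof -
      have "E cs \<zeta> \<beta> = E cs \<zeta> \<zeta>"
        using s by (intro E_cong) (auto simp: b)
      then show ?thesis
        using zs \<open>\<beta> s = 1\<close> by simp
    qed
    ultimately show ?thesis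
      using c b sup True unfolding \<beta>_def by (intro bexI [of _ "unit_vec s"] bexI [of _ \<zeta>]) auto
  next
    case False
    then have r: "r \<in> set cs"
      using skips_skip.prems by simp
    have "distinct cs" "set cs \<subseteq> S"
      using d by auto
    from skips_skip.IH [OF skips_skip.hyps(2) this r]
    obtain \<gamma> \<zeta> where *: "\<gamma> \<in> set L" "\<zeta> \<in> cone (N w)" "rho w (unit_vec r) = (\<lambda>x. \<gamma> x + \<zeta> x)"
      "supp (set cs) \<zeta>" "E cs \<zeta> (rho w (unit_vec r)) = 0"
      by blast
    have "supp (set cs) (rho w (unit_vec r))"
      using rho_unit_supp skips_skip.hyps(2) d r by simp
    then have "rho w (unit_vec r) s = 0"
      using s by (auto simp: supp_def)
    then have "E (s # cs) \<zeta> (rho w (unit_vec r)) = 0"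
      using * by simp
    moreover have "supp (set (s # cs)) \<zeta>"
      using supp_mono [OF *(4)] by auto
    ultimately show ?thesis
      using * by (intro bexI [of _ \<gamma>] bexI [of _ \<zeta>]) auto
  qed
next
  case (skips_take s w cs L)
  have d: "distinct (s # cs)" "set (s # cs) \<subseteq> S" and s: "s \<in> S"
    using skips_take.prems by auto
  obtain \<gamma> \<zeta> where *: "\<gamma> \<in> set L" "\<zeta> \<in> cone (N (s \<otimes> w))"
    "rho (s \<otimes> w) (unit_vec r) = (\<lambda>x. \<gamma> x + \<zeta> x)"
    "supp (set (cs @ [s])) \<zeta>" "E (cs @ [s]) \<zeta> (rho (s \<otimes> w) (unit_vec r)) = 0"
    using skips_take.IH [of r] skips_take.hyps skips_take.prems d by auto
  have e: "rho w (unit_vec r) = sref s (rho (s \<otimes> w) (unit_vec r))"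
    using s skips_take.hyps by (simp add: rho_mult)
  have "rho w (unit_vec r) = (\<lambda>x. sref s \<gamma> x + sref s \<zeta> x)"
    unfolding e *(3) using sref_lin [of s 1 \<gamma> 1 \<zeta>] by simp
  moreover have "sref s \<zeta> \<in> cone (N w)"
    using cone_mono [OF cone_sref [OF *(2)]] N_descend(1) [OF skips_take.hyps(2) s skips_take.hyps(1)]
    by blast
  moreover have sup: "supp (set (s # cs)) \<zeta>"
    using *(4) by simp
  moreover have "supp (set (s # cs)) (rho (s \<otimes> w) (unit_vec r))"
    using rho_unit_supp [OF skips_take.hyps(3), of r] skips_take.prems by auto
  then have "E (s # cs) (sref s \<zeta>) (rho w (unit_vec r)) = 0"
    unfolding e using E_sref [OF d sup] *(5) by simp
  moreover have "supp (set (s # cs)) (sref s \<zeta>)"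
    using sup by (intro supp_sref) auto
  ultimately show ?case
    using *(1) by (intro bexI [of _ "sref s \<gamma>"] bexI [of _ "sref s \<zeta>"]) auto
qed simp

text \<open>
  For final \<open>s\<close> the form \<open>E(-, \<alpha>\<^sub>s)\<close> reads off the coefficient of \<open>\<alpha>\<^sub>s\<close>, so in the decomposition
  \<open>\<alpha>\<^sub>s = \<gamma> + \<zeta>\<close> the positive root \<open>\<gamma>\<close> forces \<open>\<zeta> = 0\<close>.
\<close>

lemma skips_final:
  assumes "skips (cs @ [s]) w L" "sortable (cs @ [s]) w" "distinct (cs @ [s])" "set (cs @ [s]) \<subseteq> S"
    "r \<in> set (cs @ [s])" "rho w (unit_vec r) = unit_vec s"
  shows "unit_vec s \<in> set L"
proof -
  obtain \<gamma> \<zeta> where *: "\<gamma> \<in> set L" "\<zeta> \<in> cone (N w)"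
    "unit_vec s = (\<lambda>x. \<gamma> x + \<zeta> x)" "E (cs @ [s]) \<zeta> (unit_vec s) = 0"
    using skips_decomp [OF assms(1-5)] unfolding assms(6) by blast
  have s: "s \<notin> set cs" using assms(3) by auto
  have "\<And>q. q \<in> set cs \<Longrightarrow> unit_vec s q = 0"
    using s by auto
  then have "E (cs @ [s]) \<zeta> (unit_vec s) = \<zeta> s"
    using E_snoc [OF assms(4), of \<zeta> "unit_vec s"] by (simp add: E_zero Lf_zero)
  then have zs: "\<zeta> s = 0"
    using *(4) by simp
  have zn: "nonneg \<zeta>"
    using cone_nonneg [OF *(2)] N_Phi by blast
  have g: "\<gamma> x = unit_vec s x - \<zeta> x" for x
    using fun_cong [OF *(3), of x] by simp
  then have "\<gamma> s = 1"
    using zs by simp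
  moreover have "\<gamma> \<in> Phi"
    using skips_roots assms *(1) by blast
  ultimately have "nonneg \<gamma>"
    using Phi_signed unfolding nonpos_def by (metis not_one_le_zero)
  have "\<zeta> x = 0" for x
  proof (cases "x = s")
    case False
    then have "\<gamma> x = - \<zeta> x"
      using g by simp
    then show ?thesis
      using zn \<open>nonneg \<gamma>\<close> unfolding nonneg_def by (metis antisym neg_0_le_iff_le)
  qed (use zs in simp)
  then have "\<gamma> = unit_vec s"
    using g by auto
  then show ?thesis
    using *(1) by simp
qed

text \<open>When \<open>s\<close> is taken, a negative wall of \<open>w\<close> either comes from a
  negative wall of \<open>s \<otimes> w\<close>, or from \<open>unit_vec s\<close> flipped by
  \<open>s\<close>. In the second case \<open>s\<close> is final in the rotated list and
  \<open>skips_final\<close> applies. When \<open>s\<close> is skipped, its own wall has coefficient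
  1 at \<open>s\<close> and is not negative.\<close>

lemma skips_lower_wall:
  assumes "skips cs w L" "sortable cs w" "distinct cs" "set cs \<subseteq> S" "r \<in> set cs"
    "nonpos (rho w (unit_vec r))"
  shows "rho w (unit_vec r) \<in> set L"
  using assms
proof (induction arbitrary: r rule: skips.induct)
  case (skips_skip s w cs L)
  have "r \<noteq> s"
  proof
    assume "r = s"
    obtain ws where ws: "set ws \<subseteq> set cs" "wp ws = w" "ws \<in> lists S"
      using sortable_word [OF skips_skip.hyps(2)] skips_skip.prems by auto
    have "rho w (unit_vec s) s = act ws (unit_vec s) s"
      using rho_wp [OF ws(3)] ws(2) by simp
    also have "\<dots> = 1"
      using ws skips_skip.prems by (subst act_outside) auto
    finally show False
      using skips_skip.prems(5) \<open>r = s\<close> unfolding nonpos_def by (metis not_one_le_zero)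
  qed
  then show ?case
    using skips_skip by auto
next
  case (skips_take s w cs L)
  have d: "distinct (cs @ [s])" "set (cs @ [s]) \<subseteq> S" and s: "s \<in> S" and r: "r \<in> set (cs @ [s])" "r \<in> S"
    using skips_take.prems by auto
  have e: "rho w (unit_vec r) = sref s (rho (s \<otimes> w) (unit_vec r))"
    using s skips_take.hyps by (simp add: rho_mult)
  have P: "rho (s \<otimes> w) (unit_vec r) \<in> Phi"
    using s r skips_take.hyps by (intro rho_Phi) auto
  have "rho (s \<otimes> w) (unit_vec r) \<in> set L"
  proof (cases "nonpos (rho (s \<otimes> w) (unit_vec r))")
    case True
    then show ?thesis
      using skips_take.IH skips_take.hyps d r by blast
  next
    case False
    then have n: "nonneg (rho (s \<otimes> w) (unit_vec r))"
      using P Phi_signed by blast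
    have "rho (s \<otimes> w) (unit_vec r) = unit_vec s"
    proof (rule ccontr)
      assume "\<not> ?thesis"
      then have "nonneg (rho w (unit_vec r))"
        unfolding e using sref_nonneg P n s by blast
      moreover have "rho w (unit_vec r) \<in> Phi"
        unfolding e using P s by (rule sref_Phi [rotated])
      ultimately show False
        using skips_take.prems(5) Phi_not_both by blast
    qed
    then show ?thesis
      using skips_final [OF skips_take.hyps(4,3) d r(1)] by simp
  qed
  then show ?case
    unfolding e by simp
qed simp

text \<open>Both walls are skip roots, so the Euler form vanishes on them in one of the two orders.
  With \<open>unit_vec s\<close> on the left it equals \<open>\<beta> s\<close> outright. In the
  other order \<open>\<beta> s\<close> equals \<open>bil (unit_vec s) \<beta>\<close>, which is
  \<open>k r r'\<close> because \<open>w\<close> preserves \<open>bil\<close>; being nonpositive, it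
  must vanish.\<close>

theorem initial_cover_reflection:
  assumes "sortable (s # cs) w" "distinct (s # cs)" "set (s # cs) \<subseteq> S"
    and r: "r \<in> set (s # cs)" "rho w (unit_vec r) = (\<lambda>x. - unit_vec s x)"
    and r': "r' \<in> set (s # cs)" "r' \<noteq> r" "rho w (unit_vec r') = (\<lambda>x. - \<beta> x)" "nonneg \<beta>"
  shows "\<beta> s = 0"
proof -
  obtain L where L: "skips (s # cs) w L"
    using skips_exists assms(1) by blast
  have w: "w \<in> carrier G" using sortable_closed assms(1) .
  have s: "s \<in> S" "s \<notin> set cs" "r \<in> S" "r' \<in> S" using assms by auto
  have "nonpos (rho w (unit_vec r))" "nonpos (rho w (unit_vec r'))"
    unfolding r(2) r'(3) using r'(4) by simp_all
  then have "rho w (unit_vec r) \<in> set L" "rho w (unit_vec r') \<in> set L"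
    using skips_lower_wall [OF L assms(1-3)] r(1) r'(1) by blast+
  then obtain i j where ij: "i < length L" "L ! i = rho w (unit_vec r)"
    "j < length L" "L ! j = rho w (unit_vec r')"
    by (metis in_set_conv_nth)
  have "rho w (unit_vec r) \<noteq> rho w (unit_vec r')"
  proof
    assume "rho w (unit_vec r) = rho w (unit_vec r')"
    then have "unit_vec r = unit_vec r'"
      using rho_inv(1) [OF w] by metis
    from fun_cong [OF this, of r] show False
      using r'(2) by (simp split: if_splits)
  qed
  then have "i \<noteq> j"
    using ij by auto
  have srted: "sorted_wrt (\<lambda>\<beta> \<gamma>. E (s # cs) \<beta> \<gamma> = 0) L"
    using skips_exceptional [OF L assms(2,3)] .
  have Es: "E (s # cs) (unit_vec s) \<beta> = \<beta> s"
    using E_initial(1) [OF s(2)] .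
  show ?thesis
  proof (cases "i < j")
    case True
    then have "E (s # cs) (L ! i) (L ! j) = 0"
      using sorted_wrt_nth_less [OF srted True] ij by simp
    then show ?thesis
      using Es unfolding ij r(2) r'(3) by (simp only: E_uminus minus_minus)
  next
    case False
    then have "E (s # cs) (L ! j) (L ! i) = 0"
      using sorted_wrt_nth_less [OF srted, of j i] ij \<open>i \<noteq> j\<close> by simp
    then have "E (s # cs) \<beta> (unit_vec s) = 0"
      unfolding ij r(2) r'(3) by (simp only: E_uminus minus_minus)
    moreover have "supp (set (s # cs)) (rho w (unit_vec r'))"
      using rho_unit_supp [OF assms(1-3) r'(1)] .
    then have "supp (set (s # cs)) \<beta>"
      unfolding r'(3) supp_def by simp
    ultimately have "\<beta> s = bil (unit_vec s) \<beta>"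
      using E_sym [OF assms(2,3), of "unit_vec s" \<beta>] Es by simp
    also have "\<dots> = bil (rho w (unit_vec r)) (rho w (unit_vec r'))"
      using bil_scale(1) [of "-1" "unit_vec s" "\<lambda>x. - \<beta> x"] bil_scale(2) [of "unit_vec s" "-1" \<beta>]
      unfolding r(2) r'(3) by simp
    also have "\<dots> = k r r'"
      using s by (simp add: bil_rho [OF w] bil_unit K_unit)
    also have "\<dots> \<le> 0"
      using s r'(2) by (intro k_nonpos) auto
    finally show ?thesis
      using r'(4) unfolding nonneg_def by (intro antisym) auto
  qed
qed

subsection \<open>The least sortable element with a given inversion\<close>

lemma N_supp:
  assumes "sortable cs w" "distinct cs" "set cs \<subseteq> S" "\<beta> \<in> N w"
  shows "supp (set cs) \<beta>"
proof -
  obtain ws where ws: "reduced ws" "set ws \<subseteq> set cs" "wp ws = w"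
    using sortable_word assms by metis
  then have "\<beta> \<in> set (root_seq ws)"
    using set_root_seq assms by blast
  then show ?thesis
    using supp_root_seq supp_mono ws by blast
qed

lemma descent_letter:
  assumes "sortable cs w" "distinct cs" "set cs \<subseteq> S" "nonpos (rho w (unit_vec r))"
  shows "r \<in> set cs"
proof (rule ccontr)
  assume r: "r \<notin> set cs"
  obtain ws where ws: "set ws \<subseteq> set cs" "wp ws = w" "ws \<in> lists S"
    using sortable_word assms by metis
  have "rho w (unit_vec r) r = act ws (unit_vec r) r"
    using rho_wp [OF ws(3)] ws(2) by simp
  also have "\<dots> = 1"
    using ws r by (subst act_outside) auto
  finally show False
    using assms(4) unfolding nonpos_def by (metis not_one_le_zero)
qed

text \<open>The induction carries the single descent \<open>r\<close> along with leastness; its wall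
  \<open>- \<tau>\<close> later gives both join-irreducibility and the cover reflection. Dropping
  the initial letter lowers the rank without raising the length; taking it rotates \<open>cs\<close>
  and lowers the length.\<close>

theorem sortable_least_with_inversion:
  assumes "sortable cs w" "distinct cs" "set cs \<subseteq> S" "\<tau> \<in> N w"
  shows "\<exists>j r. sortable cs j \<and> \<tau> \<in> N j \<and> (\<forall>w'. sortable cs w' \<longrightarrow> \<tau> \<in> N w' \<longrightarrow> N j \<subseteq> N w')
           \<and> r \<in> S \<and> rho j (unit_vec r) = (\<lambda>x. - \<tau> x)
           \<and> (\<forall>r'\<in>S. nonpos (rho j (unit_vec r')) \<longrightarrow> r' = r)"
  using assms
proof (induction "length cs + len w" arbitrary: cs w \<tau> rule: less_induct)
  case less
  have w: "w \<in> carrier G"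
    using sortable_closed less.prems by blast
  have \<tau>: "\<tau> \<in> Phi" "nonneg \<tau>"
    using N_Phi less.prems(4) by auto
  show ?case
  proof (cases cs)
    case Nil
    then show ?thesis
      using less.prems by (simp add: sortable_Nil_iff)
  next
    case (Cons s cs')
    have d: "distinct (s # cs')" "set (s # cs') \<subseteq> S" "distinct cs'" "set cs' \<subseteq> S"
      "distinct (cs' @ [s])" "set (cs' @ [s]) \<subseteq> S"
      using less.prems Cons by auto
    then have s: "s \<in> S" "s \<notin> set cs'"
      by auto
    have sw: "sortable (s # cs') w"
      using less.prems Cons by simp
    consider (simple) "\<tau> = unit_vec s" | (para) "\<tau> \<noteq> unit_vec s" "\<tau> s = 0"
      | (other) "\<tau> \<noteq> unit_vec s" "\<tau> s \<noteq> 0"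
      by blast
    then show ?thesis
    proof cases
      case simple
      have Ns: "N s = {unit_vec s}"
        using N_S_mult [of \<one> s] s by simp
      have "sortable (s # cs') s"
        using sortable_Cons_take [of s s cs'] Ns s sortable_one by simp
      moreover have "r' = s" if "r' \<in> S" "nonpos (rho s (unit_vec r'))" for r'
      proof (rule ccontr)
        assume "r' \<noteq> s"
        then have "sref s (unit_vec r') r' = 1"
          by (simp add: sref_other)
        then show False
          using that(2) s unfolding nonpos_def by (metis not_one_le_zero rho_S)
      qed
      moreover have "rho s (unit_vec s) = (\<lambda>x. - unit_vec s x)"
        using s by (simp add: sref_unit)
      ultimately show ?thesis
        using s Ns simple Cons by (intro exI [of _ s]) auto
    next
      case para
      have sup: "supp (set cs') \<tau>"
        using N_supp [OF less.prems] para Cons by (auto simp: supp_def)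
      obtain z where z: "sortable cs' z" "N z = {\<beta> \<in> N w. supp (set cs') \<beta>}"
        using sortable_restrict [OF sw d(1,2)] by blast
      have "len z \<le> len w"
        using N_mono_len [of z w] z w sortable_closed by auto
      then have "length cs' + len z < length cs + len w"
        using Cons by simp
      from less.hyps [OF this z(1) d(3,4), of \<tau>] obtain j r where
        j: "sortable cs' j" "\<tau> \<in> N j" "\<And>w'. sortable cs' w' \<Longrightarrow> \<tau> \<in> N w' \<Longrightarrow> N j \<subseteq> N w'"
        "r \<in> S" "rho j (unit_vec r) = (\<lambda>x. - \<tau> x)"
        "\<forall>r'\<in>S. nonpos (rho j (unit_vec r')) \<longrightarrow> r' = r"
        using z(2) less.prems(4) sup by auto
      have "unit_vec s \<notin> N j"
        using N_supp [OF j(1) d(3,4), of "unit_vec s"] s by auto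
      then have "sortable cs j"
        using j(1) Cons sortable_skip by simp
      moreover have "N j \<subseteq> N w'" if "sortable cs w'" "\<tau> \<in> N w'" for w'
      proof -
        obtain z' where z': "sortable cs' z'" "N z' = {\<beta> \<in> N w'. supp (set cs') \<beta>}"
          using sortable_restrict [OF _ d(1,2)] \<open>sortable cs w'\<close> Cons by blast
        then show ?thesis
          using j(3) [OF z'(1)] that(2) sup by auto
      qed
      ultimately show ?thesis
        using j by blast
    next
      case other
      have take: "unit_vec s \<in> N w' \<and> sortable (cs' @ [s]) (s \<otimes> w') \<and> sref s \<tau> \<in> N (s \<otimes> w')"
        if w': "sortable cs w'" "\<tau> \<in> N w'" for w'
      proof -
        have c: "w' \<in> carrier G"
          using w' sortable_closed by blast
        have u: "unit_vec s \<in> N w'"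
        proof (rule ccontr)
          assume "unit_vec s \<notin> N w'"
          then have "sortable cs' w'"
            using w'(1) Cons sortable_Cons_skip by simp
          then have "supp (set cs') \<tau>"
            using N_supp d w'(2) by blast
          then show False
            using other s unfolding supp_def by blast
        qed
        then show ?thesis
          using w' Cons sortable_Cons_take [OF u c] sref_in_N [OF c s(1) w'(2) other(1)] by simp
      qed
      note tw = take [OF less.prems(1,4)]
      have "len w = Suc (len (s \<otimes> w))"
        using N_descend(3) [OF w s(1)] tw by blast
      then have "length (cs' @ [s]) + len (s \<otimes> w) < length cs + len w"
        using Cons by simp
      from less.hyps [OF this _ d(5,6), of "sref s \<tau>"] tw obtain i r where
        i: "sortable (cs' @ [s]) i" "sref s \<tau> \<in> N i"
        "\<And>w'. sortable (cs' @ [s]) w' \<Longrightarrow> sref s \<tau> \<in> N w' \<Longrightarrow> N i \<subseteq> N w'"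
        "r \<in> S" "rho i (unit_vec r) = (\<lambda>x. - sref s \<tau> x)"
        "\<And>r'. r' \<in> S \<Longrightarrow> nonpos (rho i (unit_vec r')) \<Longrightarrow> r' = r"
        by blast
      have ic: "i \<in> carrier G"
        using i sortable_closed by blast
      \<comment> \<open>Leastness of \<open>i\<close>, compared with \<open>s \<otimes> w\<close>,
        keeps \<open>unit_vec s\<close> out of \<open>N i\<close>. So \<open>s \<otimes> i\<close>
        is longer than \<open>i\<close> and \<open>N_S_mult\<close> computes its inversions.\<close>
      have "unit_vec s \<notin> N (s \<otimes> w)"
        using N_descend(2) [OF w s(1)] tw by blast
      moreover have "N i \<subseteq> N (s \<otimes> w)"
        using i(3) tw by blast
      ultimately have si: "unit_vec s \<notin> N i"
        by blast
      define j where "j = s \<otimes> i"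
      have jc: "j \<in> carrier G" and sj: "s \<otimes> j = i"
        using ic s by (simp_all add: j_def)
      have Nj: "N j = insert (unit_vec s) (sref s ` N i)"
        unfolding j_def by (rule N_S_mult [OF ic s(1) si])
      have uj: "unit_vec s \<in> N j"
        using Nj by simp
      have srtj: "sortable (s # cs') j"
        using sortable_Cons_take [OF uj jc] sj i(1) by simp
      have \<tau>j: "\<tau> \<in> N j"
        using Nj i(2) s by (metis image_eqI insertCI sref_sref)
      have min: "N j \<subseteq> N w'" if w': "sortable cs w'" "\<tau> \<in> N w'" for w'
      proof -
        have c: "w' \<in> carrier G"
          using w' sortable_closed by blast
        have "N i \<subseteq> N (s \<otimes> w')"
          using i(3) take [OF w'] by blast
        then show ?thesis
          using Nj N_descend(1) [OF c s(1)] take [OF w'] by blast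
      qed
      have rj: "rho j (unit_vec q) = sref s (rho i (unit_vec q))" for q
        using ic s by (simp add: j_def rho_mult)
      have jr: "rho j (unit_vec r) = (\<lambda>x. - \<tau> x)"
        using act_uminus [of "[s]" "sref s \<tau>"] s unfolding rj i(5) by simp
      have "r' = r" if r': "r' \<in> S" "nonpos (rho j (unit_vec r'))" for r'
      proof (rule ccontr)
        assume ne: "r' \<noteq> r"
        have P: "rho i (unit_vec r') \<in> Phi"
          using ic r' by (simp add: rho_Phi)
        have n: "nonneg (rho i (unit_vec r'))"
          using i(6) r'(1) ne P Phi_signed by blast
        \<comment> \<open>An ascent of \<open>i\<close> that becomes a descent of \<open>j\<close>
          is the wall flipped by \<open>s\<close>. Then \<open>s\<close> is a cover reflection of
          \<open>j\<close>, and \<open>initial_cover_reflection\<close> forces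
          \<open>\<tau> s = 0\<close>.\<close>
        have e: "rho i (unit_vec r') = unit_vec s"
        proof (rule ccontr)
          assume "\<not> ?thesis"
          then have "nonneg (rho j (unit_vec r'))"
            unfolding rj using sref_nonneg P n s by blast
          then show False
            using r'(2) Phi_not_both sref_Phi P s rj by metis
        qed
        have "rho j (unit_vec r') = (\<lambda>x. - unit_vec s x)"
          unfolding rj e by (rule sref_unit [OF s(1)])
        moreover have "r \<in> set (s # cs')"
          using descent_letter [OF srtj d(1,2)] jr \<tau> by simp
        moreover have "r' \<in> set (s # cs')"
          using descent_letter [OF srtj d(1,2) r'(2)] .
        ultimately have "\<tau> s = 0"
          using initial_cover_reflection [OF srtj d(1,2), of r' r \<tau>] jr \<tau>(2) ne by blast
        then show False
          using other by blast
      qed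
      then show ?thesis
        using srtj \<tau>j min i(4) jr Cons by blast
    qed
  qed
qed

subsection \<open>Reflections and the weak order\<close>

text \<open>Since \<open>bil \<beta> \<beta> = 2\<close>, the displayed action is the orthogonal
  reflection in \<open>\<beta>\<close>. The existence and injectivity lemmas below make this
  relation a bijection between reflections and positive roots.\<close>

definition root_of :: "'a \<Rightarrow> ('a \<Rightarrow> real) \<Rightarrow> bool" where
  "root_of t \<beta> \<longleftrightarrow> t \<in> carrier G \<and> t \<in> reflections G S \<and> \<beta> \<in> Phi \<and> nonneg \<beta> \<and>
     (\<forall>x. rho t x = (\<lambda>r. x r - bil \<beta> x * \<beta> r))"

lemma root_of_conj:
  assumes "w \<in> carrier G" "s \<in> S" "nonneg (rho w (unit_vec s))"
  shows "root_of (w \<otimes> s \<otimes> inv w) (rho w (unit_vec s))"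
  unfolding root_of_def reflections_def
  using assms rho_Phi rho_reflection by auto

lemma root_of_conj_neg:
  assumes "w \<in> carrier G" "s \<in> S" "nonpos (rho w (unit_vec s))"
  shows "root_of (w \<otimes> s \<otimes> inv w) (\<lambda>r. - rho w (unit_vec s) r)"
proof -
  have "bil (\<lambda>r. - rho w (unit_vec s) r) x = - bil (rho w (unit_vec s)) x" for x
    using bil_scale(1) [of "-1" "rho w (unit_vec s)" x] by simp
  then show ?thesis
    unfolding root_of_def reflections_def
    using assms rho_Phi [of w "unit_vec s"] rho_reflection uminus_Phi by auto
qed

lemma root_exists: "t \<in> reflections G S \<Longrightarrow> \<exists>\<beta>. root_of t \<beta>"
proof -
  assume "t \<in> reflections G S"
  then obtain w s where ws: "w \<in> carrier G" "s \<in> S" "t = w \<otimes> s \<otimes> inv w"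
    unfolding reflections_def by blast
  then have "nonneg (rho w (unit_vec s)) \<or> nonpos (rho w (unit_vec s))"
    using Phi_signed rho_Phi unit_Phi by blast
  then show ?thesis
    using root_of_conj root_of_conj_neg ws by blast
qed

lemma reflection_exists:
  assumes "\<beta> \<in> Phi" "nonneg \<beta>"
  shows "\<exists>t. root_of t \<beta>"
  using assms root_of_conj unfolding Phi_def by blast

lemma root_of_inj_left: "root_of t \<beta> \<Longrightarrow> root_of u \<beta> \<Longrightarrow> t = u"
  unfolding root_of_def by (intro rho_inj) auto

lemma root_of_neg: "root_of t \<beta> \<Longrightarrow> rho t \<beta> = (\<lambda>r. - \<beta> r)"
  using Phi_norm unfolding root_of_def by (simp add: fun_eq_iff)

lemma root_of_inj_right:
  assumes "root_of t \<beta>" "root_of t \<gamma>"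
  shows "\<beta> = \<gamma>"
proof -
  define c where "c = bil \<gamma> \<beta> / 2"
  have P: "\<beta> \<in> Phi" "\<gamma> \<in> Phi" "nonneg \<beta>" "nonneg \<gamma>"
    using assms by (auto simp: root_of_def)
  have "(\<lambda>r. - \<beta> r) = (\<lambda>r. \<beta> r - bil \<gamma> \<beta> * \<gamma> r)"
    using root_of_neg [OF assms(1)] assms(2) by (simp add: root_of_def)
  then have "- \<beta> r = \<beta> r - bil \<gamma> \<beta> * \<gamma> r" for r
    by (rule fun_cong)
  then have e: "\<beta> = (\<lambda>r. c * \<gamma> r)"
    by (simp add: c_def fun_eq_iff field_simps)
  have "bil \<beta> \<beta> = c * (c * bil \<gamma> \<gamma>)"
    unfolding e bil_scale ..
  then have "c * c = 1"
    using Phi_norm [OF P(1)] Phi_norm [OF P(2)] by simp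
  moreover have "c \<noteq> - 1"
  proof
    assume "c = - 1"
    then have "nonpos \<beta>"
      using P(4) unfolding e by (simp add: nonneg_def nonpos_def)
    then show False
      using P Phi_not_both by blast
  qed
  ultimately have "c = 1"
    using square_eq_1_iff by blast
  then show ?thesis
    using e by simp
qed

lemma inv_cancel: "x \<in> carrier G \<Longrightarrow> y \<in> carrier G \<Longrightarrow> inv x \<otimes> (x \<otimes> y) = y"
  by (simp add: m_assoc [symmetric])

lemma root_of_sq: "root_of t \<beta> \<Longrightarrow> t \<otimes> t = \<one>"
proof -
  assume "root_of t \<beta>"
  then obtain w s where ws: "w \<in> carrier G" "s \<in> S" "t = w \<otimes> s \<otimes> inv w"
    unfolding root_of_def reflections_def by blast
  then have "t \<otimes> t = w \<otimes> (s \<otimes> (inv w \<otimes> (w \<otimes> (s \<otimes> inv w))))"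
    by (simp add: m_assoc)
  then show ?thesis
    using ws by (simp add: inv_cancel)
qed

text \<open>Strong exchange: multiplying by \<open>t\<close> deletes from a reduced word the letter
  whose root is \<open>\<beta>\<close>.\<close>

lemma inversion_len:
  assumes "root_of t \<beta>" "w \<in> carrier G" "\<beta> \<in> N w"
  shows "len (t \<otimes> w) < len w"
proof -
  obtain ws where ws: "reduced ws" "wp ws = w" "ws \<in> lists S"
    using reduced_exists assms(2) by blast
  then have "\<beta> \<in> set (root_seq ws)"
    using set_root_seq assms(3) by blast
  then obtain xs a ys where xs: "ws = xs @ a # ys" "act xs (unit_vec a) = \<beta>"
    by (rule root_seq_split)
  have l: "xs \<in> lists S" "a \<in> S" "ys \<in> lists S"
    using ws xs by auto
  have c: "wp xs \<in> carrier G" "wp ys \<in> carrier G"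
    using l by auto
  have "root_of (wp xs \<otimes> a \<otimes> inv (wp xs)) \<beta>"
    using root_of_conj [OF c(1) l(2)] rho_wp [OF l(1)] xs(2) N_Phi(2) [OF assms(3)] by simp
  then have "t = wp xs \<otimes> a \<otimes> inv (wp xs)"
    using root_of_inj_left assms(1) by blast
  moreover have "w = wp xs \<otimes> (a \<otimes> wp ys)"
    using wp_append [OF l(1), of "a # ys"] l ws(2) xs(1) by simp
  ultimately have "t \<otimes> w = wp xs \<otimes> (a \<otimes> (inv (wp xs) \<otimes> (wp xs \<otimes> (a \<otimes> wp ys))))"
    using c l by (simp add: m_assoc)
  then have "t \<otimes> w = wp (xs @ ys)"
    using c l wp_append [OF l(1,3)] by (simp add: inv_cancel)
  moreover have "xs @ ys \<in> lists S"
    using l by auto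
  ultimately have "len (t \<otimes> w) \<le> length (xs @ ys)"
    by (metis len_le)
  then show ?thesis
    using ws xs by (simp add: reduced_def)
qed

text \<open>\<open>t\<close> negates \<open>\<beta>\<close>, so \<open>\<beta>\<close> lies in
  \<open>N w\<close> or in \<open>N (t \<otimes> w)\<close>; in the second case
  \<open>inversion_len\<close> makes \<open>w\<close> the shorter of the two.\<close>

lemma inversions_iff:
  assumes "root_of t \<beta>" "w \<in> carrier G"
  shows "t \<in> inversions G S w \<longleftrightarrow> \<beta> \<in> N w"
proof
  assume "\<beta> \<in> N w"
  then show "t \<in> inversions G S w"
    using inversion_len [OF assms] assms(1) by (simp add: inversions_def root_of_def)
next
  assume "t \<in> inversions G S w"
  then have l: "len (t \<otimes> w) < len w"
    by (simp add: inversions_def)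
  have t: "t \<in> carrier G" "\<beta> \<in> Phi" "nonneg \<beta>"
    using assms(1) by (auto simp: root_of_def)
  show "\<beta> \<in> N w"
  proof (rule ccontr)
    assume "\<beta> \<notin> N w"
    then have "nonneg (rho (inv w) \<beta>)"
      using notin_N t assms(2) by blast
    moreover have "inv (t \<otimes> w) = inv w \<otimes> t"
      using root_of_sq [OF assms(1)] t assms(2) by (simp add: inv_mult_group inv_equality)
    then have "rho (inv (t \<otimes> w)) \<beta> = (\<lambda>r. - rho (inv w) \<beta> r)"
      using root_of_neg [OF assms(1)] t assms(2) by (simp add: rho_mult rho_uminus)
    ultimately have "\<beta> \<in> N (t \<otimes> w)"
      using t by (simp add: N_def)
    then have "len (t \<otimes> (t \<otimes> w)) < len (t \<otimes> w)"
      using inversion_len assms t by simp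
    moreover have "t \<otimes> (t \<otimes> w) = w"
      using root_of_sq [OF assms(1)] t assms(2) by (simp flip: m_assoc)
    ultimately show False
      using l by simp
  qed
qed

lemma weak_le_iff:
  assumes "v \<in> carrier G" "w \<in> carrier G"
  shows "weak_le G S v w \<longleftrightarrow> N v \<subseteq> N w"
proof
  assume le: "weak_le G S v w"
  show "N v \<subseteq> N w"
  proof
    fix \<beta>
    assume b: "\<beta> \<in> N v"
    then obtain t where t: "root_of t \<beta>"
      using reflection_exists N_Phi by blast
    then show "\<beta> \<in> N w"
      using b le inversions_iff assms unfolding weak_le_def by blast
  qed
next
  assume sub: "N v \<subseteq> N w"
  show "weak_le G S v w"
    unfolding weak_le_def
  proof
    fix t
    assume t: "t \<in> inversions G S v"
    then obtain \<beta> where "root_of t \<beta>"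
      using root_exists unfolding inversions_def by blast
    then show "t \<in> inversions G S w"
      using t sub inversions_iff assms by blast
  qed
qed

lemma weak_less_iff:
  assumes "v \<in> carrier G" "w \<in> carrier G"
  shows "weak_less G S v w \<longleftrightarrow> N v \<subset> N w"
  using weak_le_iff [OF assms] N_inj [OF assms] unfolding weak_less_def by blast

text \<open>\<open>v\<close> is a prefix of \<open>w\<close>, and the last letter of a reduced word
  for the remaining factor is a descent whose removal still leaves \<open>v\<close> as a
  prefix.\<close>

lemma below_descent:
  assumes "v \<in> carrier G" "w \<in> carrier G" "N v \<subset> N w"
  shows "\<exists>r\<in>S. nonpos (rho w (unit_vec r)) \<and> N v \<subseteq> N (w \<otimes> r)"
proof -
  define z where "z = inv v \<otimes> w"
  have zc: "z \<in> carrier G" and w: "w = v \<otimes> z"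
    using assms by (simp_all add: z_def m_assoc [symmetric])
  have l: "len w = len v + len z"
    using N_subset_prefix assms unfolding z_def by blast
  have "z \<noteq> \<one>"
    using w assms by auto
  obtain zs where zs: "reduced zs" "wp zs = z" "zs \<in> lists S"
    using reduced_exists zc by blast
  with \<open>z \<noteq> \<one>\<close> have "zs \<noteq> []"
    by auto
  then obtain us r where us: "zs = us @ [r]"
    by (metis rev_exhaust)
  have r: "r \<in> S" and usS: "us \<in> lists S"
    using zs us by auto
  obtain vs where vs: "reduced vs" "wp vs = v" "vs \<in> lists S"
    using reduced_exists assms(1) by blast
  have ww: "wp (vs @ us @ [r]) = w"
    using wp_append [OF vs(3) zs(3)] vs zs us w by simp
  moreover have "vs @ us @ [r] \<in> lists S"
    using vs usS r by auto
  ultimately have rd: "reduced ((vs @ us) @ [r])"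
    using l vs(1,2) zs(1,2) us by (simp add: reduced_def)
  have vu: "vs @ us \<in> lists S"
    using vs usS by auto
  have rv: "reduced (vs @ us)"
    using reduced_append(1) [OF rd] .
  have wr: "w = wp (vs @ us) \<otimes> r"
    using wp_append [OF vu, of "[r]"] r ww by simp
  then have wr': "w \<otimes> r = wp (vs @ us)"
    using wp_closed [OF vu] r by simp
  have "len w = Suc (len (w \<otimes> r))"
    using rd rv ww unfolding wr' by (simp add: reduced_def)
  then have "nonpos (rho w (unit_vec r))"
    using rho_unit_nonpos_iff assms r by blast
  moreover have "N v \<subseteq> N (w \<otimes> r)"
    using set_root_seq [OF rv] set_root_seq [OF vs(1)] vs(2) unfolding wr' by (auto simp: root_seq_append)
  ultimately show ?thesis
    using r by blast
qed

lemma weak_covers_iff: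
  assumes "w \<in> carrier G" "v \<in> carrier G"
  shows "weak_covers G S w v \<longleftrightarrow> (\<exists>r\<in>S. nonpos (rho w (unit_vec r)) \<and> v = w \<otimes> r)"
proof
  assume cov: "weak_covers G S w v"
  then have "N v \<subset> N w"
    using weak_less_iff assms unfolding weak_covers_def by blast
  then obtain r where r: "r \<in> S" "nonpos (rho w (unit_vec r))" "N v \<subseteq> N (w \<otimes> r)"
    using below_descent assms by blast
  have wr: "w \<otimes> r \<in> carrier G"
    using r assms by simp
  have "N (w \<otimes> r) \<subset> N w"
    using N_mult_S_descent [OF assms(1) r(1,2)] by blast
  then have "weak_less G S (w \<otimes> r) w"
    using weak_less_iff assms wr by blast
  then have "\<not> weak_less G S v (w \<otimes> r)"
    using cov wr unfolding weak_covers_def by blast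
  then have "N v = N (w \<otimes> r)"
    using r(3) weak_less_iff assms wr by blast
  then show "\<exists>r\<in>S. nonpos (rho w (unit_vec r)) \<and> v = w \<otimes> r"
    using N_inj assms wr r by blast
next
  assume "\<exists>r\<in>S. nonpos (rho w (unit_vec r)) \<and> v = w \<otimes> r"
  then obtain r where r: "r \<in> S" "nonpos (rho w (unit_vec r))" "v = w \<otimes> r"
    by blast
  note Nd = N_mult_S_descent [OF assms(1) r(1,2)]
  have "weak_less G S v w"
    using weak_less_iff assms Nd r(3) by blast
  moreover have False if x: "x \<in> carrier G" "weak_less G S v x" "weak_less G S x w" for x
  proof -
    have "N v \<subset> N x" "N x \<subset> N w"
      using x weak_less_iff assms by blast+
    then show False
      using Nd unfolding r(3) by blast
  qed
  ultimately show "weak_covers G S w v"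
    unfolding weak_covers_def by blast
qed

lemma cover_reflections_iff:
  assumes "w \<in> carrier G"
  shows "t \<in> cover_reflections G S w \<longleftrightarrow>
    (\<exists>r\<in>S. nonpos (rho w (unit_vec r)) \<and> root_of t (\<lambda>x. - rho w (unit_vec r) x))"
proof
  assume t: "t \<in> cover_reflections G S w"
  then obtain s where s: "s \<in> S" "t \<otimes> w = w \<otimes> s" and ti: "t \<in> inversions G S w"
    unfolding cover_reflections_def by blast
  obtain \<beta> where b: "root_of t \<beta>"
    using root_exists ti unfolding inversions_def by blast
  then have tc: "t \<in> carrier G"
    by (simp add: root_of_def)
  then have e: "t = w \<otimes> s \<otimes> inv w"
    using s assms by (simp add: inv_solve_right)
  have "len (w \<otimes> s) < len w"
    using ti s(2) by (simp add: inversions_def)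
  then have "len w = Suc (len (w \<otimes> s))"
    using len_mult_S [OF assms s(1)] by linarith
  then have "nonpos (rho w (unit_vec s))"
    using rho_unit_nonpos_iff assms s by blast
  then show "\<exists>r\<in>S. nonpos (rho w (unit_vec r)) \<and> root_of t (\<lambda>x. - rho w (unit_vec r) x)"
    using root_of_conj_neg assms s e by blast
next
  assume "\<exists>r\<in>S. nonpos (rho w (unit_vec r)) \<and> root_of t (\<lambda>x. - rho w (unit_vec r) x)"
  then obtain r where r: "r \<in> S" "nonpos (rho w (unit_vec r))"
    "root_of t (\<lambda>x. - rho w (unit_vec r) x)"
    by blast
  have "t = w \<otimes> r \<otimes> inv w"
    using root_of_conj_neg [OF assms r(1,2)] root_of_inj_left r(3) by blast
  then have "t \<otimes> w = w \<otimes> r"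
    using assms r(1) by (simp add: m_assoc)
  moreover have "t \<in> inversions G S w"
    using inversions_iff [OF r(3) assms] N_mult_S_descent(1) [OF assms r(1,2)] by blast
  ultimately show "t \<in> cover_reflections G S w"
    using r(1) unfolding cover_reflections_def by blast
qed

end

section \<open>Sorting positions\<close>

text \<open>Deleting the first position of the infinite word of \<open>s # cs\<close> leaves the
  infinite word of the rotation \<open>cs @ [s]\<close>.\<close>

lemma subword_at_rotate: "subword_at (s # cs) (map Suc ps) = subword_at (cs @ [s]) ps"
proof -
  have "(s # cs) ! (Suc p mod Suc (length cs)) = (cs @ [s]) ! (p mod Suc (length cs))" for p
    using nth_rotate1 [of "p mod Suc (length cs)" "s # cs"] by (simp add: mod_Suc_eq)
  then show ?thesis
    by (simp add: subword_at_def)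
qed

lemma sorted_positions_cases:
  assumes "sorted_wrt (<) (ps :: nat list)"
  obtains qs where "ps = map Suc qs" | qs where "ps = 0 # map Suc qs"
proof -
  have pos: "\<exists>qs. xs = map Suc qs" if "0 \<notin> set xs" for xs :: "nat list"
  proof -
    have "Suc (x - 1) = x" if "x \<in> set xs" for x
    proof -
      have "x \<noteq> 0"
        using that \<open>0 \<notin> set xs\<close> by metis
      then show ?thesis
        by simp
    qed
    then have "map Suc (map (\<lambda>p. p - 1) xs) = xs"
      by (simp add: map_idI)
    then show ?thesis
      by metis
  qed
  show ?thesis
  proof (cases "0 \<in> set ps")
    case False
    then show ?thesis using pos that by blast
  next
    case True
    then obtain p xs where ps: "ps = p # xs"
      by (cases ps) auto
    then have "p = 0" "0 \<notin> set xs"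
      using assms True by auto
    then show ?thesis using pos that ps by blast
  qed
qed

lemma lex_map_Suc:
  "length xs = length ys \<Longrightarrow> (map Suc xs, map Suc ys) \<in> lex less_than \<longleftrightarrow> (xs, ys) \<in> lex less_than"
  by (induction xs ys rule: list_induct2) auto

lemma lex_less_than_total:
  "length xs = length (ys :: nat list) \<Longrightarrow> xs = ys \<or> (xs, ys) \<in> lex less_than \<or> (ys, xs) \<in> lex less_than"
  by (induction xs ys rule: list_induct2) auto

text \<open>
  \<open>nested c A ps\<close>: every letter at a position of \<open>ps\<close> beyond the first copy of \<open>c\<close> also occurs at
  the corresponding position of the preceding copy, and the letters in the first copy lie in \<open>A\<close>.
  The parameter \<open>A\<close> makes the property invariant under removal of the first position of \<open>c\<^sup>\<infinity>\<close>.
\<close>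

definition nested :: "'a list \<Rightarrow> 'a set \<Rightarrow> nat list \<Rightarrow> bool" where
  "nested c A ps \<longleftrightarrow>
     (\<forall>p\<in>set ps. if p < length c then c ! p \<in> A else p - length c \<in> set ps)"

lemma nested_take:
  "nested (s # cs) A (0 # map Suc qs) \<longleftrightarrow> s \<in> A \<and> nested (cs @ [s]) A qs"
proof -
  let ?l = "\<lambda>p. if p < length (s # cs) then (s # cs) ! p \<in> A else p - length (s # cs) \<in> set (0 # map Suc qs)"
  let ?r = "\<lambda>p. if p < length (cs @ [s]) then (cs @ [s]) ! p \<in> A else p - length (cs @ [s]) \<in> set qs"
  have step: "?l (Suc p) \<longleftrightarrow> ?r p" if "s \<in> A" for p
  proof -
    consider "p < length cs" | "p = length cs" | d where "p = Suc (length cs) + d"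
      by (metis less_iff_Suc_add linorder_neqE_nat add_Suc)
    then show ?thesis
      by cases (use that in \<open>auto simp: nth_append\<close>)
  qed
  have "nested (s # cs) A (0 # map Suc qs) \<longleftrightarrow> ?l 0 \<and> (\<forall>p\<in>set qs. ?l (Suc p))"
    unfolding nested_def by (simp only: list.set(2) [of 0 "map Suc qs"] set_map ball_simps)
  also have "\<dots> \<longleftrightarrow> s \<in> A \<and> (\<forall>p\<in>set qs. ?r p)"
    using step by (cases "s \<in> A") simp_all
  finally show ?thesis
    by (simp only: nested_def)
qed

lemma nested_skip:
  assumes "s \<notin> set cs"
  shows "nested (s # cs) A (map Suc qs) \<longleftrightarrow> nested (cs @ [s]) (A - {s}) qs"
proof -
  have "(if Suc p < length (s # cs) then (s # cs) ! Suc p \<in> A else Suc p - length (s # cs) \<in> set (map Suc qs))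
      \<longleftrightarrow> (if p < length (cs @ [s]) then (cs @ [s]) ! p \<in> A - {s} else p - length (cs @ [s]) \<in> set qs)"
    for p
  proof -
    consider "p < length cs" | "p = length cs" | d where "p = Suc (length cs) + d"
      by (metis less_iff_Suc_add linorder_neqE_nat add_Suc)
    then show ?thesis
    proof cases
      case 1
      then have "cs ! p \<noteq> s"
        using assms nth_mem by metis
      then show ?thesis using 1 by (simp add: nth_append)
    qed (auto simp: nth_append)
  qed
  then show ?thesis
    by (simp add: nested_def)
qed

text \<open>The letters of \<open>c\<close> are distinct, so copy and letter determine a position;
  inclusion of letter sets becomes a shift by \<open>length c\<close>.\<close>

lemma copy_letters_nested:
  assumes "distinct c" "c \<noteq> []"
  shows "(\<forall>i. copy_letters c ps (Suc i) \<subseteq> copy_letters c ps i) \<longleftrightarrow> nested c (set c) ps"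
proof
  assume L: "\<forall>i. copy_letters c ps (Suc i) \<subseteq> copy_letters c ps i"
  show "nested c (set c) ps"
    unfolding nested_def
  proof
    fix p
    assume p: "p \<in> set ps"
    have "p - length c \<in> set ps" if ge: "\<not> p < length c"
    proof -
      have n: "length c > 0"
        using assms by simp
      define i where "i = p div length c - 1"
      have "p div length c \<noteq> 0"
        using ge n by (simp add: div_eq_0_iff)
      then have i: "p div length c = Suc i"
        by (simp add: i_def)
      then have "c ! (p mod length c) \<in> copy_letters c ps (Suc i)"
        using p unfolding copy_letters_def by blast
      then have "c ! (p mod length c) \<in> copy_letters c ps i"
        using L by blast
      then obtain q where q: "q \<in> set ps" "q div length c = i"
        "c ! (q mod length c) = c ! (p mod length c)"
        unfolding copy_letters_def by auto
      then have "q mod length c = p mod length c"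
        using assms(1) n by (simp add: nth_eq_iff_index_eq)
      then have "p = q + length c"
        using q(2) i div_mult_mod_eq [of p "length c"] div_mult_mod_eq [of q "length c"] by simp
      then show ?thesis
        using q by simp
    qed
    then show "if p < length c then c ! p \<in> set c else p - length c \<in> set ps"
      by simp
  qed
next
  assume Q: "nested c (set c) ps"
  show "\<forall>i. copy_letters c ps (Suc i) \<subseteq> copy_letters c ps i"
  proof (intro allI subsetI)
    fix i x
    assume "x \<in> copy_letters c ps (Suc i)"
    then obtain p where p: "p \<in> set ps" "p div length c = Suc i" "x = c ! (p mod length c)"
      unfolding copy_letters_def by auto
    then have ge: "\<not> p < length c"
      by auto
    then have "p - length c \<in> set ps"
      using Q p unfolding nested_def by auto
    moreover have "(p - length c) div length c = i"
      using p(2) ge by (simp add: le_div_geq assms(2))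
    moreover have "(p - length c) mod length c = p mod length c"
      using ge by (simp add: le_mod_geq)
    ultimately show "x \<in> copy_letters c ps i"
      unfolding copy_letters_def p(3) by (metis (mono_tags, lifting) image_eqI mem_Collect_eq)
  qed
qed

section \<open>Lexicographically first positions and recursive sortability\<close>

context coxeter
begin

lemma reduced_positions_skip:
  "reduced_positions G S (s # cs) w (map Suc qs) \<longleftrightarrow> reduced_positions G S (cs @ [s]) w qs"
  by (simp add: reduced_positions_def subword_at_rotate sorted_wrt_map)

lemma reduced_positions_take:
  assumes "s \<in> S" "w \<in> carrier G"
  shows "reduced_positions G S (s # cs) w (0 # map Suc qs) \<longleftrightarrow>
    unit_vec s \<in> N w \<and> reduced_positions G S (cs @ [s]) (s \<otimes> w) qs"
proof -
  have r: "reduced_word_for G S w (s # ws) \<longleftrightarrow> unit_vec s \<in> N w \<and> reduced_word_for G S (s \<otimes> w) ws" for ws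
  proof
    assume "reduced_word_for G S w (s # ws)"
    then have r: "reduced (s # ws)" "wp (s # ws) = w"
      by (auto simp: reduced_word_for_def reduced_def)
    then have "wp ws = s \<otimes> w" "reduced ws" "ws \<in> lists S"
      using assms reduced_Cons [of s ws] by (auto simp: reduced_def)
    moreover have "unit_vec s \<in> N w"
      using set_root_seq [OF r(1)] r(2) by auto
    ultimately show "unit_vec s \<in> N w \<and> reduced_word_for G S (s \<otimes> w) ws"
      by (simp add: reduced_word_for_def reduced_def)
  next
    assume a: "unit_vec s \<in> N w \<and> reduced_word_for G S (s \<otimes> w) ws"
    then show "reduced_word_for G S w (s # ws)"
      using N_descend(3) [OF assms(2,1)] assms by (simp add: reduced_word_for_def)
  qed
  have "subword_at (s # cs) (0 # map Suc qs) = s # subword_at (cs @ [s]) qs"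
    by (simp flip: subword_at_rotate) (simp add: subword_at_def)
  then show ?thesis
    unfolding reduced_positions_def using r by (auto simp: sorted_wrt_map)
qed

lemma reduced_positions_length:
  "reduced_positions G S c w ps \<Longrightarrow> length ps = len w"
  by (auto simp: reduced_positions_def reduced_word_for_def subword_at_def)

lemma reduced_positions_exist:
  assumes "set c = S" "w \<in> carrier G"
  shows "\<exists>ps. reduced_positions G S c w ps"
proof -
  obtain ws where ws: "ws \<in> lists S" "wp ws = w" "length ws = len w"
    using reduced_word_exists assms by blast
  have "\<exists>j. \<forall>x\<in>S. j x < length c \<and> c ! j x = x"
    using assms(1) by (intro exI [of _ "\<lambda>x. SOME i. i < length c \<and> c ! i = x"])
      (metis (mono_tags, lifting) in_set_conv_nth someI_ex)
  then obtain j where j: "\<And>x. x \<in> S \<Longrightarrow> j x < length c \<and> c ! j x = x"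
    by blast
  \<comment> \<open>The \<open>i\<close>-th letter is taken from copy \<open>i\<close>, so the
    positions increase whatever the word.\<close>
  define ps where "ps = map (\<lambda>i. i * length c + j (ws ! i)) [0..<length ws]"
  have jw: "j (ws ! i) < length c" "c ! j (ws ! i) = ws ! i" if "i < length ws" for i
    using j ws(1) that by auto
  have "sorted_wrt (<) ps"
    unfolding sorted_wrt_iff_nth_less
  proof (intro allI impI)
    fix i i'
    assume i: "i < i'" "i' < length ps"
    then have "i * length c + j (ws ! i) < Suc i * length c"
      using jw [of i] by (simp add: ps_def)
    also have "\<dots> \<le> i' * length c"
      using i by (intro mult_le_mono1) simp
    finally show "ps ! i < ps ! i'"
      using i by (simp add: ps_def)
  qed
  moreover have "subword_at c ps = ws"
    using jw by (intro nth_equalityI) (auto simp: subword_at_def ps_def)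
  ultimately show ?thesis
    using ws by (auto simp: reduced_positions_def reduced_word_for_def)
qed

lemma sorting_positions_exist:
  assumes "set c = S" "w \<in> carrier G"
  shows "\<exists>ps. sorting_positions G S c w ps"
proof -
  have wf: "wf (lex less_than)"
    by (intro wf_lex wf_less_than)
  obtain ps0 where ps0: "ps0 \<in> Collect (reduced_positions G S c w)"
    using reduced_positions_exist [OF assms] by blast
  obtain ps where "ps \<in> Collect (reduced_positions G S c w)"
    and "\<And>qs. (qs, ps) \<in> lex less_than \<Longrightarrow> qs \<notin> Collect (reduced_positions G S c w)"
    by (rule wfE_min [OF wf ps0]) (rule that)
  then have ps: "reduced_positions G S c w ps"
    and min: "\<And>qs. (qs, ps) \<in> lex less_than \<Longrightarrow> \<not> reduced_positions G S c w qs"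
    by simp_all
  have "ps = qs \<or> (ps, qs) \<in> lex less_than" if qs: "reduced_positions G S c w qs" for qs
  proof -
    have "length ps = length qs"
      using reduced_positions_length ps qs by metis
    then show ?thesis
      using lex_less_than_total min qs by blast
  qed
  then show ?thesis
    using ps unfolding sorting_positions_def by blast
qed

text \<open>As \<open>s\<close> is a left descent, some reduced subword uses position 0. It precedes
  all those that do not, so the lexicographically first one uses it too.\<close>

lemma sorting_positions_take:
  assumes "sorting_positions G S (s # cs) w ps" "set (s # cs) = S" "w \<in> carrier G" "unit_vec s \<in> N w"
  obtains qs where "ps = 0 # map Suc qs" "sorting_positions G S (cs @ [s]) (s \<otimes> w) qs"
proof -
  have s: "s \<in> S" using assms by auto
  have rp: "reduced_positions G S (s # cs) w ps"
    and least: "\<And>qs. reduced_positions G S (s # cs) w qs \<Longrightarrow> ps = qs \<or> (ps, qs) \<in> lex less_than"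
    using assms(1) by (auto simp: sorting_positions_def)
  note rp_take = reduced_positions_take [OF s assms(3), of cs]
  have c: "set (cs @ [s]) = S"
    using assms(2) by auto
  have "s \<otimes> w \<in> carrier G"
    using s assms(3) by simp
  then obtain xs where "reduced_positions G S (cs @ [s]) (s \<otimes> w) xs"
    using reduced_positions_exist [OF c] by blast
  then have "reduced_positions G S (s # cs) w (0 # map Suc xs)"
    using rp_take assms(4) by simp
  then have "ps = 0 # map Suc xs \<or> (ps, 0 # map Suc xs) \<in> lex less_than"
    using least by blast
  then have nz: "ps \<noteq> map Suc qs" for qs
    by (cases qs) auto
  have "sorted_wrt (<) ps"
    using rp by (simp add: reduced_positions_def)
  then obtain qs where qs: "ps = 0 # map Suc qs"
    using nz by (metis sorted_positions_cases)
  have "reduced_positions G S (cs @ [s]) (s \<otimes> w) qs"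
    using rp unfolding qs rp_take by simp
  moreover have "qs = ys \<or> (qs, ys) \<in> lex less_than"
    if ys: "reduced_positions G S (cs @ [s]) (s \<otimes> w) ys" for ys
  proof -
    have "reduced_positions G S (s # cs) w (0 # map Suc ys)"
      using rp_take assms(4) ys by simp
    then have l: "ps = 0 # map Suc ys \<or> (ps, 0 # map Suc ys) \<in> lex less_than"
      using least by blast
    have "length qs = length ys"
      using reduced_positions_length ys calculation by metis
    then show ?thesis
      using l unfolding qs by (auto simp: lex_map_Suc)
  qed
  ultimately have "sorting_positions G S (cs @ [s]) (s \<otimes> w) qs"
    by (simp add: sorting_positions_def)
  then show ?thesis
    using that qs by blast
qed

lemma sorting_positions_skip:
  assumes "sorting_positions G S (s # cs) w ps" "s \<in> S" "w \<in> carrier G" "unit_vec s \<notin> N w"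
  obtains qs where "ps = map Suc qs" "sorting_positions G S (cs @ [s]) w qs"
proof -
  have rp: "reduced_positions G S (s # cs) w ps"
    and least: "\<And>qs. reduced_positions G S (s # cs) w qs \<Longrightarrow> ps = qs \<or> (ps, qs) \<in> lex less_than"
    using assms(1) by (auto simp: sorting_positions_def)
  have nz: "ps \<noteq> 0 # map Suc qs" for qs
    using rp reduced_positions_take [OF assms(2,3)] assms(4) by blast
  have "sorted_wrt (<) ps"
    using rp by (simp add: reduced_positions_def)
  then obtain qs where qs: "ps = map Suc qs"
    using nz by (metis sorted_positions_cases)
  have rq: "reduced_positions G S (cs @ [s]) w qs"
    using rp unfolding qs reduced_positions_skip .
  have "qs = ys \<or> (qs, ys) \<in> lex less_than"
    if ys: "reduced_positions G S (cs @ [s]) w ys" for ys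
  proof -
    have "ps = map Suc ys \<or> (ps, map Suc ys) \<in> lex less_than"
      using least ys reduced_positions_skip by blast
    moreover have "length qs = length ys"
      using reduced_positions_length ys rq by metis
    ultimately show ?thesis
      unfolding qs by (auto simp: lex_map_Suc)
  qed
  with rq have "sorting_positions G S (cs @ [s]) w qs"
    by (simp add: sorting_positions_def)
  then show ?thesis
    using that qs by blast
qed

text \<open>The positions keep running over all of \<open>c\<close>, whereas \<open>sortable\<close>
  discards skipped letters for good; the set \<open>A\<close> of letters still allowed reconciles
  the two. In the measure, \<open>Suc\<close> makes the removed position 0 count.\<close>

lemma sorting_positions_sortable:
  assumes "sorting_positions G S c w ps" "distinct c" "set c = S" "w \<in> carrier G"
  shows "sortable (filter (\<lambda>x. x \<in> A) c) w \<longleftrightarrow> nested c A ps"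
  using assms
proof (induction "sum_list (map Suc ps)" arbitrary: c w ps A rule: less_induct)
  case less
  show ?case
  \<comment> \<open>Without positions nothing decreases when a letter is skipped, so this case
    stands apart.\<close>
  proof (cases "ps = []")
    case True
    then have "w = \<one>"
      using less.prems by (auto simp: sorting_positions_def reduced_positions_def
          reduced_word_for_def subword_at_def)
    then show ?thesis
      using True sortable_one by (simp add: nested_def)
  next
    case False
    have "c \<noteq> []"
    proof
      assume "c = []"
      then have "S = {}"
        using less.prems by simp
      then show False
        using False less.prems(1) by (auto simp: sorting_positions_def reduced_positions_def
            reduced_word_for_def subword_at_def)
    qed
    then obtain s cs where c: "c = s # cs"
      by (cases c) auto
    have s: "s \<in> S" "s \<notin> set cs" and d: "distinct (cs @ [s])" "set (cs @ [s]) = S"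
      using less.prems c by auto
    have w: "w \<in> carrier G" by fact
    show ?thesis
    proof (cases "unit_vec s \<in> N w")
      case True
      obtain qs where qs: "ps = 0 # map Suc qs" "sorting_positions G S (cs @ [s]) (s \<otimes> w) qs"
        using sorting_positions_take [of s cs w ps] less.prems c True by blast
      have "sum_list (map Suc qs) \<le> sum_list (map (\<lambda>p. Suc (Suc p)) qs)"
        by (intro sum_list_mono) simp
      then have "sum_list (map Suc qs) < sum_list (map Suc ps)"
        unfolding qs by (simp add: comp_def)
      then have IH: "sortable (filter (\<lambda>x. x \<in> A) (cs @ [s])) (s \<otimes> w) \<longleftrightarrow> nested (cs @ [s]) A qs"
        using less.hyps [OF _ qs(2) d] s w by simp
      show ?thesis
      proof (cases "s \<in> A")
        case sA: True
        then show ?thesis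
          using IH sortable_Cons_take [OF True w] nested_take [of s cs A qs] unfolding c qs by simp
      next
        case sA: False
        have "\<not> sortable (filter (\<lambda>x. x \<in> A) c) w"
        proof
          assume "sortable (filter (\<lambda>x. x \<in> A) c) w"
          from N_supp [OF this _ _ True] have "supp (set (filter (\<lambda>x. x \<in> A) c)) (unit_vec s)"
            using less.prems by auto
          then show False
            using sA by simp
        qed
        then show ?thesis
          using sA nested_take [of s cs A qs] unfolding c qs by simp
      qed
    next
      case F: False
      obtain qs where qs: "ps = map Suc qs" "sorting_positions G S (cs @ [s]) w qs"
        using sorting_positions_skip [of s cs w ps] less.prems c F s by blast
      have "qs \<noteq> []"
        using False qs by auto
      then have "sum_list (map Suc qs) < sum_list (map (\<lambda>p. Suc (Suc p)) qs)"
        by (intro sum_list_strict_mono) auto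
      then have "sum_list (map Suc qs) < sum_list (map Suc ps)"
        unfolding qs by (simp add: comp_def)
      then have IH: "sortable (filter (\<lambda>x. x \<in> A - {s}) (cs @ [s])) w \<longleftrightarrow> nested (cs @ [s]) (A - {s}) qs"
        using less.hyps [OF _ qs(2) d w] by blast
      have "filter (\<lambda>x. x \<in> A - {s}) (cs @ [s]) = filter (\<lambda>x. x \<in> A) cs"
        using s by (auto intro!: filter_cong)
      then show ?thesis
        using IH nested_skip [OF s(2), of A qs] sortable_Cons_skip [OF F] unfolding c qs by simp
    qed
  qed
qed

theorem c_sortable_iff_sortable:
  assumes "distinct c" "set c = S"
  shows "c_sortable G S c w \<longleftrightarrow> sortable c w"
proof (cases "w \<in> carrier G")
  case w: True
  have key: "(\<forall>i. copy_letters c ps (Suc i) \<subseteq> copy_letters c ps i) \<longleftrightarrow> sortable c w"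
    if ps: "sorting_positions G S c w ps" for ps
  proof (cases "c = []")
    case True
    then have "S = {}"
      using assms by simp
    then have "ps = []" "w = \<one>"
      using ps by (auto simp: sorting_positions_def reduced_positions_def
          reduced_word_for_def subword_at_def)
    then show ?thesis
      using sortable_one by (simp add: copy_letters_def)
  next
    case False
    have "filter (\<lambda>x. x \<in> set c) c = c"
      by (simp add: filter_id_conv)
    then show ?thesis
      using sorting_positions_sortable [OF ps assms w, of "set c"] copy_letters_nested [OF assms(1) False]
      by simp
  qed
  then show ?thesis
    using sorting_positions_exist [OF assms(2) w] w unfolding c_sortable_def by blast
next
  case False
  then show ?thesis
    using sortable_closed unfolding c_sortable_def by blast
qed

theorem least_sortable_with_inversion:
  assumes "distinct cs" "set cs = S" "c_accessible G S cs t"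
  shows "\<exists>j. (c_sortable G S cs j \<and> join_irreducible G S j \<and> cover_reflections G S j = {t})
           \<and> (\<forall>j'. c_sortable G S cs j' \<and> join_irreducible G S j' \<and> cover_reflections G S j' = {t}
                  \<longrightarrow> j' = j)
           \<and> (\<forall>x. weak_minimal G S {w. c_sortable G S cs w \<and> t \<in> inversions G S w} x \<longleftrightarrow> x = j)"
proof -
  note sortable = c_sortable_iff_sortable [OF assms(1,2)]
  have t: "t \<in> reflections G S"
    using assms(3) by (simp add: c_accessible_def)
  then obtain \<tau> where \<tau>: "root_of t \<tau>"
    using root_exists by blast
  have inv: "t \<in> inversions G S w \<longleftrightarrow> \<tau> \<in> N w" if "sortable cs w" for w
    using inversions_iff [OF \<tau>] sortable_closed that by blast
  obtain w where "sortable cs w" "\<tau> \<in> N w"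
    using assms(3) inv sortable unfolding c_accessible_def by blast
  then obtain j r where j: "sortable cs j" "\<tau> \<in> N j"
    and least: "\<And>w'. sortable cs w' \<Longrightarrow> \<tau> \<in> N w' \<Longrightarrow> N j \<subseteq> N w'"
    and r: "r \<in> S" "rho j (unit_vec r) = (\<lambda>x. - \<tau> x)"
    and only: "\<And>r'. r' \<in> S \<Longrightarrow> nonpos (rho j (unit_vec r')) \<Longrightarrow> r' = r"
    using sortable_least_with_inversion [OF _ assms(1)] assms(2) by (metis order_refl)
  have jc: "j \<in> carrier G"
    using sortable_closed j by blast
  have nr: "nonpos (rho j (unit_vec r))"
    using \<tau> r(2) by (simp add: root_of_def)
  have mr: "(\<lambda>x. - rho j (unit_vec r) x) = \<tau>"
    using r(2) by simp
  have desc: "r' \<in> S \<and> nonpos (rho j (unit_vec r')) \<longleftrightarrow> r' = r" for r'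
    using only r(1) nr by blast
  have "weak_covers G S j v \<longleftrightarrow> v = j \<otimes> r" if "v \<in> carrier G" for v
    using weak_covers_iff [OF jc that] desc by metis
  then have ji: "join_irreducible G S j"
    using jc r(1) unfolding join_irreducible_def by (metis S_closed m_closed)
  have cov: "cover_reflections G S j = {t}"
  proof -
    have "x \<in> cover_reflections G S j \<longleftrightarrow> root_of x \<tau>" for x
      using cover_reflections_iff [OF jc, of x] desc mr by metis
    moreover have "root_of x \<tau> \<longleftrightarrow> x = t" for x
      using \<tau> root_of_inj_left by blast
    ultimately show ?thesis
      by auto
  qed
  \<comment> \<open>Another candidate \<open>j'\<close> lies strictly above \<open>j\<close>, so
    \<open>j\<close> is still below \<open>j' \<otimes> q\<close> for some descent \<open>q\<close>.
    The only cover reflection of \<open>j'\<close> is \<open>t\<close>, hence that step removes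
    \<open>\<tau>\<close>, an inversion of \<open>j\<close>.\<close>
  have uniq: "j' = j" if j': "sortable cs j'" "cover_reflections G S j' = {t}" for j'
  proof (rule ccontr)
    assume ne: "j' \<noteq> j"
    have jc': "j' \<in> carrier G"
      using sortable_closed j' by blast
    have "t \<in> inversions G S j'"
      using j'(2) unfolding cover_reflections_def by blast
    then have "N j \<subset> N j'"
      using least inv j'(1) N_inj [OF jc jc'] ne by blast
    then obtain q where q: "q \<in> S" "nonpos (rho j' (unit_vec q))" "N j \<subseteq> N (j' \<otimes> q)"
      using below_descent jc jc' by blast
    define b where "b = (\<lambda>x. - rho j' (unit_vec q) x)"
    have "root_of (j' \<otimes> q \<otimes> inv j') b"
      unfolding b_def using root_of_conj_neg jc' q by blast
    moreover from this have "j' \<otimes> q \<otimes> inv j' = t"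
      using cover_reflections_iff [OF jc'] q j'(2) unfolding b_def by blast
    ultimately have "b = \<tau>"
      using root_of_inj_right \<tau> by blast
    then have "\<tau> \<notin> N (j' \<otimes> q)"
      using N_mult_S_descent(2) [OF jc' q(1,2)] unfolding b_def by blast
    then show False
      using q(3) j(2) by blast
  qed
  have minimal: "weak_minimal G S {w. c_sortable G S cs w \<and> t \<in> inversions G S w} x \<longleftrightarrow> x = j" for x
  proof -
    have A: "{w. c_sortable G S cs w \<and> t \<in> inversions G S w} = {w. sortable cs w \<and> \<tau> \<in> N w}"
      using inv sortable by blast
    have jx: "weak_le G S j x" if "sortable cs x" "\<tau> \<in> N x" for x
      using least [OF that] weak_le_iff jc sortable_closed [OF that(1)] by blast
    show ?thesis
      unfolding A weak_minimal_def
    proof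
      assume "x \<in> {w. sortable cs w \<and> \<tau> \<in> N w} \<and> \<not> (\<exists>v\<in>{w. sortable cs w \<and> \<tau> \<in> N w}. weak_less G S v x)"
      then show "x = j"
        using j jx unfolding weak_less_def by blast
    next
      assume x: "x = j"
      have "\<not> weak_less G S v j" if v: "sortable cs v" "\<tau> \<in> N v" for v
      proof -
        have vc: "v \<in> carrier G"
          using sortable_closed v by blast
        show ?thesis
          using least [OF v] weak_less_iff [OF vc jc] by blast
      qed
      then show "x \<in> {w. sortable cs w \<and> \<tau> \<in> N w} \<and> \<not> (\<exists>v\<in>{w. sortable cs w \<and> \<tau> \<in> N w}. weak_less G S v x)"
        using j x by blast
    qed
  qed
  show ?thesis
    using j(1) ji cov uniq minimal sortable by (intro exI [of _ j]) blast
qed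

end

theorem theorem8p3:
  fixes G :: "('a, 'b) monoid_scheme" and S :: "'a set" and cs :: "'a list" and t :: 'a
  assumes "coxeter_system G S"
    and "finite S"
    and "coxeter_word S cs"
    and "c_accessible G S cs t"
  shows "\<exists>j. (c_sortable G S cs j \<and> join_irreducible G S j \<and> cover_reflections G S j = {t})
           \<and> (\<forall>j'. c_sortable G S cs j' \<and> join_irreducible G S j' \<and> cover_reflections G S j' = {t}
                  \<longrightarrow> j' = j)
           \<and> (\<forall>x. weak_minimal G S {w. c_sortable G S cs w \<and> t \<in> inversions G S w} x \<longleftrightarrow> x = j)"
proof -
  obtain m where "group G" "S \<subseteq> carrier G" "generate G S = carrier G" "coxeter_matrix S m"
    "\<forall>u\<in>lists S. \<forall>v\<in>lists S.
       word_prod G u = word_prod G v \<longleftrightarrow> equivclp (relator_step S m) u v"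
    using assms(1) unfolding coxeter_system_def by blast
  then interpret coxeter G S m
    using assms(2) by (auto intro!: coxeter.intro coxeter_form.intro coxeter_axioms.intro)
  show ?thesis
    using least_sortable_with_inversion assms(3,4) unfolding coxeter_word_def by blast
qed

end
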